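(* Fix $1\le p<2$ and a constant $0<\varepsilon<1$. There exist constants $c,C>0$ (depending only on $p,\varepsilon$) such that for all integers $d\ge2$ and $n\ge1$ there is a distribution over $r\times n$ real matrices $\Pi$ with $r\le Cd^2$, such that every matrix in the support has at most two non-zero entries in each column, the expected number of non-zero entries in each column is at most $1+\varepsilon$, and for every fixed $A\in\mathbb{R}^{n\times d}$, with probability at least $0.99$, simultaneously for all $x\in\mathbb{R}^d$, $$c\|Ax\|_p\le\|\Pi Ax\|_p\le C(d\log d)^{1/p}\|Ax\|_p.$$
   Context: $\|y\|_p=(\sum_i|y_i|^p)^{1/p}$. The distribution depends only on $n,d,p,\varepsilon$, not on $A$. *)

theory Defs
  imports "HOL-Probability.Probability"
begin

text \<open>Matrices are functions nat \<Rightarrow> nat \<Rightarrow> real (row index, column index);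
  vectors are functions nat \<Rightarrow> real; dimensions are carried explicitly.\<close>

definition lp_norm :: "real \<Rightarrow> nat \<Rightarrow> (nat \<Rightarrow> real) \<Rightarrow> real" where
  "lp_norm p m y = (\<Sum>i<m. \<bar>y i\<bar> powr p) powr (1 / p)"

definition mat_vec :: "nat \<Rightarrow> (nat \<Rightarrow> nat \<Rightarrow> real) \<Rightarrow> (nat \<Rightarrow> real) \<Rightarrow> (nat \<Rightarrow> real)" where
  "mat_vec k A x = (\<lambda>i. \<Sum>j<k. A i j * x j)"

definition matrix_space :: "(nat \<Rightarrow> nat \<Rightarrow> real) measure" where
  "matrix_space = PiM UNIV (\<lambda>_. PiM UNIV (\<lambda>_. borel))"

end

theory Submission
  imports Defs "HOL-Real_Asymp.Real_Asymp"
begin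

text \<open>
  Take \<open>r = K d\<^sup>2\<close> buckets and hash every column to one bucket with a random sign. The matrix
  stacks a multiple of this sparse embedding \<open>S\<close> on a second copy \<open>T\<close> in which the sign in
  column \<open>j\<close> is multiplied by \<open>D\<^sub>j\<close>, where \<open>D\<^sub>j\<^sup>p = 2\<^sup>k\<close> with probability \<open>\<epsilon> 2\<^sup>-\<^sup>k\<close> and \<open>D\<^sub>j = 0\<close>
  otherwise.

  Lower bound. Put \<open>m = K d ln d\<close> and let \<open>y\<close> have \<open>p\<close>-norm 1. If a constant part of the mass of
  \<open>y\<close> lies on entries with \<open>\<bar>y\<^sub>j\<bar>\<^sup>p \<le> 1/m\<close>, then with probability \<open>1 - exp (- c m)\<close> of the order
  of \<open>m\<close> buckets of \<open>T y\<close> have a \<open>p\<close>-th power of at least \<open>1/m\<close>; this beats the cardinality of a net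
  of mesh \<open>1/poly d\<close>. Otherwise the Euclidean norm of \<open>y\<close> is at least a multiple of
  \<open>m powr (1/2 - 1/p)\<close>; since \<open>S\<close> is a Euclidean subspace embedding and the \<open>p\<close>-norm dominates the
  Euclidean norm, it suffices to scale \<open>S\<close> by \<open>m powr (1/p - 1/2)\<close>.

  Upper bound. In a Lewis basis \<open>U\<close> of the column space the rows satisfy \<open>\<Sum>\<^sub>j \<parallel>u\<^sub>j\<parallel>\<^sub>2\<^sup>p \<le> 2 d\<close> and the
  \<open>p\<close>-norm of \<open>U x\<close> is at least half of the Euclidean norm of \<open>x\<close>, so moments of the rows of the sketch of
  \<open>U\<close>, truncated at levels that differ by a factor polynomial in \<open>d\<close>, give \<open>O(d log d)\<close>.
  The extra scaling of \<open>S\<close> is affordable because its heavy rows have bucket loads \<open>O(d)\<close> and its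
  light rows have small second moments.
\<close>

section \<open>Power inequalities and finite expectations\<close>

text \<open>Neither block suffices alone. On a coordinate vector \<open>T\<close> vanishes with
  probability at least \<open>1 - \<epsilon>\<close>; in \<open>S\<close> the signs cancel inside
  buckets, so its control is Euclidean, and the Euclidean norm is tiny on spread vectors. The tail
  of \<open>D_j^p\<close> is that of a p-stable variable: a light entry of mass \<open>a\<close> is
  lifted to mass \<open>1/m\<close> with probability of order \<open>\<epsilon> a m\<close>, hence
  the number of lifted entries is of order \<open>\<epsilon> m\<close> however the light mass is
  distributed. Only the lower bound on \<open>T\<close> needs a net; every other bound holds for all
  \<open>x\<close> at once because one random quantity (Frobenius norm, bucket load, Gram error)
  controls it. The mesh has to be polynomially small since \<open>T\<close> may expand the rounding
  error by a factor of order \<open>d log d\<close>; the net then has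
  \<open>exp (O (d ln d))\<close> points, which dictates \<open>m\<close>. The Gram error has second
  moment of order \<open>d^2 / r\<close>, which dictates \<open>r\<close>. All bad events are joined
  by a union bound, so the two blocks may share buckets and signs. The restriction
  \<open>p < 2\<close> makes a geometric series with ratio \<open>2 powr (2/p - 1)\<close> be
  dominated by its last term.\<close>

lemma powr_sum_le_card_powr_sum:
  fixes c :: "'a \<Rightarrow> real"
  assumes S: "finite S" and q: "1 \<le> q" and c: "\<And>i. i \<in> S \<Longrightarrow> 0 \<le> c i"
  shows "(\<Sum>i\<in>S. c i) powr q \<le> real (card S) powr (q - 1) * (\<Sum>i\<in>S. c i powr q)"
proof -
  \<comment> \<open>Jensen is applied to the positive terms only; dropping the zeros changes neither
    sum, and the smaller cardinality is absorbed by monotonicity at the end.\<close>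
  define P where "P = {i \<in> S. c i > 0}"
  have fP: "finite P" using S by (simp add: P_def)
  have s1: "(\<Sum>i\<in>S. c i) = (\<Sum>i\<in>P. c i)"
    using S c unfolding P_def by (intro sum.mono_neutral_right) (auto simp: order.order_iff_strict)
  have s2: "(\<Sum>i\<in>S. c i powr q) = (\<Sum>i\<in>P. c i powr q)"
    using S c unfolding P_def by (intro sum.mono_neutral_right) (auto simp: order.order_iff_strict)
  show ?thesis
  proof (cases "P = {}")
    case True
    then show ?thesis using s1 s2 by simp
  next
    case False
    define N where "N = real (card P)"
    have N: "N > 0" using False fP by (simp add: N_def card_gt_0_iff)
    have "(\<Sum>i\<in>P. (1 / N) *\<^sub>R c i) powr q \<le> (\<Sum>i\<in>P. (1 / N) * (c i powr q))"
      by (rule convex_on_sum[OF fP False powr_convex[OF q]]) (use N in \<open>auto simp: P_def N_def\<close>)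
    then have "((\<Sum>i\<in>P. c i) / N) powr q \<le> (\<Sum>i\<in>P. c i powr q) / N"
      by (simp add: sum_divide_distrib)
    then have "N powr q * ((\<Sum>i\<in>P. c i) / N) powr q \<le> N powr q * ((\<Sum>i\<in>P. c i powr q) / N)"
      by (intro mult_left_mono) auto
    also have "N powr q * ((\<Sum>i\<in>P. c i) / N) powr q = (\<Sum>i\<in>P. c i) powr q"
      using N by (subst powr_mult[symmetric]) (auto simp: P_def intro!: sum_nonneg)
    also have "N powr q * ((\<Sum>i\<in>P. c i powr q) / N) = N powr (q - 1) * (\<Sum>i\<in>P. c i powr q)"
      using N by (simp add: powr_diff)
    also have "... \<le> real (card S) powr (q - 1) * (\<Sum>i\<in>P. c i powr q)"
      using q S by (intro mult_right_mono powr_mono2 sum_nonneg) (auto simp: N_def P_def intro: card_mono)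
    finally show ?thesis using s1 s2 by simp
  qed
qed

lemma powr_add_le_sum_powr:
  fixes x y :: real
  assumes "0 \<le> x" "0 \<le> y" "0 < a" "a \<le> 1"
  shows "(x + y) powr a \<le> x powr a + y powr a"
proof (cases "x + y = 0")
  case True
  then show ?thesis using assms by simp
next
  case False
  then have s: "x + y > 0" using assms by simp
  have *: "t \<le> t powr a" if "0 \<le> t" "t \<le> 1" for t :: real
  proof (cases "t = 0")
    case False
    have "t powr 1 \<le> t powr a" by (rule powr_mono') (use that False assms in auto)
    then show ?thesis using that by simp
  qed (use assms in simp)
  have "1 = x / (x + y) + y / (x + y)" using s by (simp add: add_divide_distrib[symmetric])
  also have "... \<le> (x / (x + y)) powr a + (y / (x + y)) powr a"
    by (intro add_mono *) (use assms s in \<open>auto simp: divide_simps\<close>)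
  also have "... = (x powr a + y powr a) / (x + y) powr a"
    using assms by (simp add: powr_divide add_divide_distrib)
  finally show ?thesis using s by (simp add: divide_simps split: if_splits)
qed

lemma powr_sum_le_sum_powr:
  fixes c :: "'a \<Rightarrow> real"
  assumes "\<And>i. i \<in> S \<Longrightarrow> 0 \<le> c i" "0 < a" "a \<le> 1"
  shows "(\<Sum>i\<in>S. c i) powr a \<le> (\<Sum>i\<in>S. c i powr a)"
  using assms(1)
proof (induction S rule: infinite_finite_induct)
  case (insert x F)
  have "(c x + sum c F) powr a \<le> c x powr a + sum c F powr a"
    by (rule powr_add_le_sum_powr) (use insert assms in \<open>auto intro!: sum_nonneg\<close>)
  then show ?case using insert by fastforce
qed (use assms in auto)

text \<open>Concavity of \<open>powr a\<close>, derived from the convexity of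
  \<open>powr (1/a)\<close>: the power mean inequality is applied to the \<open>a\<close>-th powers,
  indexed by the two elements of \<open>bool\<close>.\<close>

lemma powr_avg_le_powr_avg:
  fixes x y :: real
  assumes "0 \<le> x" "0 \<le> y" "0 < a" "a \<le> 1"
  shows "(x powr a + y powr a) / 2 \<le> ((x + y) / 2) powr a"
proof -
  have "(\<Sum>b\<in>UNIV. if b then x powr a else y powr a) powr (1/a)
      \<le> real (card (UNIV :: bool set)) powr (1/a - 1) *
        (\<Sum>b\<in>UNIV. (if b then x powr a else y powr a) powr (1/a))"
    by (rule powr_sum_le_card_powr_sum) (use assms in auto)
  then have "(x powr a + y powr a) powr (1/a) \<le> 2 powr (1/a - 1) * (x + y)"
    using assms by (simp add: UNIV_bool powr_powr add.commute)
  then have "((x powr a + y powr a) powr (1/a)) powr a \<le> (2 powr (1/a - 1) * (x + y)) powr a"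
    using assms by (intro powr_mono2) auto
  then have "x powr a + y powr a \<le> 2 powr (1 - a) * (x + y) powr a"
    using assms by (simp add: powr_powr powr_mult left_diff_distrib)
  then show ?thesis using assms by (simp add: powr_divide powr_diff field_simps)
qed

lemma abs_add_powr_le:
  fixes a b :: real
  assumes "1 \<le> p" "p \<le> 2"
  shows "\<bar>a + b\<bar> powr p \<le> 2 * (\<bar>a\<bar> powr p + \<bar>b\<bar> powr p)"
proof -
  have "\<bar>a + b\<bar> powr p \<le> (\<bar>a\<bar> + \<bar>b\<bar>) powr p"
    using assms by (intro powr_mono2) auto
  also have "... = (\<Sum>i\<in>UNIV. if i then \<bar>a\<bar> else \<bar>b\<bar>) powr p" by (simp add: UNIV_bool add.commute)
  also have "... \<le> real (card (UNIV :: bool set)) powr (p - 1) * (\<Sum>i\<in>UNIV. (if i then \<bar>a\<bar> else \<bar>b\<bar>) powr p)"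
    by (rule powr_sum_le_card_powr_sum) (use assms in auto)
  also have "... = 2 powr (p - 1) * (\<bar>a\<bar> powr p + \<bar>b\<bar> powr p)" by (simp add: UNIV_bool add.commute)
  also have "... \<le> 2 powr 1 * (\<bar>a\<bar> powr p + \<bar>b\<bar> powr p)"
    using assms by (intro mult_right_mono powr_mono) auto
  finally show ?thesis by simp
qed

text \<open>Hoelder's inequality. The factor \<open>r powr (1 - p/2)\<close> is the price for
  turning a second moment into a \<open>p\<close>-th power; the truncation thresholds
  \<open>1/r\<close> and \<open>d/r\<close> used later are chosen so that it cancels.\<close>

lemma sum_abs_powr_le_card_powr:
  fixes z :: "nat \<Rightarrow> real"
  assumes "1 \<le> p" "p < 2"
  shows "(\<Sum>b<r. \<bar>z b\<bar> powr p) \<le> real r powr (1 - p/2) * (\<Sum>b<r. (z b)\<^sup>2) powr (p/2)"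
proof -
  have "(\<Sum>b<r. \<bar>z b\<bar> powr p) powr (2/p) \<le> real (card {..<r}) powr (2/p - 1) * (\<Sum>b<r. (\<bar>z b\<bar> powr p) powr (2/p))"
    by (rule powr_sum_le_card_powr_sum) (use assms in auto)
  also have "(\<Sum>b<r. (\<bar>z b\<bar> powr p) powr (2/p)) = (\<Sum>b<r. (z b)\<^sup>2)"
    using assms by (intro sum.cong) (auto simp: powr_powr)
  finally have "((\<Sum>b<r. \<bar>z b\<bar> powr p) powr (2/p)) powr (p/2) \<le> (real r powr (2/p - 1) * (\<Sum>b<r. (z b)\<^sup>2)) powr (p/2)"
    using assms by (intro powr_mono2) auto
  then show ?thesis using assms by (simp add: powr_powr powr_mult sum_nonneg algebra_simps)
qed

section \<open>Finite probability model of the sketch, revealed column by column\<close>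

abbreviation sq_norm :: "nat \<Rightarrow> (nat \<Rightarrow> real) \<Rightarrow> real" where
  "sq_norm d x \<equiv> \<Sum>k<d. (x k)\<^sup>2"

abbreviation mass :: "real \<Rightarrow> nat \<Rightarrow> (nat \<Rightarrow> real) \<Rightarrow> real" where
  "mass p n y \<equiv> \<Sum>j<n. \<bar>y j\<bar> powr p"

abbreviation prb :: "'a pmf \<Rightarrow> 'a set \<Rightarrow> real" where
  "prb \<equiv> measure_pmf.prob"

abbreviation avg :: "'a pmf \<Rightarrow> ('a \<Rightarrow> real) \<Rightarrow> real" where
  "avg \<equiv> measure_pmf.expectation"

text \<open>One sample carries bucket, sign and label of a column. Both blocks read the same bucket
  and sign; the label is the random level in the heavy block and is ignored by the sign
  sketch.\<close>

definition column_pmf :: "nat \<Rightarrow> 'l pmf \<Rightarrow> (nat \<times> bool \<times> 'l) pmf" where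
  "column_pmf r L = pair_pmf (pmf_of_set {..<r}) (pair_pmf (pmf_of_set UNIV) L)"

definition sketch_pmf :: "'j set \<Rightarrow> nat \<Rightarrow> 'l pmf \<Rightarrow> ('j \<Rightarrow> nat \<times> bool \<times> 'l) pmf" where
  "sketch_pmf J r L = Pi_pmf J undefined (\<lambda>_. column_pmf r L)"

definition sgn_of :: "bool \<Rightarrow> real" where
  "sgn_of s = (if s then 1 else - 1)"

text \<open>The coefficient may depend on the label, so that level-dependent truncations of a column
  are sketches of the same kind and add up linearly.\<close>

definition bucket_sum ::
  "'j set \<Rightarrow> ('j \<Rightarrow> 'l \<Rightarrow> real) \<Rightarrow> ('j \<Rightarrow> nat \<times> bool \<times> 'l) \<Rightarrow> nat \<Rightarrow> real" where
  "bucket_sum J c w b = (\<Sum>j\<in>J. case w j of (h, s, l) \<Rightarrow> if h = b then sgn_of s * c j l else 0)"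

abbreviation sign_sketch :: "nat \<Rightarrow> (nat \<Rightarrow> real) \<Rightarrow> (nat \<Rightarrow> nat \<times> bool \<times> 'l) \<Rightarrow> nat \<Rightarrow> real" where
  "sign_sketch n y \<equiv> bucket_sum {..<n} (\<lambda>j l. y j)"

lemma avg_mono:
  assumes "finite (set_pmf P)" "\<And>x. x \<in> set_pmf P \<Longrightarrow> f x \<le> g x"
  shows "avg P f \<le> avg P g"
  using assms by (intro integral_mono_AE integrable_measure_pmf_finite) (auto simp: AE_measure_pmf_iff)

lemma avg_add: "finite (set_pmf P) \<Longrightarrow> avg P (\<lambda>x. f x + g x) = avg P f + avg P g"
  by (intro Bochner_Integration.integral_add integrable_measure_pmf_finite)

lemma avg_sum: "finite (set_pmf P) \<Longrightarrow> avg P (\<lambda>x. \<Sum>i\<in>I. f i x) = (\<Sum>i\<in>I. avg P (f i))"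
  by (intro Bochner_Integration.integral_sum integrable_measure_pmf_finite)

lemma avg_swap:
  assumes "finite (set_pmf P)" "finite (set_pmf Q)"
  shows "avg P (\<lambda>x. avg Q (F x)) = avg Q (\<lambda>y. avg P (\<lambda>x. F x y))"
proof -
  have "avg P (\<lambda>x. avg Q (F x)) = (\<Sum>x\<in>set_pmf P. \<Sum>y\<in>set_pmf Q. pmf P x * pmf Q y * F x y)"
    using assms
    by (subst integral_measure_pmf[of "set_pmf P"], simp, simp,
        subst integral_measure_pmf[of "set_pmf Q"], simp, simp)
       (simp add: sum_distrib_left mult.assoc)
  also have "... = (\<Sum>y\<in>set_pmf Q. \<Sum>x\<in>set_pmf P. pmf P x * pmf Q y * F x y)"
    by (rule sum.swap)
  also have "... = avg Q (\<lambda>y. avg P (\<lambda>x. F x y))"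
    using assms
    by (subst integral_measure_pmf[of "set_pmf Q"], simp, simp,
        subst integral_measure_pmf[of "set_pmf P"], simp, simp)
       (simp add: sum_distrib_left mult_ac)
  finally show ?thesis .
qed

lemma avg_pair:
  assumes "finite (set_pmf P)" "finite (set_pmf Q)"
  shows "avg (pair_pmf P Q) F = avg P (\<lambda>x. avg Q (\<lambda>y. F (x, y)))"
proof -
  have "avg (pair_pmf P Q) F = (\<Sum>z\<in>set_pmf P \<times> set_pmf Q. pmf (pair_pmf P Q) z *\<^sub>R F z)"
    using assms by (intro integral_measure_pmf) auto
  also have "... = (\<Sum>x\<in>set_pmf P. \<Sum>y\<in>set_pmf Q. pmf P x * pmf Q y * F (x, y))"
    by (subst sum.cartesian_product) (auto simp: pmf_pair intro!: sum.cong)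
  also have "... = avg P (\<lambda>x. avg Q (\<lambda>y. F (x, y)))"
    using assms
    by (subst integral_measure_pmf[of "set_pmf P"], simp, simp,
        subst integral_measure_pmf[of "set_pmf Q"], simp, simp)
       (simp add: sum_distrib_left mult.assoc)
  finally show ?thesis .
qed

lemma finite_set_column_pmf [simp]:
  "r > 0 \<Longrightarrow> finite (set_pmf L) \<Longrightarrow> finite (set_pmf (column_pmf r L))"
  by (simp add: column_pmf_def lessThan_empty_iff)

lemma finite_set_sketch_pmf [simp]:
  "finite J \<Longrightarrow> r > 0 \<Longrightarrow> finite (set_pmf L) \<Longrightarrow> finite (set_pmf (sketch_pmf J r L))"
  by (auto simp: sketch_pmf_def set_Pi_pmf intro!: finite_PiE_dflt)

lemma avg_column_pmf:
  assumes "r > 0" "finite (set_pmf L)"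
  shows "avg (column_pmf r L) F =
    avg L (\<lambda>l. (\<Sum>b<r. F (b, True, l) + F (b, False, l)) / (2 * real r))"
proof -
  have ne: "{..<r} \<noteq> {}" using assms by (simp add: lessThan_empty_iff)
  have "avg (column_pmf r L) F = (\<Sum>b<r. (\<Sum>s\<in>UNIV. avg L (\<lambda>l. F (b, s, l))) / 2) / r"
    unfolding column_pmf_def using assms ne
    by (simp add: avg_pair integral_pmf_of_set sum_divide_distrib)
  also have "... = (\<Sum>b<r. avg L (\<lambda>l. F (b, True, l) + F (b, False, l))) / (2 * r)"
    using assms by (simp add: UNIV_bool avg_add add.commute sum_divide_distrib)
  also have "... = avg L (\<lambda>l. (\<Sum>b<r. F (b, True, l) + F (b, False, l)) / (2 * real r))"
    using assms by (simp add: avg_sum)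
  finally show ?thesis .
qed

text \<open>The recursion behind all moment bounds: given the other columns, the new one is averaged
  over bucket, sign and label. The two signs are kept side by side so that terms odd in the sign
  cancel.\<close>

lemma avg_sketch_pmf_insert:
  assumes J: "finite J" "j \<notin> J" and rL: "r > 0" "finite (set_pmf L)"
  shows "avg (sketch_pmf (insert j J) r L) F =
    avg (sketch_pmf J r L) (\<lambda>w. avg L (\<lambda>l.
      (\<Sum>b<r. F (fun_upd w j (b, True, l)) + F (fun_upd w j (b, False, l))) / (2 * real r)))"
proof -
  have "avg (sketch_pmf (insert j J) r L) F =
      avg (column_pmf r L) (\<lambda>y. avg (sketch_pmf J r L) (\<lambda>w. F (fun_upd w j y)))"
    unfolding sketch_pmf_def Pi_pmf_insert[OF J]
    using J rL by (simp add: avg_pair finite_set_sketch_pmf[unfolded sketch_pmf_def])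
  also have "... = avg (sketch_pmf J r L) (\<lambda>w. avg (column_pmf r L) (\<lambda>y. F (fun_upd w j y)))"
    using J rL by (intro avg_swap) auto
  also have "... = avg (sketch_pmf J r L) (\<lambda>w. avg L (\<lambda>l.
      (\<Sum>b<r. F (fun_upd w j (b, True, l)) + F (fun_upd w j (b, False, l))) / (2 * real r)))"
    using J rL by (simp add: avg_column_pmf)
  finally show ?thesis .
qed

lemma avg_sketch_pmf_component:
  assumes "finite J" "j \<in> J" "r > 0" "finite (set_pmf L)"
  shows "avg (sketch_pmf J r L) (\<lambda>w. f (snd (snd (w j)))) = avg L f"
proof -
  have "avg (sketch_pmf J r L) (\<lambda>w. f (snd (snd (w j)))) = avg (map_pmf (\<lambda>w. w j) (sketch_pmf J r L)) (\<lambda>y. f (snd (snd y)))"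
    by simp
  also have "map_pmf (\<lambda>w. w j) (sketch_pmf J r L) = column_pmf r L"
    unfolding sketch_pmf_def using assms by (subst Pi_pmf_component) auto
  also have "avg (column_pmf r L) (\<lambda>y. f (snd (snd y))) = avg L f"
    using assms by (simp add: avg_column_pmf)
  finally show ?thesis .
qed

lemma bucket_sum_empty [simp]: "bucket_sum {} c w b = 0"
  by (simp add: bucket_sum_def)

lemma bucket_sum_insert_upd:
  assumes "finite J" "j \<notin> J"
  shows "bucket_sum (insert j J) c (fun_upd w j (h, s, l)) b =
    bucket_sum J c w b + (if h = b then sgn_of s * c j l else 0)"
proof -
  have "bucket_sum J c (fun_upd w j (h, s, l)) b = bucket_sum J c w b"
    unfolding bucket_sum_def using assms by (intro sum.cong) auto
  then show ?thesis using assms unfolding bucket_sum_def by (simp add: add.commute)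
qed

lemma markov_pmf:
  assumes "finite (set_pmf P)" "\<And>x. x \<in> set_pmf P \<Longrightarrow> 0 \<le> f x" "avg P f \<le> B" "0 < a"
  shows "prb P {x. a \<le> f x} \<le> B / a"
proof -
  have "prb P {x. a \<le> f x} = avg P (indicator {x. a \<le> f x})" by simp
  also have "... \<le> avg P (\<lambda>x. f x / a)"
    using assms by (intro avg_mono) (auto simp: indicator_def)
  also have "... \<le> B / a" using assms by (simp add: divide_right_mono)
  finally show ?thesis .
qed

section \<open>Moments and small-ball estimate of a random sparse sketch\<close>

lemma sgn_of_simps [simp]: "sgn_of True = 1" "sgn_of False = - 1"
  by (auto simp: sgn_of_def)

lemma sum_if_eq_update:
  fixes f g :: "nat \<Rightarrow> real"
  assumes "a < r"
  shows "(\<Sum>b<r. if a = b then f b else g b) = (\<Sum>b<r. g b) + (f a - g a)"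
proof -
  have "(\<Sum>b<r. if a = b then f b else g b) = (\<Sum>b<r. g b + (if a = b then f b - g b else 0))"
    by (intro sum.cong) auto
  then show ?thesis using assms by (simp add: sum.distrib)
qed

lemma avg_sketch_mono:
  assumes "finite J" "r > 0" "finite (set_pmf L)" "\<And>w. f w \<le> g w"
  shows "avg (sketch_pmf J r L) f \<le> avg (sketch_pmf J r L) g"
  using assms by (intro avg_mono) auto

text \<open>The random signs kill the cross terms of each new column.\<close>
lemma avg_bucket_sum_sq:
  fixes c :: "'j \<Rightarrow> 'l \<Rightarrow> nat \<Rightarrow> real"
  assumes "finite J" and rL: "r > 0" "finite (set_pmf L)"
  shows "avg (sketch_pmf J r L) (\<lambda>w. \<Sum>b<r. \<Sum>k<d. (bucket_sum J (\<lambda>j l. c j l k) w b)\<^sup>2)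
    = (\<Sum>j\<in>J. avg L (\<lambda>l. \<Sum>k<d. (c j l k)\<^sup>2))"
  using assms(1)
proof (induction J)
  case (insert j J)
  let ?z = "\<lambda>w b k. bucket_sum J (\<lambda>j l. c j l k) w b"
  let ?F = "\<lambda>w. \<Sum>b<r. \<Sum>k<d. (bucket_sum (insert j J) (\<lambda>j l. c j l k) w b)\<^sup>2"
  have F: "?F (fun_upd w j (a, s, l)) =
     (\<Sum>b<r. sq_norm d (?z w b)) + (\<Sum>k<d. (sgn_of s)\<^sup>2 * (c j l k)\<^sup>2 + 2 * sgn_of s * c j l k * ?z w a k)"
    if "a < r" for w a s l
  proof -
    have "?F (fun_upd w j (a, s, l)) =
       (\<Sum>b<r. if a = b then \<Sum>k<d. (?z w b k + sgn_of s * c j l k)\<^sup>2 else sq_norm d (?z w b))"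
      using insert by (intro sum.cong) (auto simp: bucket_sum_insert_upd)
    also have "... = (\<Sum>b<r. sq_norm d (?z w b))
        + (\<Sum>k<d. (?z w a k + sgn_of s * c j l k)\<^sup>2 - (?z w a k)\<^sup>2)"
      using that by (simp add: sum_if_eq_update sum_subtractf)
    finally show ?thesis by (simp add: power2_sum algebra_simps)
  qed
  have inner: "(\<Sum>a<r. ?F (fun_upd w j (a, True, l)) + ?F (fun_upd w j (a, False, l))) / (2 * real r)
     = (\<Sum>b<r. sq_norm d (?z w b)) + (sq_norm d (c j l))" for w l
  proof -
    have "(\<Sum>a<r. ?F (fun_upd w j (a, True, l)) + ?F (fun_upd w j (a, False, l)))
      = (\<Sum>a<r. 2 * ((\<Sum>b<r. sq_norm d (?z w b)) + (sq_norm d (c j l))))"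
      by (intro sum.cong refl) (simp add: F sum.distrib sum_negf sum_subtractf)
    then show ?thesis using rL by simp
  qed
  have "avg (sketch_pmf (insert j J) r L) ?F =
     avg (sketch_pmf J r L) (\<lambda>w. (\<Sum>b<r. sq_norm d (?z w b)) + avg L (\<lambda>l. \<Sum>k<d. (c j l k)\<^sup>2))"
    using insert rL by (subst avg_sketch_pmf_insert) (simp_all add: inner avg_add)
  also have "... = (\<Sum>j\<in>insert j J. avg L (\<lambda>l. \<Sum>k<d. (c j l k)\<^sup>2))"
    using insert rL by (simp add: avg_add)
  finally show ?case .
qed simp

text \<open>By the parallelogram law the squared norms of \<open>z + c\<close> and
  \<open>z - c\<close> average to the sum of the two squared norms. Concavity of
  \<open>powr a\<close> moves the average over the sign inside the power, and subadditivity then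
  splits off the new column. With \<open>a = p/2\<close> collisions cost nothing in the
  \<open>p\<close>-th moment.\<close>

lemma avg_bucket_sum_powr_le:
  fixes c :: "'j \<Rightarrow> 'l \<Rightarrow> nat \<Rightarrow> real"
  assumes "finite J" and rL: "r > 0" "finite (set_pmf L)" and a: "0 < a" "a \<le> 1"
  shows "avg (sketch_pmf J r L) (\<lambda>w. \<Sum>b<r. (\<Sum>k<d. (bucket_sum J (\<lambda>j l. c j l k) w b)\<^sup>2) powr a)
    \<le> (\<Sum>j\<in>J. avg L (\<lambda>l. (sq_norm d (c j l)) powr a))"
  using assms(1)
proof (induction J)
  case (insert j J)
  let ?z = "\<lambda>w b k. bucket_sum J (\<lambda>j l. c j l k) w b"
  let ?S = "\<lambda>w. \<Sum>b<r. (sq_norm d (?z w b)) powr a"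
  let ?F = "\<lambda>w. \<Sum>b<r. (\<Sum>k<d. (bucket_sum (insert j J) (\<lambda>j l. c j l k) w b)\<^sup>2) powr a"
  have F: "?F (fun_upd w j (h, s, l)) = ?S w + ((\<Sum>k<d. (?z w h k + sgn_of s * c j l k)\<^sup>2) powr a - (sq_norm d (?z w h)) powr a)"
    if "h < r" for w h s l
  proof -
    have "?F (fun_upd w j (h, s, l)) =
       (\<Sum>b<r. if h = b then (\<Sum>k<d. (?z w b k + sgn_of s * c j l k)\<^sup>2) powr a else (sq_norm d (?z w b)) powr a)"
      using insert by (intro sum.cong) (auto simp: bucket_sum_insert_upd)
    then show ?thesis using that by (simp add: sum_if_eq_update)
  qed
  have pair: "?F (fun_upd w j (h, True, l)) + ?F (fun_upd w j (h, False, l))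
     \<le> 2 * (?S w + (sq_norm d (c j l)) powr a)" if h: "h < r" for w h l
  proof -
    let ?p = "\<Sum>k<d. (?z w h k + c j l k)\<^sup>2" and ?m = "\<Sum>k<d. (?z w h k - c j l k)\<^sup>2"
    have "(?p powr a + ?m powr a) / 2 \<le> ((?p + ?m) / 2) powr a"
      by (rule powr_avg_le_powr_avg) (use a in \<open>auto intro: sum_nonneg\<close>)
    also have "(?p + ?m) / 2 = (sq_norm d (?z w h)) + (sq_norm d (c j l))"
      by (simp add: sum.distrib[symmetric] sum_divide_distrib power2_sum power2_diff add_divide_distrib)
    also have "... powr a \<le> (sq_norm d (?z w h)) powr a + (sq_norm d (c j l)) powr a"
      by (rule powr_add_le_sum_powr) (use a in \<open>auto intro: sum_nonneg\<close>)
    finally show ?thesis using h by (simp add: F)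
  qed
  have inner: "(\<Sum>h<r. ?F (fun_upd w j (h, True, l)) + ?F (fun_upd w j (h, False, l))) / (2 * real r)
     \<le> ?S w + (sq_norm d (c j l)) powr a" for w l
  proof -
    have "(\<Sum>h<r. ?F (fun_upd w j (h, True, l)) + ?F (fun_upd w j (h, False, l)))
      \<le> (\<Sum>h<r. 2 * (?S w + (sq_norm d (c j l)) powr a))"
      by (intro sum_mono) (rule pair, simp)
    also have "... = (?S w + (sq_norm d (c j l)) powr a) * (2 * real r)" by simp
    finally show ?thesis using rL by (simp add: pos_divide_le_eq)
  qed
  have "avg (sketch_pmf (insert j J) r L) ?F \<le>
     avg (sketch_pmf J r L) (\<lambda>w. avg L (\<lambda>l. ?S w + (sq_norm d (c j l)) powr a))"
    unfolding avg_sketch_pmf_insert[OF insert.hyps rL]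
    by (intro avg_sketch_mono avg_mono insert.hyps rL inner)
  also have "... \<le> (\<Sum>j\<in>insert j J. avg L (\<lambda>l. (sq_norm d (c j l)) powr a))"
    using insert rL by (simp add: avg_add)
  finally show ?case .
qed simp

text \<open>Martingale form of the second moment bound for the sparse embedding of Clarkson and Woodruff:
  a new column changes the Gram matrix by a term that is linear in its sign.\<close>
lemma avg_gram_error_le:
  fixes u :: "'j \<Rightarrow> nat \<Rightarrow> real"
  assumes "finite J" and rL: "r > 0" "finite (set_pmf L)"
  shows "avg (sketch_pmf J r L) (\<lambda>w. \<Sum>k<d. \<Sum>m<d.
      ((\<Sum>b<r. bucket_sum J (\<lambda>j l. u j k) w b * bucket_sum J (\<lambda>j l. u j m) w b)
        - (\<Sum>j\<in>J. u j k * u j m))\<^sup>2)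
    \<le> 2 / r * (\<Sum>j\<in>J. \<Sum>k<d. (u j k)\<^sup>2)\<^sup>2"
  using assms(1)
proof (induction J)
  case (insert j J)
  let ?z = "\<lambda>w b k. bucket_sum J (\<lambda>j l. u j k) w b"
  let ?X = "\<lambda>w k m. (\<Sum>b<r. ?z w b k * ?z w b m) - (\<Sum>j\<in>J. u j k * u j m)"
  let ?z' = "\<lambda>w b k. bucket_sum (insert j J) (\<lambda>j l. u j k) w b"
  let ?X' = "\<lambda>w k m. (\<Sum>b<r. ?z' w b k * ?z' w b m) - (\<Sum>j\<in>insert j J. u j k * u j m)"
  let ?F = "\<lambda>w. \<Sum>k<d. \<Sum>m<d. (?X' w k m)\<^sup>2"
  let ?N = "\<Sum>k<d. (u j k)\<^sup>2"
  have X': "?X' (fun_upd w j (h, s, l)) k m = ?X w k m + sgn_of s * (?z w h k * u j m + u j k * ?z w h m)"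
    if "h < r" for w h s l k m
  proof -
    have "(\<Sum>b<r. ?z' (fun_upd w j (h, s, l)) b k * ?z' (fun_upd w j (h, s, l)) b m) =
       (\<Sum>b<r. if h = b then (?z w b k + sgn_of s * u j k) * (?z w b m + sgn_of s * u j m) else ?z w b k * ?z w b m)"
      using insert by (intro sum.cong) (auto simp: bucket_sum_insert_upd)
    also have "... = (\<Sum>b<r. ?z w b k * ?z w b m) + ((?z w h k + sgn_of s * u j k) * (?z w h m + sgn_of s * u j m) - ?z w h k * ?z w h m)"
      using that by (simp add: sum_if_eq_update)
    finally show ?thesis
      using insert by (cases s) (simp_all add: algebra_simps)
  qed
  have pair: "?F (fun_upd w j (h, True, l)) + ?F (fun_upd w j (h, False, l))
     \<le> 2 * ((\<Sum>k<d. \<Sum>m<d. (?X w k m)\<^sup>2) + 4 * ?N * (sq_norm d (?z w h)))" if h: "h < r" for w h l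
  proof -
    have "?F (fun_upd w j (h, True, l)) + ?F (fun_upd w j (h, False, l))
      = (\<Sum>k<d. \<Sum>m<d. 2 * (?X w k m)\<^sup>2 + 2 * (?z w h k * u j m + u j k * ?z w h m)\<^sup>2)"
      unfolding X'[OF h] sum.distrib[symmetric]
      by (intro sum.cong refl) (simp only: sgn_of_simps, algebra)
    also have "... \<le> (\<Sum>k<d. \<Sum>m<d. 2 * (?X w k m)\<^sup>2 + 4 * ((?z w h k)\<^sup>2 * (u j m)\<^sup>2) + 4 * ((u j k)\<^sup>2 * (?z w h m)\<^sup>2))"
    proof (intro sum_mono)
      fix k m
      have "2 * ((?z w h k * u j m) * (u j k * ?z w h m)) \<le> (?z w h k * u j m)\<^sup>2 + (u j k * ?z w h m)\<^sup>2"
        using sum_squares_bound[of "?z w h k * u j m" "u j k * ?z w h m"] by (simp only: mult.assoc)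
      then show "2 * (?X w k m)\<^sup>2 + 2 * (?z w h k * u j m + u j k * ?z w h m)\<^sup>2
         \<le> 2 * (?X w k m)\<^sup>2 + 4 * ((?z w h k)\<^sup>2 * (u j m)\<^sup>2) + 4 * ((u j k)\<^sup>2 * (?z w h m)\<^sup>2)"
        unfolding power2_sum[of "?z w h k * u j m"] power_mult_distrib by (simp add: algebra_simps)
    qed
    also have "... = 2 * ((\<Sum>k<d. \<Sum>m<d. (?X w k m)\<^sup>2) + 4 * ?N * (sq_norm d (?z w h)))"
      by (simp add: sum.distrib sum_distrib_left[symmetric] sum_distrib_right[symmetric] algebra_simps)
    finally show ?thesis .
  qed
  have inner: "(\<Sum>h<r. ?F (fun_upd w j (h, True, l)) + ?F (fun_upd w j (h, False, l))) / (2 * real r)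
     \<le> (\<Sum>k<d. \<Sum>m<d. (?X w k m)\<^sup>2) + (4 * ?N / r) * (\<Sum>b<r. sq_norm d (?z w b))" for w l
  proof -
    have "(\<Sum>h<r. ?F (fun_upd w j (h, True, l)) + ?F (fun_upd w j (h, False, l)))
      \<le> (\<Sum>h<r. 2 * ((\<Sum>k<d. \<Sum>m<d. (?X w k m)\<^sup>2) + 4 * ?N * (sq_norm d (?z w h))))"
      by (intro sum_mono) (rule pair, simp)
    also have "... = ((\<Sum>k<d. \<Sum>m<d. (?X w k m)\<^sup>2) + (4 * ?N / r) * (\<Sum>b<r. sq_norm d (?z w b))) * (2 * real r)"
      using rL by (simp add: sum.distrib sum_distrib_left[symmetric] field_simps)
    finally show ?thesis using rL by (simp add: pos_divide_le_eq)
  qed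
  have "avg (sketch_pmf (insert j J) r L) ?F \<le>
     avg (sketch_pmf J r L) (\<lambda>w. avg L (\<lambda>l. (\<Sum>k<d. \<Sum>m<d. (?X w k m)\<^sup>2) + (4 * ?N / r) * (\<Sum>b<r. sq_norm d (?z w b))))"
    unfolding avg_sketch_pmf_insert[OF insert.hyps rL]
    by (intro avg_sketch_mono avg_mono insert.hyps rL inner)
  also have "... = avg (sketch_pmf J r L) (\<lambda>w. \<Sum>k<d. \<Sum>m<d. (?X w k m)\<^sup>2)
      + (4 * ?N / r) * avg (sketch_pmf J r L) (\<lambda>w. \<Sum>b<r. sq_norm d (?z w b))"
    using insert rL by (simp add: avg_add)
  also have "avg (sketch_pmf J r L) (\<lambda>w. \<Sum>b<r. sq_norm d (?z w b)) = (\<Sum>j\<in>J. \<Sum>k<d. (u j k)\<^sup>2)"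
    using insert rL by (subst avg_bucket_sum_sq) simp_all
  also have "avg (sketch_pmf J r L) (\<lambda>w. \<Sum>k<d. \<Sum>m<d. (?X w k m)\<^sup>2) + 4 * ?N / r * (\<Sum>j\<in>J. \<Sum>k<d. (u j k)\<^sup>2)
     \<le> 2 / r * (\<Sum>j\<in>J. \<Sum>k<d. (u j k)\<^sup>2)\<^sup>2 + 4 * ?N / r * (\<Sum>j\<in>J. \<Sum>k<d. (u j k)\<^sup>2)"
    using insert by simp
  \<comment> \<open>The added term completes the square of the old total plus
    \<open>?N\<close>.\<close>
  also have "... \<le> 2 / r * (\<Sum>j\<in>J. \<Sum>k<d. (u j k)\<^sup>2)\<^sup>2 + 4 * ?N / r * (\<Sum>j\<in>J. \<Sum>k<d. (u j k)\<^sup>2) + 2 / r * ?N\<^sup>2"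
    by simp
  also have "... = 2 / r * (\<Sum>j\<in>insert j J. \<Sum>k<d. (u j k)\<^sup>2)\<^sup>2"
    using insert rL by (simp add: power2_sum field_simps)
  finally show ?case .
qed simp

definition bucket_load :: "'j set \<Rightarrow> ('j \<Rightarrow> nat \<times> bool \<times> 'l) \<Rightarrow> nat \<Rightarrow> real" where
  "bucket_load J w b = (\<Sum>j\<in>J. if fst (w j) = b then 1 else 0)"

text \<open>A column of \<open>H\<close> multiplies the exponential of one load by
  \<open>exp 1\<close>, so on average the sum grows by the factor
  \<open>1 + (exp 1 - 1) / r\<close>, which is at most \<open>exp (2 / r)\<close>. A bound on the
  sum bounds the largest load by its logarithm.\<close>

lemma avg_exp_bucket_load_le:
  assumes "finite J" and rL: "r > 0" "finite (set_pmf L)"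
  shows "avg (sketch_pmf J r L) (\<lambda>w. \<Sum>b<r. exp (bucket_load (J \<inter> H) w b))
    \<le> r * exp (2 * card (J \<inter> H) / r)"
  using assms(1)
proof (induction J)
  case empty
  then show ?case by (simp add: bucket_load_def sketch_pmf_def)
next
  case (insert j J)
  let ?e = "if j \<in> H then 1 else 0 :: real"
  let ?F = "\<lambda>w. \<Sum>b<r. exp (bucket_load (insert j J \<inter> H) w b)"
  let ?S = "\<lambda>w. \<Sum>b<r. exp (bucket_load (J \<inter> H) w b)"
  have load: "bucket_load (insert j J \<inter> H) (fun_upd w j (h, s, l)) b
      = bucket_load (J \<inter> H) w b + (if h = b then ?e else 0)" for w h s l b
  proof -
    have "bucket_load (J \<inter> H) (fun_upd w j (h, s, l)) b = bucket_load (J \<inter> H) w b"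
      unfolding bucket_load_def using insert by (intro sum.cong) auto
    then show ?thesis using insert by (auto simp: bucket_load_def Int_insert_left)
  qed
  have F: "?F (fun_upd w j (h, s, l)) = ?S w + (exp ?e - 1) * exp (bucket_load (J \<inter> H) w h)"
    if "h < r" for w h s l
  proof -
    have "?F (fun_upd w j (h, s, l)) = (\<Sum>b<r. if h = b then exp (bucket_load (J \<inter> H) w b + ?e) else exp (bucket_load (J \<inter> H) w b))"
      unfolding load by (intro sum.cong) auto
    then show ?thesis using that by (simp only: sum_if_eq_update) (simp add: exp_add algebra_simps)
  qed
  have inner: "(\<Sum>h<r. ?F (fun_upd w j (h, True, l)) + ?F (fun_upd w j (h, False, l))) / (2 * real r)
     = (1 + (exp ?e - 1) / r) * ?S w" for w l
  proof -
    have "(\<Sum>h<r. ?F (fun_upd w j (h, True, l)) + ?F (fun_upd w j (h, False, l)))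
      = (\<Sum>h<r. 2 * (?S w + (exp ?e - 1) * exp (bucket_load (J \<inter> H) w h)))"
      by (intro sum.cong refl) (simp only: F lessThan_iff, simp)
    also have "... = 2 * (real r * ?S w + (exp ?e - 1) * ?S w)"
      by (simp only: sum_distrib_left[symmetric] sum.distrib) simp
    finally show ?thesis using rL by (simp add: field_simps)
  qed
  have "avg (sketch_pmf (insert j J) r L) ?F = (1 + (exp ?e - 1) / r) * avg (sketch_pmf J r L) ?S"
  proof -
    have *: "avg (sketch_pmf J r L) (\<lambda>w. avg L (\<lambda>l. K * ?S w)) = K * avg (sketch_pmf J r L) ?S" for K
      by simp
    show ?thesis unfolding avg_sketch_pmf_insert[OF insert.hyps rL] inner by (rule *)
  qed
  also have "... \<le> exp (2 * ?e / r) * (r * exp (2 * card (J \<inter> H) / r))"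
  proof (intro mult_mono insert)
    have "exp ?e - 1 \<le> 2 * ?e" using exp_le by auto
    then have "1 + (exp ?e - 1) / r \<le> 1 + 2 * ?e / r" using rL by (intro add_left_mono divide_right_mono) auto
    also have "... \<le> exp (2 * ?e / r)" by (rule exp_ge_add_one_self)
    finally show "1 + (exp ?e - 1) / r \<le> exp (2 * ?e / r)" .
    show "0 \<le> avg (sketch_pmf J r L) ?S"
      by (intro Bochner_Integration.integral_nonneg sum_nonneg) auto
  qed auto
  also have "... = r * exp (2 * card (insert j J \<inter> H) / r)"
    using insert by (auto simp: Int_insert_left exp_add[symmetric] add_divide_distrib)
  finally show ?case .
qed

lemma prod_update_lessThan:
  fixes f :: "nat \<Rightarrow> real"
  assumes "h < r"
  shows "(\<Prod>b<r. if h = b then x else f b) = x * (\<Prod>b\<in>{..<r} - {h}. f b)"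
proof -
  have "(\<Prod>b<r. if h = b then x else f b) = x * (\<Prod>b\<in>{..<r} - {h}. if h = b then x else f b)"
    using assms by (subst prod.remove[of _ h]) auto
  also have "(\<Prod>b\<in>{..<r} - {h}. if h = b then x else f b) = (\<Prod>b\<in>{..<r} - {h}. f b)"
    by (intro prod.cong) auto
  finally show ?thesis .
qed

text \<open>\<open>\<phi> b\<close> is the conditional expectation, given the columns revealed so far, of a
  functional of bucket \<open>b\<close>; \<open>B\<close> is the set of the buckets already hit by a large entry.  Averaging
  over one sign turns \<open>\<phi> b\<close> into \<open>(\<phi> b (z + c) + \<phi> b (z - c)) / 2\<close>, and this operation preserves
  all assumptions.\<close>
lemma avg_prod_bucket_le:
  fixes c :: "'j \<Rightarrow> 'l \<Rightarrow> real"
  assumes "finite J" and rL: "r > 0" "finite (set_pmf L)"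
    and B: "B \<subseteq> {..<r}"
    and \<phi>: "\<And>b z. 0 \<le> \<phi> b z" "\<And>b z. \<phi> b z \<le> 1"
      "\<And>b z t. \<tau> \<le> \<bar>t\<bar> \<Longrightarrow> (\<phi> b (z + t) + \<phi> b (z - t)) / 2 \<le> 3 / 4"
      "\<And>b z. b \<in> B \<Longrightarrow> \<phi> b z \<le> 3 / 4"
  shows "avg (sketch_pmf J r L) (\<lambda>w. \<Prod>b<r. \<phi> b (bucket_sum J c w b))
    \<le> (3 / 4) ^ card B * (\<Prod>j\<in>J. 1 - prb L {l. \<tau> \<le> \<bar>c j l\<bar>} / 8)
      + (3 / 4) powr (r / 2)"
  using assms(1,4-)
proof (induction J arbitrary: B \<phi>)
  case empty
  have "(\<Prod>b<r. \<phi> b 0) = (\<Prod>b\<in>B. \<phi> b 0) * (\<Prod>b\<in>{..<r} - B. \<phi> b 0)"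
    using empty by (metis finite_lessThan mult.commute prod.subset_diff)
  also have "... \<le> (\<Prod>b\<in>B. 3 / 4) * (\<Prod>b\<in>{..<r} - B. 1)"
    using empty by (intro mult_mono prod_mono prod_nonneg) auto
  finally show ?case by (simp add: sketch_pmf_def add_increasing2)
next
  case (insert j J)
  let ?q = "prb L {l. \<tau> \<le> \<bar>c j l\<bar>}"
  let ?P = "\<Prod>j\<in>J. 1 - prb L {l. \<tau> \<le> \<bar>c j l\<bar>} / 8"
  let ?e = "(3 / 4) powr (r / 2) :: real"
  let ?Z = "\<lambda>w b. bucket_sum J c w b"
  let ?F = "\<lambda>w. \<Prod>b<r. \<phi> b (bucket_sum (insert j J) c w b)"
  have fB: "finite B" using insert.prems(1) finite_subset by blast
  have P: "0 \<le> ?P"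
    by (intro prod_nonneg) (auto simp: le_diff_eq intro: order_trans[OF measure_pmf.prob_le_1])
  have q: "0 \<le> ?q" "?q \<le> 1" by auto
  \<comment> \<open>Once half of the buckets are in \<open>B\<close>, their factors alone give
    \<open>(3/4) powr (r/2)\<close>, the second summand of the claim. Until then a large entry
    reaches a fresh bucket with probability above 1/2.\<close>
  show ?case
  proof (cases "real (card B) \<ge> r / 2")
    case True
    have "?F w \<le> ?e" for w
    proof -
      have "?F w = (\<Prod>b\<in>B. \<phi> b (bucket_sum (insert j J) c w b)) * (\<Prod>b\<in>{..<r} - B. \<phi> b (bucket_sum (insert j J) c w b))"
        using insert by (metis finite_lessThan mult.commute prod.subset_diff)
      also have "... \<le> (\<Prod>b\<in>B. 3 / 4) * (\<Prod>b\<in>{..<r} - B. 1)"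
        using insert by (intro mult_mono prod_mono prod_nonneg) auto
      also have "... = (3 / 4) powr (card B)" by (simp add: powr_realpow)
      also have "... \<le> ?e" using True by (intro powr_mono') auto
      finally show ?thesis .
    qed
    then have "avg (sketch_pmf (insert j J) r L) ?F \<le> avg (sketch_pmf (insert j J) r L) (\<lambda>_. ?e)"
      using insert rL by (intro avg_sketch_mono) auto
    moreover have "0 \<le> (3 / 4) ^ card B * (\<Prod>j\<in>insert j J. 1 - prb L {l. \<tau> \<le> \<bar>c j l\<bar>} / 8)"
    proof -
      have "0 \<le> 1 - ?q / 8" using q(2) by linarith
      then show ?thesis using insert.hyps P by (simp del: diff_ge_0_iff_ge)
    qed
    ultimately show ?thesis by simp
  next
    case False
    \<comment> \<open>This is \<open>\<phi>\<close> after averaging the sign of an entry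
      \<open>t\<close> that falls into bucket \<open>h\<close>. If the entry is large, the induction
      hypothesis is used with \<open>h\<close> added to \<open>B\<close>; therefore both
      \<open>B\<close> and \<open>\<phi>\<close> are generalized.\<close>
    define \<psi> where "\<psi> = (\<lambda>h t b z. if h = b then (\<phi> b (z + t) + \<phi> b (z - t)) / 2 else \<phi> b z)"
    have F: "?F (fun_upd w j (h, True, l)) + ?F (fun_upd w j (h, False, l)) = 2 * (\<Prod>b<r. \<psi> h (c j l) b (?Z w b))"
      if h: "h < r" for w h l
    proof -
      have "?F (fun_upd w j (h, s, l)) = \<phi> h (?Z w h + sgn_of s * c j l) * (\<Prod>b\<in>{..<r} - {h}. \<phi> b (?Z w b))" for s
      proof -
        have "?F (fun_upd w j (h, s, l)) = (\<Prod>b<r. if h = b then \<phi> h (?Z w h + sgn_of s * c j l) else \<phi> b (?Z w b))"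
          using insert by (intro prod.cong) (auto simp: bucket_sum_insert_upd)
        then show ?thesis using h by (simp add: prod_update_lessThan)
      qed
      moreover have "(\<Prod>b<r. \<psi> h (c j l) b (?Z w b)) = (\<phi> h (?Z w h + c j l) + \<phi> h (?Z w h - c j l)) / 2 * (\<Prod>b\<in>{..<r} - {h}. \<phi> b (?Z w b))"
      proof -
        have "(\<Prod>b<r. \<psi> h (c j l) b (?Z w b)) = (\<Prod>b<r. if h = b then (\<phi> h (?Z w h + c j l) + \<phi> h (?Z w h - c j l)) / 2 else \<phi> b (?Z w b))"
          by (intro prod.cong) (auto simp: \<psi>_def)
        then show ?thesis using h by (simp add: prod_update_lessThan)
      qed
      ultimately show ?thesis by (simp add: algebra_simps add_divide_distrib)
    qed
    let ?new = "\<lambda>l h. \<tau> \<le> \<bar>c j l\<bar> \<and> h \<notin> B"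
    have IH: "avg (sketch_pmf J r L) (\<lambda>w. \<Prod>b<r. \<psi> h (c j l) b (?Z w b))
        \<le> (3 / 4) ^ card B * ?P * (if ?new l h then 3 / 4 else 1) + ?e" if h: "h < r" for l h
    proof -
      have "avg (sketch_pmf J r L) (\<lambda>w. \<Prod>b<r. \<psi> h (c j l) b (?Z w b))
        \<le> (3 / 4) ^ card (if ?new l h then insert h B else B) * ?P + ?e"
      proof (rule insert.IH)
        show "(if ?new l h then insert h B else B) \<subseteq> {..<r}" using h insert.prems(1) by auto
        fix b z t
        show "0 \<le> \<psi> h (c j l) b z" using insert.prems(2) by (simp add: \<psi>_def)
        show "\<psi> h (c j l) b z \<le> 1"
          using insert.prems(3)[of b "z + c j l"] insert.prems(3)[of b "z - c j l"] insert.prems(3)[of b z]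
          by (simp add: \<psi>_def)
        show "\<psi> h (c j l) b z \<le> 3 / 4" if "b \<in> (if ?new l h then insert h B else B)"
        proof (cases "b \<in> B")
          case True
          then show ?thesis using insert.prems(5)[of b "z + c j l"] insert.prems(5)[of b "z - c j l"] insert.prems(5)[of b z]
            by (simp add: \<psi>_def)
        next
          case False
          then have "b = h" "\<tau> \<le> \<bar>c j l\<bar>" using that by (auto split: if_splits)
          then show ?thesis using insert.prems(4)[of "c j l" b z] by (simp add: \<psi>_def)
        qed
        show "(\<psi> h (c j l) b (z + t) + \<psi> h (c j l) b (z - t)) / 2 \<le> 3 / 4" if "\<tau> \<le> \<bar>t\<bar>"
          using insert.prems(4)[OF that, of b "z + c j l"] insert.prems(4)[OF that, of b "z - c j l"]
            insert.prems(4)[OF that, of b z]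
          by (auto simp: \<psi>_def algebra_simps add_divide_distrib)
      qed
      then show ?thesis using fB by (auto simp: mult_ac)
    qed
    have "avg (sketch_pmf (insert j J) r L) ?F
      = avg (sketch_pmf J r L) (\<lambda>w. avg L (\<lambda>l. (\<Sum>h<r. \<Prod>b<r. \<psi> h (c j l) b (?Z w b)) / r))"
    proof -
      have "(\<Sum>h<r. ?F (fun_upd w j (h, True, l)) + ?F (fun_upd w j (h, False, l))) / (2 * real r)
        = (\<Sum>h<r. \<Prod>b<r. \<psi> h (c j l) b (?Z w b)) / r" for w l
      proof -
        have "(\<Sum>h<r. ?F (fun_upd w j (h, True, l)) + ?F (fun_upd w j (h, False, l)))
          = (\<Sum>h<r. 2 * (\<Prod>b<r. \<psi> h (c j l) b (?Z w b)))"
          by (intro sum.cong refl) (simp add: F)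
        then show ?thesis by (simp add: sum_distrib_left[symmetric])
      qed
      then show ?thesis using insert rL by (subst avg_sketch_pmf_insert) simp_all
    qed
    also have "... = avg L (\<lambda>l. (\<Sum>h<r. avg (sketch_pmf J r L) (\<lambda>w. \<Prod>b<r. \<psi> h (c j l) b (?Z w b))) / r)"
      using insert rL by (subst avg_swap) (simp_all add: avg_sum)
    also have "... \<le> avg L (\<lambda>l. (3 / 4) ^ card B * ?P * (1 - indicator {l. \<tau> \<le> \<bar>c j l\<bar>} l / 8) + ?e)"
    proof (intro avg_mono rL)
      fix l
      have "(\<Sum>h<r. avg (sketch_pmf J r L) (\<lambda>w. \<Prod>b<r. \<psi> h (c j l) b (?Z w b)))
         \<le> (\<Sum>h<r. (3 / 4) ^ card B * ?P * (if ?new l h then 3 / 4 else 1) + ?e)"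
        by (intro sum_mono) (rule IH, simp)
      also have "... = (3 / 4) ^ card B * ?P * (\<Sum>h<r. if ?new l h then 3 / 4 else 1) + r * ?e"
        by (simp add: sum.distrib sum_distrib_left)
      also have "... \<le> (3 / 4) ^ card B * ?P * (r * (1 - indicator {l. \<tau> \<le> \<bar>c j l\<bar>} l / 8)) + r * ?e"
      proof (intro add_right_mono mult_left_mono)
        show "(\<Sum>h<r. if ?new l h then 3 / 4 else 1) \<le> r * (1 - indicator {l. \<tau> \<le> \<bar>c j l\<bar>} l / 8 :: real)"
        proof (cases "\<tau> \<le> \<bar>c j l\<bar>")
          case True
          \<comment> \<open>Less than half of the buckets lie in \<open>B\<close>, so the fresh ones
            lower the average from 1 by at least \<open>1/4 * 1/2 = 1/8\<close>.\<close>
          have "(\<Sum>h<r. if ?new l h then 3 / 4 else 1) = (\<Sum>h<r. 3 / 4 + (if h \<in> B then 1 / 4 else 0 :: real))"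
            using True by (intro sum.cong) auto
          also have "... = 3 / 4 * r + card B / 4"
            using insert.prems(1) by (simp add: sum.distrib sum.If_cases Int_absorb1)
          finally show ?thesis using True False by (simp add: field_simps)
        qed auto
      qed (use P in auto)
      finally show "(\<Sum>h<r. avg (sketch_pmf J r L) (\<lambda>w. \<Prod>b<r. \<psi> h (c j l) b (?Z w b))) / r
         \<le> (3 / 4) ^ card B * ?P * (1 - indicator {l. \<tau> \<le> \<bar>c j l\<bar>} l / 8) + ?e"
        using rL by (subst pos_divide_le_eq) (simp_all add: algebra_simps)
    qed
    also have "... = (3 / 4) ^ card B * ?P * (1 - ?q / 8) + ?e"
      using rL by (simp add: avg_add integrable_measure_pmf_finite)
    finally show ?thesis using insert by (simp add: mult_ac)
  qed
qed

section \<open>Lewis weights\<close>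

text \<open>Equality of column spaces, compared in the first \<open>n\<close> coordinates only
  because matrices are total functions.\<close>

definition same_range :: "nat \<Rightarrow> nat \<Rightarrow> (nat \<Rightarrow> nat \<Rightarrow> real) \<Rightarrow> (nat \<Rightarrow> nat \<Rightarrow> real) \<Rightarrow> bool" where
  "same_range n d A U \<longleftrightarrow>
    (\<forall>x. \<exists>y. \<forall>j<n. mat_vec d A x j = mat_vec d U y j) \<and>
    (\<forall>y. \<exists>x. \<forall>j<n. mat_vec d U y j = mat_vec d A x j)"

text \<open>Columns that depend on the previous ones are orthonormalized to zero columns.\<close>
definition orthonormal_cols :: "(nat \<Rightarrow> real) \<Rightarrow> nat \<Rightarrow> nat \<Rightarrow> (nat \<Rightarrow> nat \<Rightarrow> real) \<Rightarrow> bool" where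
  "orthonormal_cols v n d U \<longleftrightarrow>
    (\<forall>k<d. \<forall>l<d. (\<Sum>j<n. v j * U j k * U j l) = (if k = l \<and> (\<exists>j<n. U j k \<noteq> 0) then 1 else 0))"

lemma mat_vec_Suc: "mat_vec (Suc d) A x j = mat_vec d A x j + A j d * x d"
  by (simp add: mat_vec_def)

lemma mat_vec_cong: "(\<And>k. k < d \<Longrightarrow> A j k = B j k) \<Longrightarrow> (\<And>k. k < d \<Longrightarrow> x k = y k) \<Longrightarrow> mat_vec d A x j = mat_vec d B y j"
  by (simp add: mat_vec_def)

lemma mat_vec_add_scaled: "mat_vec d A (\<lambda>k. x k + t * y k) j = mat_vec d A x j + t * mat_vec d A y j"
  by (simp add: mat_vec_def sum.distrib sum_distrib_left algebra_simps)

lemma weighted_gram_schmidt: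
  assumes v: "\<And>j. j < n \<Longrightarrow> 0 < v j"
  shows "\<exists>U. same_range n d A U \<and> orthonormal_cols v n d U"
proof (induction d)
  case 0
  show ?case by (auto simp: same_range_def orthonormal_cols_def mat_vec_def)
next
  case (Suc d)
  then obtain U where sr: "same_range n d A U" and oc: "orthonormal_cols v n d U" by auto
  define g where "g = (\<lambda>k. \<Sum>j<n. v j * A j d * U j k)"
  define \<rho> where "\<rho> = (\<lambda>j. A j d - mat_vec d U g j)"
  define N where "N = (\<Sum>j<n. v j * (\<rho> j)\<^sup>2)"
  \<comment> \<open>If the new column depends on the previous ones, positivity of \<open>v\<close>
    makes the residual \<open>\<rho>\<close> vanish on all rows below \<open>n\<close>;
    \<open>t = 0\<close> then yields the zero column, so \<open>A\<close> may be rank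
    deficient.\<close>
  define t where "t = (if N = 0 then 0 else 1 / sqrt N)"
  define U' where "U' = (\<lambda>j k. if k < d then U j k else t * \<rho> j)"
  have vnn: "0 \<le> v j * a\<^sup>2" if "j < n" for j a using v[OF that] by simp
  have N0: "0 \<le> N" unfolding N_def by (intro sum_nonneg) (use vnn in auto)
  have \<rho>0: "\<rho> j = 0" if "N = 0" "j < n" for j
  proof -
    have "v j * (\<rho> j)\<^sup>2 = 0"
      using that vnn unfolding N_def by (subst (asm) sum_nonneg_eq_0_iff) auto
    then show ?thesis using v[OF that(2)] by simp
  qed
  have tN: "sqrt N * (t * \<rho> j) = \<rho> j" if "j < n" for j
    using that \<rho>0 by (auto simp: t_def N0)
  have mvU': "mat_vec d U' x j = mat_vec d U x j" for x j
    by (intro mat_vec_cong) (auto simp: U'_def)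
  have "same_range n (Suc d) A U'"
    unfolding same_range_def
  proof (intro conjI allI)
    fix x
    obtain y where y: "\<forall>j<n. mat_vec d A x j = mat_vec d U y j"
      using sr unfolding same_range_def by blast
    let ?y = "\<lambda>k. if k < d then y k + x d * g k else x d * sqrt N"
    have "mat_vec (Suc d) A x j = mat_vec (Suc d) U' ?y j" if "j < n" for j
    proof -
      have "mat_vec (Suc d) A x j = mat_vec d U y j + (\<rho> j + mat_vec d U g j) * x d"
        using y that by (simp add: mat_vec_Suc \<rho>_def)
      also have "... = mat_vec d U (\<lambda>k. y k + x d * g k) j + x d * (sqrt N * (t * \<rho> j))"
        using that by (simp only: mat_vec_add_scaled tN) (simp add: algebra_simps)
      also have "mat_vec d U (\<lambda>k. y k + x d * g k) j = mat_vec d U' ?y j"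
        unfolding mvU' by (intro mat_vec_cong) auto
      finally show ?thesis by (simp add: mat_vec_Suc U'_def mult_ac)
    qed
    then show "\<exists>y. \<forall>j<n. mat_vec (Suc d) A x j = mat_vec (Suc d) U' y j" by blast
  next
    fix y
    obtain x where x: "\<forall>j<n. mat_vec d U (\<lambda>k. y k + (- (y d * t)) * g k) j = mat_vec d A x j"
      using sr unfolding same_range_def by blast
    let ?x = "\<lambda>k. if k < d then x k else y d * t"
    have "mat_vec (Suc d) U' y j = mat_vec (Suc d) A ?x j" if "j < n" for j
    proof -
      have "mat_vec (Suc d) U' y j = mat_vec d U y j + t * \<rho> j * y d"
        by (simp add: mat_vec_Suc mvU') (simp add: U'_def)
      also have "... = mat_vec d U (\<lambda>k. y k + (- (y d * t)) * g k) j + A j d * (y d * t)"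
        unfolding mat_vec_add_scaled by (simp add: \<rho>_def algebra_simps)
      also have "... = mat_vec d A ?x j + A j d * (y d * t)"
        using x that by (simp cong: mat_vec_cong)
      finally show ?thesis by (simp add: mat_vec_Suc)
    qed
    then show "\<exists>x. \<forall>j<n. mat_vec (Suc d) U' y j = mat_vec (Suc d) A x j" by blast
  qed
  moreover have "orthonormal_cols v n (Suc d) U'"
  proof -
    have old: "(\<Sum>j<n. v j * U j k * U j l) = (if k = l \<and> (\<exists>j<n. U j k \<noteq> 0) then 1 else 0)"
      if "k < d" "l < d" for k l using oc that unfolding orthonormal_cols_def by blast
    have orth: "(\<Sum>j<n. v j * U j k * \<rho> j) = 0" if k: "k < d" for k
    proof -
      have "(\<Sum>j<n. v j * U j k * \<rho> j) = g k - (\<Sum>j<n. \<Sum>l<d. g l * (v j * U j k * U j l))"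
        by (simp add: \<rho>_def g_def mat_vec_def sum_subtractf algebra_simps sum_distrib_left)
      also have "(\<Sum>j<n. \<Sum>l<d. g l * (v j * U j k * U j l)) = (\<Sum>l<d. g l * (\<Sum>j<n. v j * U j k * U j l))"
        by (subst sum.swap) (simp add: sum_distrib_left)
      also have "... = (\<Sum>l<d. if k = l then (if \<exists>j<n. U j k \<noteq> 0 then g k else 0) else 0)"
        using k by (intro sum.cong) (auto simp: old)
      also have "... = (if \<exists>j<n. U j k \<noteq> 0 then g k else 0)" using k by simp
      also have "... = g k" by (auto simp: g_def)
      finally show ?thesis by simp
    qed
    have orth': "(\<Sum>j<n. v j * U j k * (t * \<rho> j)) = 0" "(\<Sum>j<n. v j * (t * \<rho> j) * U j k) = 0" if "k < d" for k
    proof -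
      have "(\<Sum>j<n. v j * U j k * (t * \<rho> j)) = t * (\<Sum>j<n. v j * U j k * \<rho> j)"
        by (simp add: sum_distrib_left mult_ac)
      then show "(\<Sum>j<n. v j * U j k * (t * \<rho> j)) = 0" using orth[OF that] by simp
      then show "(\<Sum>j<n. v j * (t * \<rho> j) * U j k) = 0" by (simp add: mult_ac)
    qed
    have new: "(\<Sum>j<n. v j * (t * \<rho> j) * (t * \<rho> j)) = (if \<exists>j<n. t * \<rho> j \<noteq> 0 then 1 else 0)"
    proof -
      have e: "(\<Sum>j<n. v j * (t * \<rho> j) * (t * \<rho> j)) = t\<^sup>2 * N"
        by (simp add: N_def sum_distrib_left power2_eq_square mult_ac)
      show ?thesis
      proof (cases "N = 0")
        case True
        then show ?thesis by (simp add: t_def)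
      next
        case False
        then have "t\<^sup>2 * N = 1" using N0 by (simp add: t_def power_divide)
        moreover have "\<exists>j<n. t * \<rho> j \<noteq> 0"
          using e calculation by (metis (no_types, lifting) lessThan_iff mult_zero_right sum.neutral zero_neq_one)
        ultimately show ?thesis using e by simp
      qed
    qed
    show ?thesis
      unfolding orthonormal_cols_def
      by (auto simp: less_Suc_eq U'_def old orth' new)
  qed
  ultimately show ?case by blast
qed

lemma sum_weighted_mat_vec_sq:
  assumes "orthonormal_cols v n d U"
  shows "(\<Sum>j<n. v j * (mat_vec d U y j)\<^sup>2) = (\<Sum>k<d. if \<exists>j<n. U j k \<noteq> 0 then (y k)\<^sup>2 else 0)"
proof -
  have "(\<Sum>j<n. v j * (mat_vec d U y j)\<^sup>2) = (\<Sum>j<n. \<Sum>k<d. \<Sum>l<d. y k * y l * (v j * U j k * U j l))"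
    by (simp add: mat_vec_def power2_eq_square sum_product sum_distrib_left mult_ac)
  also have "... = (\<Sum>k<d. \<Sum>j<n. \<Sum>l<d. y k * y l * (v j * U j k * U j l))"
    by (rule sum.swap)
  also have "... = (\<Sum>k<d. \<Sum>l<d. \<Sum>j<n. y k * y l * (v j * U j k * U j l))"
    by (rule sum.cong[OF refl], rule sum.swap)
  also have "... = (\<Sum>k<d. \<Sum>l<d. y k * y l * (\<Sum>j<n. v j * U j k * U j l))"
    by (simp add: sum_distrib_left)
  also have "... = (\<Sum>k<d. \<Sum>l<d. if k = l then (if \<exists>j<n. U j k \<noteq> 0 then (y k)\<^sup>2 else 0) else 0)"
    using assms by (intro sum.cong refl) (auto simp: orthonormal_cols_def power2_eq_square)
  also have "... = (\<Sum>k<d. if \<exists>j<n. U j k \<noteq> 0 then (y k)\<^sup>2 else 0)"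
    by (intro sum.cong refl) simp
  finally show ?thesis .
qed

lemma same_range_coords:
  assumes sr: "same_range n d A U" and oc: "orthonormal_cols v n d U"
  shows "\<exists>y. (\<forall>j<n. mat_vec d A x j = mat_vec d U y j) \<and>
    (sq_norm d y) = (\<Sum>j<n. v j * (mat_vec d A x j)\<^sup>2)"
proof -
  obtain y where y: "\<forall>j<n. mat_vec d A x j = mat_vec d U y j"
    using sr unfolding same_range_def by blast
  \<comment> \<open>Coordinates along zero columns do not influence the product but would spoil the
    norm identity, so they are set to 0.\<close>
  let ?y = "\<lambda>k. if \<exists>j<n. U j k \<noteq> 0 then y k else 0"
  have eq: "mat_vec d U y j = mat_vec d U ?y j" if "j < n" for j
    using that unfolding mat_vec_def by (intro sum.cong) auto
  have "(\<Sum>j<n. v j * (mat_vec d A x j)\<^sup>2) = (\<Sum>j<n. v j * (mat_vec d U y j)\<^sup>2)" using y by simp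
  also have "... = (\<Sum>k<d. (?y k)\<^sup>2)"
    unfolding sum_weighted_mat_vec_sq[OF oc] by (intro sum.cong) auto
  finally have "(\<Sum>k<d. (?y k)\<^sup>2) = (\<Sum>j<n. v j * (mat_vec d A x j)\<^sup>2)" by simp
  moreover have "\<forall>j<n. mat_vec d A x j = mat_vec d U ?y j" using y eq by simp
  ultimately show ?thesis by blast
qed

lemma mat_vec_sq_le: "(mat_vec d U y j)\<^sup>2 \<le> (sq_norm d (U j)) * (sq_norm d y)"
  unfolding mat_vec_def by (rule Cauchy_Schwarz_ineq_sum)

text \<open>For positive \<open>v\<close> this is the quantity \<open>a_j^T (A^T V A)^+ a_j\<close>
  with \<open>V = diag v\<close>, the leverage score without its weight factor. It is independent of
  the chosen basis: \<open>mat_vec_sq_le_leverage\<close> and \<open>leverage_attained\<close>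
  identify it as the largest value of \<open>(A x)_j^2\<close> over all \<open>x\<close> of weighted
  square norm at most 1.\<close>

definition leverage :: "nat \<Rightarrow> nat \<Rightarrow> (nat \<Rightarrow> nat \<Rightarrow> real) \<Rightarrow> (nat \<Rightarrow> real) \<Rightarrow> nat \<Rightarrow> real" where
  "leverage n d A v j =
    (\<Sum>k<d. ((SOME U. same_range n d A U \<and> orthonormal_cols v n d U) j k)\<^sup>2)"

context
  fixes n d :: nat and A :: "nat \<Rightarrow> nat \<Rightarrow> real" and v :: "nat \<Rightarrow> real"
  assumes v: "\<And>j. j < n \<Longrightarrow> 0 < v j"
begin

lemma leverage_basis:
  obtains U where "same_range n d A U" "orthonormal_cols v n d U"
    "\<And>j. leverage n d A v j = (sq_norm d (U j))"
  using someI_ex[OF weighted_gram_schmidt[where n = n and v = v and A = A and d = d, OF v]] that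
  unfolding leverage_def by blast

lemma mat_vec_sq_le_leverage:
  assumes "j < n"
  shows "(mat_vec d A x j)\<^sup>2 \<le> leverage n d A v j * (\<Sum>i<n. v i * (mat_vec d A x i)\<^sup>2)"
proof -
  obtain U where U: "same_range n d A U" "orthonormal_cols v n d U"
    "\<And>j. leverage n d A v j = (sq_norm d (U j))" by (rule leverage_basis) blast
  obtain y where y: "\<forall>j<n. mat_vec d A x j = mat_vec d U y j"
    "sq_norm d y = (\<Sum>j<n. v j * (mat_vec d A x j)\<^sup>2)"
    using same_range_coords[OF U(1,2)] by blast
  then show ?thesis using mat_vec_sq_le[of d U y j] U(3) assms by simp
qed

lemma leverage_attained:
  assumes "j < n"
  shows "\<exists>x. mat_vec d A x j = leverage n d A v j \<and>
    (\<Sum>i<n. v i * (mat_vec d A x i)\<^sup>2) = leverage n d A v j"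
proof -
  obtain U where U: "same_range n d A U" "orthonormal_cols v n d U"
    "\<And>j. leverage n d A v j = (sq_norm d (U j))" by (rule leverage_basis) blast
  \<comment> \<open>Equality in Cauchy-Schwarz: the row \<open>U j\<close> itself serves as the
    coordinate vector.\<close>
  obtain x where x: "\<forall>i<n. mat_vec d U (U j) i = mat_vec d A x i"
    using U(1) unfolding same_range_def by blast
  have "mat_vec d A x j = leverage n d A v j"
    using x assms U(3) by (simp add: mat_vec_def power2_eq_square flip: x)
  moreover have "(\<Sum>i<n. v i * (mat_vec d A x i)\<^sup>2) = leverage n d A v j"
  proof -
    have "(\<Sum>i<n. v i * (mat_vec d A x i)\<^sup>2) = (\<Sum>i<n. v i * (mat_vec d U (U j) i)\<^sup>2)"
      using x by simp
    also have "... = (sq_norm d (U j))"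
      unfolding sum_weighted_mat_vec_sq[OF U(2)] using assms by (intro sum.cong) auto
    finally show ?thesis using U(3) by simp
  qed
  ultimately show ?thesis by blast
qed

lemma leverage_nonneg: "0 \<le> leverage n d A v j"
  by (simp add: leverage_def sum_nonneg)

lemma leverage_pos:
  assumes "j < n" "mat_vec d A x j \<noteq> 0"
  shows "0 < leverage n d A v j"
proof -
  have "0 < (mat_vec d A x j)\<^sup>2" using assms by simp
  also note mat_vec_sq_le_leverage[OF assms(1), of x]
  finally show ?thesis using leverage_nonneg[of j] by (metis mult_zero_left order_less_le)
qed

end

text \<open>The maximizer for \<open>v'\<close> is inserted into the variational inequality for
  \<open>v\<close>, which gives \<open>?l'\<^sup>2 \<le> ?l * (g * ?l')\<close>.\<close>

lemma leverage_mono_scaled: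
  assumes v: "\<And>j. j < n \<Longrightarrow> 0 < v j" and v': "\<And>j. j < n \<Longrightarrow> 0 < v' j"
    and le: "\<And>i. i < n \<Longrightarrow> v i \<le> g * v' i" and g: "0 \<le> g" and j: "j < n"
  shows "leverage n d A v' j \<le> g * leverage n d A v j"
proof -
  let ?l = "leverage n d A v j" and ?l' = "leverage n d A v' j"
  obtain x where x: "mat_vec d A x j = ?l'" "(\<Sum>i<n. v' i * (mat_vec d A x i)\<^sup>2) = ?l'"
    using leverage_attained[where v = v' and n = n, OF v' j] by blast
  have "?l'\<^sup>2 \<le> ?l * (\<Sum>i<n. v i * (mat_vec d A x i)\<^sup>2)"
    using mat_vec_sq_le_leverage[where v = v and n = n and x = x and d = d and A = A, OF v j] x by simp
  also have "... \<le> ?l * (\<Sum>i<n. g * (v' i * (mat_vec d A x i)\<^sup>2))"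
  proof (intro mult_left_mono sum_mono)
    show "v i * (mat_vec d A x i)\<^sup>2 \<le> g * (v' i * (mat_vec d A x i)\<^sup>2)" if "i \<in> {..<n}" for i
      using mult_right_mono[OF le, of i "(mat_vec d A x i)\<^sup>2"] that by (simp add: mult.assoc)
  qed (rule leverage_nonneg[where v = v and n = n, OF v])
  also have "... = g * ?l * ?l'" by (simp add: sum_distrib_left[symmetric] x(2))
  finally have "?l' * ?l' \<le> g * ?l * ?l'" by (simp add: power2_eq_square)
  then show ?thesis
    using leverage_nonneg[where v = v' and n = n and j = j and d = d and A = A, OF v'] leverage_nonneg[where v = v and n = n and j = j and d = d and A = A, OF v] g
    by (cases "?l' = 0") auto
qed

text \<open>An approximate change of density of Lewis. The map \<open>w \<mapsto> leverage (w powr (1 - 2/p)) powr (p/2)\<close>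
  is a contraction with factor \<open>1 - p/2\<close> for the metric \<open>max\<^sub>j \<bar>ln (w j / w' j)\<bar>\<close>
  (Cohen and Peng), so finitely many iterations give a fixed point up to a factor 2.\<close>
lemma approximate_lewis_weights:
  assumes p: "1 \<le> p" "p < 2"
  obtains w where "\<And>j. j < n \<Longrightarrow> 0 < w j"
    "\<And>j x. j < n \<Longrightarrow> mat_vec d A x j \<noteq> 0 \<Longrightarrow>
      leverage n d A (\<lambda>j. w j powr (1 - 2/p)) j powr (p/2) \<le> 2 * w j \<and>
      w j \<le> 2 * leverage n d A (\<lambda>j. w j powr (1 - 2/p)) j powr (p/2)"
proof -
  define nz where "nz = (\<lambda>j. \<exists>x. mat_vec d A x j \<noteq> 0)"
  define V :: "(nat \<Rightarrow> real) \<Rightarrow> nat \<Rightarrow> real" where "V = (\<lambda>w j. w j powr (1 - 2/p))"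
  \<comment> \<open>Zero rows have leverage 0; the dummy value 1 keeps all iterates
    positive.\<close>
  define f :: "(nat \<Rightarrow> real) \<Rightarrow> nat \<Rightarrow> real" where "f = (\<lambda>w j. if nz j then leverage n d A (V w) j powr (p/2) else 1)"
  define W where "W = (\<lambda>i. (f ^^ i) (\<lambda>_. 1))"
  define \<rho> :: real where "\<rho> = 1 - p/2"
  have \<rho>: "0 < \<rho>" "\<rho> < 1" using p by (auto simp: \<rho>_def)
  have WS: "W (Suc i) = f (W i)" for i by (simp add: W_def)
  have f_pos: "0 < f w j" if "\<And>j. j < n \<Longrightarrow> 0 < w j" "j < n" for w j
  proof (cases "nz j")
    case True
    then obtain x where "mat_vec d A x j \<noteq> 0" by (auto simp: nz_def)
    then have "0 < leverage n d A (V w) j"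
      using that by (intro leverage_pos[where x = x]) (auto simp: V_def, metis less_irrefl)
    then show ?thesis by (simp add: f_def)
  qed (simp add: f_def)
  have Wpos: "0 < W i j" if "j < n" for i j
    using that
  proof (induction i arbitrary: j)
    case 0
    then show ?case by (simp add: W_def)
  next
    case (Suc i)
    then show ?case unfolding WS by (intro f_pos) auto
  qed
  \<comment> \<open>The contraction, one side at a time. The exponent \<open>1 - 2/p\<close> is
    negative and reverses the comparison of the weights, the leverage reverses it again, and
    \<open>(2/p - 1) * (p/2) = \<rho>\<close>.\<close>
  have V_step: "f w' j \<le> g powr \<rho> * f w j"
    if pos: "\<And>j. j < n \<Longrightarrow> 0 < w j" "\<And>j. j < n \<Longrightarrow> 0 < w' j"
      and le: "\<And>j. j < n \<Longrightarrow> w' j \<le> g * w j" and g: "1 \<le> g" and j: "j < n" for w w' g j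
  proof (cases "nz j")
    case True
    have Vle: "V w i \<le> g powr (2/p - 1) * V w' i" if i: "i < n" for i
    proof -
      have "(g * w i) powr (1 - 2/p) \<le> w' i powr (1 - 2/p)"
        using pos i le[OF i] g p by (intro powr_mono2') (auto simp: field_simps)
      then have "g powr (2/p - 1) * (g powr (1 - 2/p) * w i powr (1 - 2/p)) \<le> g powr (2/p - 1) * w' i powr (1 - 2/p)"
        using g pos i by (intro mult_left_mono) (auto simp: powr_mult less_imp_le)
      then show ?thesis using g by (simp add: V_def powr_add[symmetric] flip: mult.assoc)
    qed
    have "leverage n d A (V w') j \<le> g powr (2/p - 1) * leverage n d A (V w) j"
      using pos Vle j g by (intro leverage_mono_scaled) (auto simp: V_def, (metis less_irrefl)+)
    then have "leverage n d A (V w') j powr (p/2) \<le> (g powr (2/p - 1) * leverage n d A (V w) j) powr (p/2)"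
      using p by (intro powr_mono2) (auto simp: leverage_nonneg leverage_def sum_nonneg)
    also have "... = (g powr (2/p - 1)) powr (p/2) * leverage n d A (V w) j powr (p/2)"
      using g by (simp add: powr_mult leverage_def sum_nonneg)
    also have "(g powr (2/p - 1)) powr (p/2) = g powr \<rho>"
      using p by (simp add: powr_powr \<rho>_def algebra_simps)
    finally show ?thesis using True by (simp add: f_def)
  next
    case False
    then show ?thesis using g \<rho> by (simp add: f_def ge_one_powr_ge_zero)
  qed
  \<comment> \<open>Since \<open>W 0\<close> is constantly 1, this crude number bounds the ratio of
    the first two iterates in both directions.\<close>
  define g0 where "g0 = (\<Sum>j<n. W 1 j + 1 / W 1 j) + 1"
  have g0: "1 \<le> g0" unfolding g0_def
    using Wpos by (auto intro!: sum_nonneg add_nonneg_nonneg simp: less_imp_le)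
  have term_le: "W 1 j + 1 / W 1 j \<le> g0" if "j < n" for j
  proof -
    have "W 1 j + 1 / W 1 j \<le> (\<Sum>j<n. W 1 j + 1 / W 1 j)"
      using that Wpos by (intro member_le_sum) (auto simp: less_imp_le)
    then show ?thesis by (simp add: g0_def)
  qed
  have ratio: "\<forall>j<n. W (Suc i) j \<le> g0 powr (\<rho> ^ i) * W i j \<and> W i j \<le> g0 powr (\<rho> ^ i) * W (Suc i) j" for i
  proof (induction i)
    case 0
    have "W 1 j \<le> g0 \<and> 1 \<le> g0 * W 1 j" if "j < n" for j
    proof -
      have "1 / W 1 j > 0" "W 1 j > 0" using Wpos[OF that, of 1] by auto
      then have "W 1 j \<le> g0" "1 / W 1 j \<le> g0" using term_le[OF that] by linarith+
      then show ?thesis using \<open>W 1 j > 0\<close> by (auto simp: pos_divide_le_eq)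
    qed
    moreover have "W 0 j = 1" for j by (simp add: W_def)
    ultimately show ?case using g0 by simp
  next
    case (Suc i)
    let ?g = "g0 powr (\<rho> ^ i)"
    have g: "1 \<le> ?g" using g0 \<rho> by (intro ge_one_powr_ge_zero) auto
    have e: "?g powr \<rho> = g0 powr (\<rho> ^ Suc i)" by (simp add: powr_powr mult.commute)
    show ?case
      using V_step[of "W i" "W (Suc i)" ?g] V_step[of "W (Suc i)" "W i" ?g] Suc Wpos g
      unfolding e WS[symmetric] by blast
  qed
  \<comment> \<open>Chosen so that \<open>g0 powr (\<rho> ^ i) \<le> 2\<close>; the summand 1 keeps
    the denominator positive when \<open>g0 = 1\<close>.\<close>
  obtain i where i: "\<rho> ^ i < ln 2 / (ln g0 + 1)"
    using real_arch_pow_inv[of "ln 2 / (ln g0 + 1)" \<rho>] \<rho> g0 by (auto simp: add_nonneg_pos)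
  have g2: "g0 powr (\<rho> ^ i) \<le> 2"
  proof -
    have "\<rho> ^ i * ln g0 \<le> \<rho> ^ i * (ln g0 + 1)" using \<rho> by (intro mult_left_mono) auto
    also have "... \<le> ln 2" using i g0 by (simp add: pos_less_divide_eq add_nonneg_pos less_imp_le)
    finally have "exp (\<rho> ^ i * ln g0) \<le> 2" by (metis exp_le_cancel_iff exp_ln zero_less_numeral)
    then show ?thesis using g0 by (simp add: powr_def)
  qed
  show ?thesis
  proof (rule that[of "W i"])
    show "0 < W i j" if "j < n" for j using Wpos that by blast
    fix j x assume j: "j < n" and x: "mat_vec d A x j \<noteq> 0"
    have fW: "leverage n d A (\<lambda>j. W i j powr (1 - 2/p)) j powr (p/2) = W (Suc i) j"
      using x by (auto simp: WS f_def V_def nz_def)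
    have "g0 powr (\<rho> ^ i) * W i j \<le> 2 * W i j" "g0 powr (\<rho> ^ i) * W (Suc i) j \<le> 2 * W (Suc i) j"
      using g2 Wpos[OF j] by (auto intro!: mult_right_mono simp: less_imp_le)
    then show "leverage n d A (\<lambda>j. W i j powr (1 - 2/p)) j powr (p/2) \<le> 2 * W i j \<and>
      W i j \<le> 2 * leverage n d A (\<lambda>j. W i j powr (1 - 2/p)) j powr (p/2)"
      unfolding fW using ratio[of i] j by (meson order_trans)
  qed
qed

text \<open>Let \<open>v = w powr (1 - 2/p)\<close> and let \<open>f j\<close> be the
  \<open>p\<close>-th power of the norm of row \<open>j\<close>. The approximate fixed point gives
  \<open>f j \<le> 2 * v j * |u_j|^2\<close>, and the weighted squares of all rows sum to at most
  \<open>d\<close>, one for each nonzero orthonormal column. For the norm comparison,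
  \<open>|(A x)_j|^2\<close> is split into the powers \<open>2 - p\<close> and \<open>p\<close>;
  Cauchy-Schwarz bounds the first by row norm and coordinate norm, and \<open>v j\<close> cancels
  the row norm.\<close>

lemma lewis_basis:
  assumes p: "1 \<le> p" "p < 2"
  obtains U where
    "\<And>x. \<exists>y. (\<forall>j<n. mat_vec d A x j = mat_vec d U y j) \<and>
      (sq_norm d y) powr (p/2) \<le> 2 * (mass p n (mat_vec d A x))"
    "(\<Sum>j<n. (sq_norm d (U j)) powr (p/2)) \<le> 2 * d"
proof -
  obtain w where w: "\<And>j. j < n \<Longrightarrow> 0 < w j"
    "\<And>j x. j < n \<Longrightarrow> mat_vec d A x j \<noteq> 0 \<Longrightarrow>
      leverage n d A (\<lambda>j. w j powr (1 - 2/p)) j powr (p/2) \<le> 2 * w j \<and>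
      w j \<le> 2 * leverage n d A (\<lambda>j. w j powr (1 - 2/p)) j powr (p/2)"
    using approximate_lewis_weights[OF p, of n d A] by blast
  define v where "v = (\<lambda>j. w j powr (1 - 2/p))"
  have v: "0 < v j" if "j < n" for j using w(1)[OF that] by (simp add: v_def)
  obtain U where U: "same_range n d A U" "orthonormal_cols v n d U"
    "\<And>j. leverage n d A v j = (sq_norm d (U j))" by (rule leverage_basis[where v = v and n = n, OF v]) auto
  define f where "f = (\<lambda>j. (sq_norm d (U j)) powr (p/2))"
  have f0: "0 \<le> f j" for j by (simp add: f_def)
  have lev: "(sq_norm d (U j)) = f j powr (2/p)" for j
    using p by (simp add: f_def powr_powr sum_nonneg)
  have fw: "f j \<le> 2 * w j" "w j \<le> 2 * f j" if "j < n" "mat_vec d A x j \<noteq> 0" for j x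
    using w(2)[OF that] U(3) by (auto simp: v_def[symmetric] f_def)
  have s: "0 \<le> 2/p - 1" "2/p - 1 \<le> 1" using p by (auto simp: field_simps)
  \<comment> \<open>The fixed point is exact only up to a factor 2; raised to \<open>2/p - 1\<close>
    this is still at most 2, the constant in both claims.\<close>
  have two: "2 powr (2/p - 1) \<le> (2::real)" using s powr_mono[of "2/p - 1" 1 "2::real"] by simp
  have zero_row: "f j = 0" if j: "j < n" and "\<And>x. mat_vec d A x j = 0" for j
  proof -
    obtain x where "mat_vec d A x j = leverage n d A v j"
      using leverage_attained[where v = v and n = n, OF v j] by blast
    then show ?thesis using that U(3) by (simp add: f_def)
  qed
  show ?thesis
  proof (rule that)
    fix x
    obtain y where y: "\<forall>j<n. mat_vec d A x j = mat_vec d U y j"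
      "sq_norm d y = (\<Sum>j<n. v j * (mat_vec d A x j)\<^sup>2)"
      using same_range_coords[OF U(1,2)] by blast
    define Y where "Y = (sq_norm d y)"
    have Y0: "0 \<le> Y" by (simp add: Y_def sum_nonneg)
    have "v j * (mat_vec d A x j)\<^sup>2 \<le> 2 * Y powr (1 - p/2) * \<bar>mat_vec d A x j\<bar> powr p" if j: "j < n" for j
    proof (cases "mat_vec d A x j = 0")
      case False
      let ?a = "\<bar>mat_vec d A x j\<bar>"
      have fj: "0 < f j" using fw(2)[OF j False] w(1)[OF j] by simp
      have "?a\<^sup>2 \<le> f j powr (2/p) * Y"
        using mat_vec_sq_le[of d U y j] y(1) j lev by (simp add: Y_def)
      then have "(?a\<^sup>2) powr (1 - p/2) \<le> (f j powr (2/p) * Y) powr (1 - p/2)"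
        using p by (intro powr_mono2) auto
      also have "... = f j powr (2/p - 1) * Y powr (1 - p/2)"
        using p Y0 by (simp add: powr_mult powr_powr algebra_simps)
      finally have "(?a\<^sup>2) powr (1 - p/2) \<le> f j powr (2/p - 1) * Y powr (1 - p/2)" .
      then have a2: "?a powr (2 - p) \<le> f j powr (2/p - 1) * Y powr (1 - p/2)"
      proof -
        have "(?a\<^sup>2) powr (1 - p/2) = (?a powr 2) powr (1 - p/2)" using False by simp
        also have "... = ?a powr (2 - p)" by (simp only: powr_powr) (simp add: algebra_simps)
        finally have "(?a\<^sup>2) powr (1 - p/2) = ?a powr (2 - p)" .
        then show ?thesis using \<open>(?a\<^sup>2) powr (1 - p/2) \<le> f j powr (2/p - 1) * Y powr (1 - p/2)\<close> by simp
      qed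
      have "v j * ?a\<^sup>2 = v j * ?a powr (2 - p) * ?a powr p"
        using False by (simp add: powr_add[symmetric] mult.assoc)
      also have "... \<le> v j * (f j powr (2/p - 1) * Y powr (1 - p/2)) * ?a powr p"
        using a2 v[OF j] by (intro mult_right_mono mult_left_mono) auto
      also have "... = (v j * f j powr (2/p - 1)) * (Y powr (1 - p/2) * ?a powr p)" by simp
      also have "... \<le> 2 * (Y powr (1 - p/2) * ?a powr p)"
      proof (intro mult_right_mono)
        have "f j powr (2/p - 1) \<le> (2 * w j) powr (2/p - 1)"
          using fw[OF j False] fj s by (intro powr_mono2) auto
        also have "... \<le> 2 * w j powr (2/p - 1)"
          using two w(1)[OF j] by (simp add: powr_mult)
        finally have "v j * f j powr (2/p - 1) \<le> v j * (2 * w j powr (2/p - 1))"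
          using v[OF j] by simp
        also have "... = 2" using w(1)[OF j] by (simp add: v_def powr_add[symmetric])
        finally show "v j * f j powr (2/p - 1) \<le> 2" .
      qed auto
      finally show ?thesis by simp
    qed auto
    then have "Y \<le> (\<Sum>j<n. 2 * Y powr (1 - p/2) * \<bar>mat_vec d A x j\<bar> powr p)"
      unfolding Y_def y(2) by (intro sum_mono) auto
    also have "... = Y powr (1 - p/2) * (2 * (mass p n (mat_vec d A x)))"
      by (simp add: sum_distrib_left mult_ac)
    \<comment> \<open>A self-bounding inequality: dividing by \<open>Y powr (1 - p/2)\<close> leaves
      exactly \<open>Y powr (p/2)\<close>.\<close>
    finally have YY: "Y \<le> Y powr (1 - p/2) * (2 * (mass p n (mat_vec d A x)))" .
    have "Y powr (p/2) \<le> 2 * (mass p n (mat_vec d A x))"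
    proof (cases "Y = 0")
      case False
      then have Yp: "0 < Y" using Y0 by simp
      have "Y powr (1 - p/2) * Y powr (p/2) = Y" using Yp by (simp add: powr_add[symmetric])
      then have "Y powr (1 - p/2) * Y powr (p/2) \<le> Y powr (1 - p/2) * (2 * (mass p n (mat_vec d A x)))"
        using YY by simp
      then show ?thesis using Yp by simp
    qed (simp add: sum_nonneg)
    then show "\<exists>y. (\<forall>j<n. mat_vec d A x j = mat_vec d U y j) \<and>
      (sq_norm d y) powr (p/2) \<le> 2 * (mass p n (mat_vec d A x))"
      using y(1) unfolding Y_def by blast
  next
    have "f j \<le> 2 * (v j * (sq_norm d (U j)))" if j: "j < n" for j
    proof (cases "\<exists>x. mat_vec d A x j \<noteq> 0")
      case True
      then obtain x where x: "mat_vec d A x j \<noteq> 0" by blast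
      have fj: "0 < f j" using fw(2)[OF j x] w(1)[OF j] by simp
      have "w j powr (2/p - 1) \<le> (2 * f j) powr (2/p - 1)"
        using fw[OF j x] w(1)[OF j] s by (intro powr_mono2) auto
      also have "... \<le> 2 * f j powr (2/p - 1)" using two fj by (simp add: powr_mult)
      finally have "v j * w j powr (2/p - 1) \<le> v j * (2 * f j powr (2/p - 1))" using v[OF j] by simp
      moreover have "v j * w j powr (2/p - 1) = 1" using w(1)[OF j] by (simp add: v_def powr_add[symmetric])
      ultimately have "f j * 1 \<le> f j * (v j * (2 * f j powr (2/p - 1)))" using fj by (intro mult_left_mono) auto
      also have "... = 2 * (v j * (f j powr 1 * f j powr (2/p - 1)))" using fj by simp
      also have "f j powr 1 * f j powr (2/p - 1) = f j powr (2/p)" using fj by (subst powr_add[symmetric]) simp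
      finally show ?thesis by (simp add: lev)
    next
      case False
      then show ?thesis using zero_row[OF j] v[OF j] by (simp add: sum_nonneg)
    qed
    then have "(\<Sum>j<n. f j) \<le> (\<Sum>j<n. 2 * (v j * (sq_norm d (U j))))" by (intro sum_mono) auto
    also have "... = 2 * (\<Sum>k<d. \<Sum>j<n. v j * U j k * U j k)"
      by (subst sum.swap) (simp add: sum_distrib_left power2_eq_square mult_ac)
    also have "(\<Sum>k<d. \<Sum>j<n. v j * U j k * U j k) \<le> (\<Sum>k<d. 1)"
      using U(2) by (intro sum_mono) (auto simp: orthonormal_cols_def)
    finally show "(\<Sum>j<n. (sq_norm d (U j)) powr (p/2)) \<le> 2 * d" by (simp add: f_def)
  qed
qed

section \<open>Heavy-tailed entries\<close>

text \<open>Level 0 stands for a zero entry and takes the remaining mass, at least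
  \<open>1 - \<epsilon>\<close>. The cutoff \<open>N\<close> makes the support finite; it only has
  to satisfy \<open>32 * n \<le> 2 ^ N\<close>, because entries of mass below
  \<open>1 / (16 * n)\<close> are never asked to be lifted.\<close>

definition level_weight :: "real \<Rightarrow> nat \<Rightarrow> nat \<Rightarrow> real" where
  "level_weight \<epsilon> N k = (if k = 0 then 1 - \<epsilon> * (1 - (1/2) ^ N) else if k \<le> N then \<epsilon> / 2 ^ k else 0)"

definition level_pmf :: "real \<Rightarrow> nat \<Rightarrow> nat pmf" where
  "level_pmf \<epsilon> N = embed_pmf (level_weight \<epsilon> N)"

text \<open>The \<open>p\<close>-th power of an entry at level \<open>k \<ge> 1\<close> is \<open>2 ^ k\<close>; this has probability
  \<open>\<epsilon> / 2 ^ k\<close>, a discrete version of the tail of a \<open>p\<close>-stable variable.\<close>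
definition level_entry :: "real \<Rightarrow> nat \<Rightarrow> real" where
  "level_entry p k = (if k = 0 then 0 else 2 powr (k / p))"

abbreviation heavy_sketch ::
  "real \<Rightarrow> nat \<Rightarrow> (nat \<Rightarrow> real) \<Rightarrow> (nat \<Rightarrow> nat \<times> bool \<times> nat) \<Rightarrow> nat \<Rightarrow> real" where
  "heavy_sketch p n y \<equiv> bucket_sum {..<n} (\<lambda>j l. level_entry p l * y j)"

lemma level_entry_powr: "0 < p \<Longrightarrow> \<bar>level_entry p k\<bar> powr p = (if k = 0 then 0 else 2 ^ k)"
  by (simp add: level_entry_def powr_powr powr_realpow)

context
  fixes \<epsilon> :: real and N :: nat
  assumes \<epsilon>: "0 < \<epsilon>" "\<epsilon> < 1"
begin

lemma level_weight_nonneg: "0 \<le> level_weight \<epsilon> N k"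
proof -
  have "\<epsilon> * (1 - (1/2) ^ N) \<le> 1 * 1" using \<epsilon> by (intro mult_mono) (auto simp: power_le_one)
  then show ?thesis using \<epsilon> by (simp add: level_weight_def)
qed

lemma sum_level_weight: "(\<Sum>k\<le>N. level_weight \<epsilon> N k) = 1"
proof -
  have g: "(\<Sum>k = 1..M. (1/2) ^ k) = (1 - (1/2) ^ M :: real)" for M
    by (induction M) (auto simp: field_simps)
  have "(\<Sum>k\<le>N. level_weight \<epsilon> N k) = level_weight \<epsilon> N 0 + (\<Sum>k = 1..N. level_weight \<epsilon> N k)"
    by (simp add: atMost_atLeast0 sum.atLeast_Suc_atMost)
  also have "(\<Sum>k = 1..N. level_weight \<epsilon> N k) = (\<Sum>k = 1..N. \<epsilon> * (1/2) ^ k)"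
    by (intro sum.cong) (auto simp: level_weight_def power_divide)
  also have "... = \<epsilon> * (1 - (1/2) ^ N)" unfolding sum_distrib_left[symmetric] g ..
  finally show ?thesis by (simp add: level_weight_def)
qed

lemma pmf_level_pmf: "pmf (level_pmf \<epsilon> N) k = level_weight \<epsilon> N k"
  unfolding level_pmf_def
proof (rule pmf_embed_pmf)
  show "0 \<le> level_weight \<epsilon> N x" for x by (rule level_weight_nonneg)
  have "(\<integral>\<^sup>+ x. ennreal (level_weight \<epsilon> N x) \<partial>count_space UNIV)
      = (\<integral>\<^sup>+ x. ennreal (level_weight \<epsilon> N x) * indicator {..N} x \<partial>count_space UNIV)"
    by (intro nn_integral_cong) (auto simp: level_weight_def indicator_def)
  also have "... = (\<Sum>x\<le>N. ennreal (level_weight \<epsilon> N x))"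
    by (subst nn_integral_count_space_indicator[symmetric]) (auto simp: nn_integral_count_space_finite)
  also have "... = ennreal (\<Sum>x\<le>N. level_weight \<epsilon> N x)"
    by (simp add: sum_ennreal level_weight_nonneg)
  finally show "(\<integral>\<^sup>+ x. ennreal (level_weight \<epsilon> N x) \<partial>count_space UNIV) = 1"
    by (simp add: sum_level_weight)
qed

lemma set_level_pmf_subset: "set_pmf (level_pmf \<epsilon> N) \<subseteq> {..N}"
  by (auto simp: set_pmf_eq pmf_level_pmf level_weight_def)

lemma finite_set_level_pmf: "finite (set_pmf (level_pmf \<epsilon> N))"
  using set_level_pmf_subset by (rule finite_subset) simp

lemma avg_level_pmf: "avg (level_pmf \<epsilon> N) f = level_weight \<epsilon> N 0 * f 0 + (\<Sum>k = 1..N. \<epsilon> / 2 ^ k * f k)"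
proof -
  have "avg (level_pmf \<epsilon> N) f = (\<Sum>k\<le>N. level_weight \<epsilon> N k * f k)"
    by (subst integral_measure_pmf[of "{..N}"])
       (use set_level_pmf_subset in \<open>auto simp: pmf_level_pmf set_pmf_eq level_weight_nonneg\<close>)
  also have "... = level_weight \<epsilon> N 0 * f 0 + (\<Sum>k = 1..N. level_weight \<epsilon> N k * f k)"
    by (simp add: atMost_atLeast0 sum.atLeast_Suc_atMost)
  also have "(\<Sum>k = 1..N. level_weight \<epsilon> N k * f k) = (\<Sum>k = 1..N. \<epsilon> / 2 ^ k * f k)"
    by (intro sum.cong) (auto simp: level_weight_def)
  finally show ?thesis .
qed

lemma avg_level_pmf_le:
  assumes "f 0 = 0"
    and "\<And>k. 1 \<le> k \<Longrightarrow> k \<le> N \<Longrightarrow> 0 \<le> f k"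
  shows "avg (level_pmf \<epsilon> N) f \<le> (\<Sum>k = 1..N. f k / 2 ^ k)"
proof -
  have "avg (level_pmf \<epsilon> N) f = (\<Sum>k = 1..N. \<epsilon> * (f k / 2 ^ k))"
    by (simp add: avg_level_pmf assms)
  also have "... \<le> (\<Sum>k = 1..N. 1 * (f k / 2 ^ k))"
    using \<epsilon> assms by (intro sum_mono mult_right_mono) auto
  finally show ?thesis by simp
qed

lemma avg_level_nonzero_le: "avg (level_pmf \<epsilon> N) (\<lambda>l. if l = 0 then 0 else 1) \<le> \<epsilon>"
proof -
  have "avg (level_pmf \<epsilon> N) (\<lambda>l. if l = 0 then 0 else 1) = avg (level_pmf \<epsilon> N) (\<lambda>l. 1 - indicator {0} l)"
    by (intro arg_cong[where f = "avg (level_pmf \<epsilon> N)"]) (auto simp: indicator_def)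
  also have "... = 1 - pmf (level_pmf \<epsilon> N) 0"
    by (simp add: Bochner_Integration.integral_diff integrable_measure_pmf_finite[OF finite_set_level_pmf] measure_pmf_single)
  also have "... \<le> \<epsilon>" using \<epsilon> by (simp add: pmf_level_pmf level_weight_def)
  finally show ?thesis .
qed

text \<open>Level probabilities decay geometrically, so the tail is at most twice the bound
  \<open>2 powr (-l)\<close> at the first exceeding level \<open>l\<close>, where
  \<open>T < 2 ^ l * f\<close>.\<close>

lemma level_pmf_tail_le:
  assumes f: "0 \<le> f" and T: "0 < T"
  shows "avg (level_pmf \<epsilon> N) (\<lambda>l. if 1 \<le> l \<and> T < 2 ^ l * f then 1 else 0) \<le> 2 * f / T"
proof -
  \<comment> \<open>Removing level 1 shifts the others, which is the same sum for
    \<open>2 * g\<close> with half the weight; hence \<open>g\<close> is generalized.\<close>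
  have tail: "(\<Sum>l = 1..M. (if T < 2 ^ l * g then 1 else 0) / 2 ^ l) \<le> 2 * g / T" if "0 \<le> g" for M g
    using that
  proof (induction M arbitrary: g)
    case 0
    then show ?case using T by simp
  next
    case (Suc M)
    show ?case
    proof (cases "T < 2 * g")
      case True
      have g: "(\<Sum>k = 1..M. (1/2) ^ k) \<le> (1 :: real)" for M
      proof -
        have "(\<Sum>k = 1..M. (1/2) ^ k) = (1 - (1/2) ^ M :: real)" by (induction M) (auto simp: field_simps)
        then show ?thesis by simp
      qed
      have "(\<Sum>l = 1..Suc M. (if T < 2 ^ l * g then 1 else 0) / 2 ^ l) \<le> (\<Sum>l = 1..Suc M. (1/2) ^ l :: real)"
        by (intro sum_mono) (auto simp: power_divide)
      also have "... \<le> 1" by (rule g)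
      also have "... \<le> 2 * g / T" using True T by simp
      finally show ?thesis .
    next
      case False
      have "(\<Sum>l = 1..Suc M. (if T < 2 ^ l * g then 1 else 0) / 2 ^ l :: real)
         = (\<Sum>l = 1..M. (if T < 2 ^ Suc l * g then 1 else 0) / 2 ^ Suc l)"
        using False by (subst sum.atLeast_Suc_atMost) (auto simp: sum.shift_bounds_cl_Suc_ivl simp del: sum.cl_ivl_Suc)
      also have "... = (1/2) * (\<Sum>l = 1..M. (if T < 2 ^ l * (2 * g) then 1 else 0) / 2 ^ l)"
        unfolding sum_distrib_left by (intro sum.cong) (auto simp: mult_ac)
      also have "... \<le> (1/2) * (2 * (2 * g) / T)" using Suc.IH[of "2 * g"] Suc.prems by (intro mult_left_mono) simp_all
      finally show ?thesis by simp
    qed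
  qed
  have "avg (level_pmf \<epsilon> N) (\<lambda>l. if 1 \<le> l \<and> T < 2 ^ l * f then 1 else 0)
      \<le> (\<Sum>l = 1..N. (if 1 \<le> l \<and> T < 2 ^ l * f then 1 else 0) / 2 ^ l)"
    by (rule avg_level_pmf_le) auto
  also have "... = (\<Sum>l = 1..N. (if T < 2 ^ l * f then 1 else 0) / 2 ^ l)"
    by (intro sum.cong) auto
  also have "... \<le> 2 * f / T" using f by (rule tail)
  finally show ?thesis .
qed

lemma level_pmf_truncated_second_moment_le:
  assumes p: "1 \<le> p" "p < 2" and f: "0 \<le> f" and \<tau>: "0 < \<tau>"
  shows "avg (level_pmf \<epsilon> N) (\<lambda>l. if 1 \<le> l \<and> 2 ^ l * f \<le> \<tau> then (level_entry p l)\<^sup>2 * f powr (2/p) else 0)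
    \<le> f * \<tau> powr (2/p - 1) / (1 - 2 powr (1 - 2/p))"
proof (cases "f = 0")
  case True
  then have "(\<lambda>l. if 1 \<le> l \<and> 2 ^ l * f \<le> \<tau> then (level_entry p l)\<^sup>2 * f powr (2/p) else 0) = (\<lambda>l. 0)"
    by (auto simp: fun_eq_iff)
  then show ?thesis using True by simp
next
  case False
  then have f: "0 < f" using f by simp
  define s where "s = 2/p - 1"
  have s: "0 < s" using p by (simp add: s_def)
  define q where "q = 2 powr (- s)"
  have q: "0 < q" "q < 1" using s powr_less_mono[of "-s" 0 "2::real"] by (auto simp: q_def)
  have geo: "(\<Sum>l = 1..M. if 2 ^ l * f \<le> \<tau> then (2 ^ l * f) powr s else 0) \<le> (min \<tau> (2 ^ M * f)) powr s / (1 - q)" for M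
  proof (induction M)
    case 0
    then show ?case using q by simp
  next
    case (Suc M)
    show ?case
    proof (cases "2 ^ Suc M * f \<le> \<tau>")
      case True
      have "2 ^ M * f \<le> 2 ^ Suc M * f" using f by simp
      then have M: "2 ^ M * f \<le> \<tau>" using True by linarith
      have e: "(2 ^ Suc M * f) powr s * q = (2 ^ M * f) powr s"
        using f by (simp add: q_def powr_mult powr_minus)
      have "(\<Sum>l = 1..Suc M. if 2 ^ l * f \<le> \<tau> then (2 ^ l * f) powr s else 0)
          \<le> (2 ^ M * f) powr s / (1 - q) + (2 ^ Suc M * f) powr s"
        using Suc True M by (simp add: min_absorb2)
      also have "... = (2 ^ Suc M * f) powr s / (1 - q)"
        unfolding e[symmetric] using q by (simp add: field_simps)
      finally show ?thesis using True by (simp add: min_absorb2)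
    next
      case False
      have "(min \<tau> (2 ^ M * f)) powr s \<le> (min \<tau> (2 ^ Suc M * f)) powr s"
        using \<tau> f s by (intro powr_mono2) (auto simp: min_def)
      then have "(min \<tau> (2 ^ M * f)) powr s / (1 - q) \<le> (min \<tau> (2 ^ Suc M * f)) powr s / (1 - q)"
        using q by (intro divide_right_mono) auto
      moreover have "(\<Sum>l = 1..Suc M. if 2 ^ l * f \<le> \<tau> then (2 ^ l * f) powr s else 0)
          = (\<Sum>l = 1..M. if 2 ^ l * f \<le> \<tau> then (2 ^ l * f) powr s else 0)" using False by simp
      ultimately show ?thesis using Suc by linarith
    qed
  qed
  have "avg (level_pmf \<epsilon> N) (\<lambda>l. if 1 \<le> l \<and> 2 ^ l * f \<le> \<tau> then (level_entry p l)\<^sup>2 * f powr (2/p) else 0)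
    \<le> (\<Sum>l = 1..N. (if 1 \<le> l \<and> 2 ^ l * f \<le> \<tau> then (level_entry p l)\<^sup>2 * f powr (2/p) else 0) / 2 ^ l)"
    by (rule avg_level_pmf_le) auto
  also have "... = (\<Sum>l = 1..N. f * (if 2 ^ l * f \<le> \<tau> then (2 ^ l * f) powr s else 0))"
  proof (intro sum.cong refl)
    fix l assume "l \<in> {1..N}"
    then have l: "1 \<le> l" by simp
    have "(level_entry p l)\<^sup>2 = (2 ^ l) powr (2/p)"
      using l by (simp add: level_entry_def powr_powr power2_eq_square powr_add[symmetric] mult.commute flip: powr_realpow)
    then have "(level_entry p l)\<^sup>2 * f powr (2/p) / 2 ^ l = (2 ^ l * f) powr (2/p) / 2 ^ l"
      using f by (simp add: powr_mult)
    also have "... = f * ((2 ^ l * f) powr (2/p) / (2 ^ l * f) powr 1)"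
      using f by (simp add: field_simps)
    also have "... = f * (2 ^ l * f) powr s" unfolding s_def powr_diff by simp
    finally show "(if 1 \<le> l \<and> 2 ^ l * f \<le> \<tau> then (level_entry p l)\<^sup>2 * f powr (2/p) else 0) / 2 ^ l
      = f * (if 2 ^ l * f \<le> \<tau> then (2 ^ l * f) powr s else 0)" using l by simp
  qed
  also have "... = f * (\<Sum>l = 1..N. if 2 ^ l * f \<le> \<tau> then (2 ^ l * f) powr s else 0)"
    by (simp add: sum_distrib_left)
  also have "... \<le> f * ((min \<tau> (2 ^ N * f)) powr s / (1 - q))"
    using geo[of N] f by (intro mult_left_mono) auto
  also have "... \<le> f * (\<tau> powr s / (1 - q))"
    using f q s \<tau> by (intro mult_left_mono divide_right_mono powr_mono2) auto
  finally show ?thesis by (simp add: s_def q_def)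
qed

text \<open>Value \<open>2 ^ l * f\<close> and probability \<open>\<epsilon> / 2 ^ l\<close>
  balance, so each level in the window contributes at most \<open>f\<close>; the logarithm counts
  the levels. This is the source of the logarithm in the distortion.\<close>

lemma level_pmf_truncated_first_moment_le:
  assumes p: "0 < p" and f: "0 \<le> f" and \<tau>: "0 < \<tau>" "\<tau> \<le> T"
  shows "avg (level_pmf \<epsilon> N) (\<lambda>l. if 1 \<le> l \<and> \<tau> < 2 ^ l * f \<and> 2 ^ l * f \<le> T then 2 ^ l * f else 0)
    \<le> f * (log 2 (T / \<tau>) + 1)"
proof -
  define L where "L = {l \<in> {1..N}. \<tau> < 2 ^ l * f \<and> 2 ^ l * f \<le> T}"
  have finL: "finite L" by (simp add: L_def)
  have "avg (level_pmf \<epsilon> N) (\<lambda>l. if 1 \<le> l \<and> \<tau> < 2 ^ l * f \<and> 2 ^ l * f \<le> T then 2 ^ l * f else 0)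
    \<le> (\<Sum>l = 1..N. (if 1 \<le> l \<and> \<tau> < 2 ^ l * f \<and> 2 ^ l * f \<le> T then 2 ^ l * f else 0) / 2 ^ l)"
    using f by (intro avg_level_pmf_le) auto
  also have "... = (\<Sum>l\<in>L. f)"
    unfolding L_def sum.inter_filter[OF finite_atLeastAtMost] by (intro sum.cong) auto
  also have "... = f * card L" by simp
  also have "... \<le> f * (log 2 (T / \<tau>) + 1)"
  proof (intro mult_left_mono f)
    show "card L \<le> log 2 (T / \<tau>) + 1"
    proof (cases "L = {}")
      case True
      then show ?thesis using \<tau> by (simp add: add_nonneg_nonneg zero_le_log_cancel_iff)
    next
      case False
      let ?a = "Min L" and ?b = "Max L"
      have ab: "?a \<in> L" "?b \<in> L" "?a \<le> ?b" using False finL by auto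
      have "L \<subseteq> {?a..?b}" using finL by auto
      then have "card L \<le> card {?a..?b}" by (intro card_mono) auto
      then have c: "real (card L) \<le> real ?b - real ?a + 1" using ab by simp
      have "\<tau> < 2 ^ ?a * f" "2 ^ ?b * f \<le> T" using ab by (auto simp: L_def)
      then have fp: "0 < f" using \<tau> f by (cases "f = 0") auto
      have "2 ^ ?b * f * \<tau> \<le> T * (2 ^ ?a * f)"
        using \<open>\<tau> < 2 ^ ?a * f\<close> \<open>2 ^ ?b * f \<le> T\<close> \<tau> fp by (intro mult_mono) auto
      then have "2 ^ ?b / 2 ^ ?a \<le> T / \<tau>" using fp \<tau> by (simp add: field_simps)
      then have "log 2 (2 ^ ?b / 2 ^ ?a) \<le> log 2 (T / \<tau>)" using \<tau> by (subst log_le_cancel_iff) auto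
      moreover have "log 2 (2 ^ ?b / 2 ^ ?a) = real ?b - real ?a" by (simp add: log_divide log_nat_power)
      ultimately show ?thesis using c by linarith
    qed
  qed
  finally show ?thesis .
qed

text \<open>The least positive level \<open>l\<close> with \<open>2 ^ l * (a * m) \<ge> 1\<close>
  also has \<open>2 ^ l * (a * m) \<le> 2\<close>, by minimality or, for \<open>l = 1\<close>, by
  \<open>a * m \<le> 1\<close>; its own probability \<open>\<epsilon> / 2 ^ l\<close> is already
  large enough. The condition on \<open>N\<close> makes this level available.\<close>

lemma level_pmf_tail_ge:
  assumes p: "0 < p" and a: "0 < a" "a * m \<le> 1" and m: "0 < m" and N: "2 \<le> 2 ^ N * (a * m)"
  shows "\<epsilon> * (a * m) / 2 \<le> prb (level_pmf \<epsilon> N) {l. 1 / m \<le> \<bar>level_entry p l\<bar> powr p * a}"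
proof -
  define l where "l = (LEAST l. 1 \<le> 2 ^ l * (a * m) \<and> 1 \<le> l)"
  have am: "0 < a * m" using a m by simp
  have N1: "1 \<le> N" using N a by (cases N) auto
  have "1 \<le> 2 ^ l * (a * m) \<and> 1 \<le> l"
    unfolding l_def by (rule LeastI[where k = N]) (use N N1 in auto)
  then have l: "1 \<le> 2 ^ l * (a * m)" "1 \<le> l" by auto
  have "l \<le> N" unfolding l_def by (rule Least_le) (use N N1 in auto)
  have "2 ^ l * (a * m) \<le> 2"
  proof (cases "l = 1")
    case True
    then show ?thesis using a by simp
  next
    case False
    then obtain i where i: "l = Suc i" "1 \<le> i" using l(2) by (cases l) auto
    then have "\<not> (1 \<le> 2 ^ i * (a * m) \<and> 1 \<le> i)"
      using not_less_Least[of i "\<lambda>l. 1 \<le> 2 ^ l * (a * m) \<and> 1 \<le> l"] unfolding l_def[symmetric] by simp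
    then have "2 ^ i * (a * m) < 1" using i by simp
    then show ?thesis using i by simp
  qed
  then have "\<epsilon> * (a * m) / 2 \<le> \<epsilon> / 2 ^ l" using \<epsilon> by (simp add: field_simps)
  also have "... = pmf (level_pmf \<epsilon> N) l" using l \<open>l \<le> N\<close> by (simp add: pmf_level_pmf level_weight_def)
  also have "... = prb (level_pmf \<epsilon> N) {l}" by (simp add: measure_pmf_single)
  also have "... \<le> prb (level_pmf \<epsilon> N) {l. 1 / m \<le> \<bar>level_entry p l\<bar> powr p * a}"
  proof (rule measure_pmf.finite_measure_mono)
    have "1 / m \<le> \<bar>level_entry p l\<bar> powr p * a" using l m p by (simp add: level_entry_powr field_simps)
    then show "{l} \<subseteq> {l. 1 / m \<le> \<bar>level_entry p l\<bar> powr p * a}" by simp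
  qed simp
  finally show ?thesis .
qed

text \<open>Each light entry is enlarged to size \<open>1/m\<close> with probability proportional to its mass, so
  many buckets receive such an entry, and half of them keep it since the signs are random.\<close>
lemma flat_vector_lower_tail:
  assumes p: "1 \<le> p" "p < 2" and m: "1 \<le> m" "m \<le> r" and n: "32 * real n \<le> 2 ^ N"
    and flat: "1/8 \<le> (\<Sum>j<n. if \<bar>y j\<bar> powr p \<le> 1/m then \<bar>y j\<bar> powr p else 0)"
  shows "prb (sketch_pmf {..<n} r (level_pmf \<epsilon> N))
      {w. real (card {b. b < r \<and> 1/m \<le> \<bar>heavy_sketch p n y w b\<bar> powr p}) \<le> \<epsilon> / 512 * m}
    \<le> 2 * exp (- (\<epsilon> / 512 * m))"
proof -
  define L where "L = level_pmf \<epsilon> N"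
  define P where "P = sketch_pmf {..<n} r L"
  have r: "0 < r" using m by simp
  have finL: "finite (set_pmf L)" unfolding L_def by (rule finite_set_level_pmf)
  define Z where "Z = heavy_sketch p n y"
  define W where "W = (\<lambda>w. card {b. b < r \<and> 1/m \<le> \<bar>Z w b\<bar> powr p})"
  \<comment> \<open>A factor 1/2 per large bucket makes the product \<open>(1/2) ^ W\<close>, a
    Laplace transform of the count. For \<open>\<bar>t\<bar> \<ge> \<tau>\<close> one of
    \<open>z + t\<close> and \<open>z - t\<close> is large, whence
    \<open>(1 + 1/2) / 2 = 3/4\<close>.\<close>
  define \<phi> where "\<phi> = (\<lambda>z. if 1/m \<le> \<bar>z\<bar> powr p then 1/2 else 1 :: real)"
  define \<tau> where "\<tau> = (1/m) powr (1/p)"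
  have \<tau>p: "\<tau> powr p = 1/m" using p m by (simp add: \<tau>_def powr_powr)
  define q where "q = (\<lambda>j. prb L {l. \<tau> \<le> \<bar>level_entry p l * y j\<bar>})"
  have prodW: "(\<Prod>b<r. \<phi> (Z w b)) = (1/2) ^ W w" for w
  proof -
    have "(\<Prod>b<r. \<phi> (Z w b)) = (\<Prod>b\<in>{..<r} \<inter> {b. 1/m \<le> \<bar>Z w b\<bar> powr p}. 1/2)"
      unfolding \<phi>_def by (subst prod.If_cases) auto
    also have "{..<r} \<inter> {b. 1/m \<le> \<bar>Z w b\<bar> powr p} = {b. b < r \<and> 1/m \<le> \<bar>Z w b\<bar> powr p}" by auto
    finally show ?thesis by (simp add: W_def)
  qed
  have "avg P (\<lambda>w. \<Prod>b<r. \<phi> (Z w b)) \<le> (3/4) ^ card ({} :: nat set) * (\<Prod>j<n. 1 - q j / 8) + (3/4) powr (r / 2)"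
    unfolding P_def Z_def q_def
  proof (rule avg_prod_bucket_le)
    fix b z t assume t: "\<tau> \<le> \<bar>t\<bar>"
    have "\<bar>t\<bar> \<le> \<bar>z + t\<bar> \<or> \<bar>t\<bar> \<le> \<bar>z - t\<bar>" by linarith
    then have "1/m \<le> \<bar>z + t\<bar> powr p \<or> 1/m \<le> \<bar>z - t\<bar> powr p"
      using t p powr_mono2[of p \<tau> "\<bar>z + t\<bar>"] powr_mono2[of p \<tau> "\<bar>z - t\<bar>"] \<tau>p by (auto simp: \<tau>_def)
    then show "(\<phi> (z + t) + \<phi> (z - t)) / 2 \<le> 3/4" by (auto simp: \<phi>_def)
  qed (auto simp: \<phi>_def r finL)
  also have "... = (\<Prod>j<n. 1 - q j / 8) + (3/4) powr (r / 2)" by simp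
  also have "(\<Prod>j<n. 1 - q j / 8) \<le> (\<Prod>j<n. exp (- (q j / 8)))"
  proof (intro prod_mono conjI)
    fix j
    have "q j \<le> 1" unfolding q_def by simp
    then show "0 \<le> 1 - q j / 8" by simp
    show "1 - q j / 8 \<le> exp (- (q j / 8))" using exp_ge_add_one_self[of "- (q j / 8)"] by simp
  qed
  also have "... = exp (- (\<Sum>j<n. q j) / 8)" by (simp add: exp_sum[symmetric] sum_negf sum_divide_distrib)
  also have "... \<le> exp (- (\<epsilon> / 256 * m))"
  proof -
    \<comment> \<open>Entries below \<open>1 / (16 * n)\<close> have total mass at most 1/16 and
      might need levels beyond \<open>N\<close>, so they are discarded.\<close>
    define mid where "mid = {j \<in> {..<n}. \<bar>y j\<bar> powr p \<le> 1/m \<and> 1 / (16 * n) \<le> \<bar>y j\<bar> powr p}"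
    have mid: "1/16 \<le> (\<Sum>j\<in>mid. \<bar>y j\<bar> powr p)"
    proof -
      have n0: "n \<noteq> 0" using flat by (intro notI) simp
      have "1/8 \<le> (\<Sum>j<n. (if j \<in> mid then \<bar>y j\<bar> powr p else 0) + 1 / (16 * n))"
        by (rule order_trans[OF flat], intro sum_mono) (auto simp: mid_def)
      also have "... = (\<Sum>j\<in>mid. \<bar>y j\<bar> powr p) + 1/16"
        using n0 unfolding sum.distrib by (subst sum.inter_restrict[symmetric]) (auto simp: mid_def intro!: sum.cong)
      finally show ?thesis by simp
    qed
    \<comment> \<open>The probabilities \<open>q j\<close> add up to at least
      \<open>\<epsilon> * m / 32\<close>; the 1/8 in the product bound turns this into the exponent
      \<open>\<epsilon> / 256 * m\<close>.\<close>
    have "\<epsilon> * m / 32 = (\<epsilon> * m / 2) * (1/16)" by simp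
    also have "... \<le> (\<epsilon> * m / 2) * (\<Sum>j\<in>mid. \<bar>y j\<bar> powr p)"
      using mid \<epsilon> m by (intro mult_left_mono) auto
    also have "... = (\<Sum>j\<in>mid. \<epsilon> * (\<bar>y j\<bar> powr p * m) / 2)" by (simp add: sum_distrib_left mult_ac)
    also have "... \<le> (\<Sum>j\<in>mid. q j)"
    proof (intro sum_mono)
      fix j assume "j \<in> mid"
      then have j: "j < n" "\<bar>y j\<bar> powr p \<le> 1/m" "1 / (16 * n) \<le> \<bar>y j\<bar> powr p" by (auto simp: mid_def)
      have "2 \<le> 2 ^ N * (1 / (16 * real n))" using n j by (simp add: field_simps)
      also have "... \<le> 2 ^ N * (\<bar>y j\<bar> powr p * m)"
      proof (intro mult_left_mono)
        have "1 / (16 * real n) * 1 \<le> \<bar>y j\<bar> powr p * m" using j m by (intro mult_mono) auto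
        then show "1 / (16 * real n) \<le> \<bar>y j\<bar> powr p * m" by simp
      qed auto
      finally have N: "2 \<le> 2 ^ N * (\<bar>y j\<bar> powr p * m)" .
      have "0 < 1 / (16 * real n)" using j by simp
      then have "\<epsilon> * (\<bar>y j\<bar> powr p * m) / 2 \<le> prb L {l. 1 / m \<le> \<bar>level_entry p l\<bar> powr p * \<bar>y j\<bar> powr p}"
        unfolding L_def using p j m N by (intro level_pmf_tail_ge) (auto simp: field_simps)
      also have "... \<le> q j"
        unfolding q_def
      proof (rule measure_pmf.finite_measure_mono)
        show "{l. 1 / m \<le> \<bar>level_entry p l\<bar> powr p * \<bar>y j\<bar> powr p} \<subseteq> {l. \<tau> \<le> \<bar>level_entry p l * y j\<bar>}"
        proof clarify
          fix l assume "1 / m \<le> \<bar>level_entry p l\<bar> powr p * \<bar>y j\<bar> powr p"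
          then have "\<tau> powr p \<le> \<bar>level_entry p l * y j\<bar> powr p"
            unfolding \<tau>p abs_mult by (simp add: powr_mult)
          then show "\<tau> \<le> \<bar>level_entry p l * y j\<bar>"
            using p powr_less_mono2[of p "\<bar>level_entry p l * y j\<bar>" \<tau>] by (auto simp: not_le[symmetric])
        qed
      qed simp
      finally show "\<epsilon> * (\<bar>y j\<bar> powr p * m) / 2 \<le> q j" .
    qed
    also have "... \<le> (\<Sum>j<n. q j)" by (intro sum_mono2) (auto simp: mid_def q_def)
    finally show ?thesis by simp
  qed
  also have "(3/4) powr (r / 2) \<le> exp (- (\<epsilon> / 256 * m))"
  proof -
    have "ln (3/4 :: real) \<le> - (1/4)" using ln_le_minus_one[of "3/4 :: real"] by simp
    then have "(3/4) powr (r / 2) \<le> exp (- (real r / 8))"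
      using mult_left_mono[of "ln (3/4)" "- (1/4)" "real r / 2"] by (simp add: powr_def)
    also have "... \<le> exp (- (\<epsilon> / 256 * m))"
    proof -
      have "\<epsilon> / 256 * m \<le> 1 / 8 * r" using \<epsilon> m by (intro mult_mono) auto
      then show ?thesis by simp
    qed
    finally show ?thesis .
  qed
  finally have avg: "avg P (\<lambda>w. (1/2) ^ W w) \<le> 2 * exp (- (\<epsilon> / 256 * m))" by (simp add: prodW)
  \<comment> \<open>Markov at the square root of the exponential in the mean: since
    \<open>exp (- 1) \<le> 1/2\<close>, few large buckets force \<open>(1/2) ^ W w\<close> above it,
    and half of the exponent survives.\<close>
  have "{w. real (W w) \<le> \<epsilon> / 512 * m} \<subseteq> {w. exp (- (\<epsilon> / 512 * m)) \<le> (1/2) ^ W w}"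
  proof clarify
    fix w assume w: "real (W w) \<le> \<epsilon> / 512 * m"
    have "exp (- (\<epsilon> / 512 * m)) \<le> exp (- real (W w))" using w by simp
    also have "... = (exp (- 1)) ^ W w" by (simp add: exp_of_nat_mult[symmetric])
    also have "... \<le> (1/2) ^ W w"
    proof (intro power_mono)
      show "exp (- 1) \<le> (1/2 :: real)" using exp_ge_add_one_self[of "1::real"] by (simp add: exp_minus field_simps)
    qed simp
    finally show "exp (- (\<epsilon> / 512 * m)) \<le> (1/2) ^ W w" .
  qed
  then have "prb P {w. real (W w) \<le> \<epsilon> / 512 * m} \<le> prb P {w. exp (- (\<epsilon> / 512 * m)) \<le> (1/2) ^ W w}"
    by (intro measure_pmf.finite_measure_mono) auto
  also have "... \<le> 2 * exp (- (\<epsilon> / 256 * m)) / exp (- (\<epsilon> / 512 * m))"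
    by (rule markov_pmf) (use avg finL r in \<open>auto simp: P_def\<close>)
  also have "... = 2 * exp (- (\<epsilon> / 512 * m))"
  proof -
    have "exp (- (\<epsilon> / 256 * m)) = exp (- (\<epsilon> / 512 * m)) * exp (- (\<epsilon> / 512 * m))"
      by (simp only: exp_add[symmetric]) simp
    then show ?thesis by simp
  qed
  finally show ?thesis unfolding P_def L_def W_def Z_def .
qed

end

section \<open>Linearity of the sketch and upper tails uniform in the vector\<close>

lemma bucket_sum_add: "bucket_sum J (\<lambda>j l. c j l + c' j l) w b = bucket_sum J c w b + bucket_sum J c' w b"
  unfolding bucket_sum_def sum.distrib[symmetric] by (intro sum.cong) (auto simp: algebra_simps split: prod.splits)

lemma bucket_sum_combination:
  "bucket_sum J (\<lambda>j l. \<Sum>k<d. c j l k * x k) w b = (\<Sum>k<d. bucket_sum J (\<lambda>j l. c j l k) w b * x k)"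
proof -
  have "bucket_sum J (\<lambda>j l. \<Sum>k<d. c j l k * x k) w b =
    (\<Sum>j\<in>J. \<Sum>k<d. (case w j of (h, s, l) \<Rightarrow> if h = b then sgn_of s * c j l k else 0) * x k)"
    unfolding bucket_sum_def
    by (intro sum.cong) (auto simp: sum_distrib_left mult.assoc split: prod.splits)
  also have "... = (\<Sum>k<d. bucket_sum J (\<lambda>j l. c j l k) w b * x k)"
    unfolding bucket_sum_def by (subst sum.swap) (simp add: sum_distrib_right)
  finally show ?thesis .
qed

lemma bucket_sum_cong:
  "(\<And>j. j \<in> J \<Longrightarrow> c j (snd (snd (w j))) = c' j (snd (snd (w j)))) \<Longrightarrow> bucket_sum J c w b = bucket_sum J c' w b"
  unfolding bucket_sum_def
proof (intro sum.cong refl)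
  fix j assume eq: "\<And>j. j \<in> J \<Longrightarrow> c j (snd (snd (w j))) = c' j (snd (snd (w j)))" and j: "j \<in> J"
  show "(case w j of (h, s, l) \<Rightarrow> if h = b then sgn_of s * c j l else 0)
    = (case w j of (h, s, l) \<Rightarrow> if h = b then sgn_of s * c' j l else 0)"
    using eq[OF j] by (cases "w j") simp
qed

lemma abs_powr_eq_sq_powr: "\<bar>t\<bar> powr p = (t\<^sup>2) powr (p/2)" for t :: real
proof (cases "t = 0")
  case False
  then have "t\<^sup>2 = \<bar>t\<bar> powr 2" by simp
  then have "(t\<^sup>2) powr (p/2) = (\<bar>t\<bar> powr 2) powr (p/2)" by (rule arg_cong)
  then show ?thesis by (simp only: powr_powr) simp
qed simp

text \<open>Cauchy-Schwarz in every bucket separates \<open>x\<close> from the sketched rows. The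
  Frobenius norm of the sketched rows then controls all \<open>x\<close> simultaneously, and Markov
  applies to that single variable without a net.\<close>

lemma sketch_l2_upper_tail:
  fixes c :: "'j \<Rightarrow> 'l \<Rightarrow> nat \<Rightarrow> real"
  assumes J: "finite J" and rL: "r > 0" "finite (set_pmf L)"
    and E: "(\<Sum>j\<in>J. avg L (\<lambda>l. \<Sum>k<d. (c j l k)\<^sup>2)) \<le> E" and B: "0 < B"
  shows "prb (sketch_pmf J r L)
    {w. \<exists>x. B * (sq_norm d x) < (\<Sum>b<r. (bucket_sum J (\<lambda>j l. \<Sum>k<d. c j l k * x k) w b)\<^sup>2)} \<le> E / B"
    (is "prb ?P ?bad \<le> _")
proof -
  let ?z = "\<lambda>w b k. bucket_sum J (\<lambda>j l. c j l k) w b"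
  have "?bad
    \<subseteq> {w. B \<le> (\<Sum>b<r. sq_norm d (?z w b))}"
  proof clarify
    fix w and x :: "nat \<Rightarrow> real"
    assume "B * (sq_norm d x) < (\<Sum>b<r. (bucket_sum J (\<lambda>j l. \<Sum>k<d. c j l k * x k) w b)\<^sup>2)"
    also have "... \<le> (\<Sum>b<r. (sq_norm d (?z w b)) * (sq_norm d x))"
      unfolding bucket_sum_combination by (intro sum_mono Cauchy_Schwarz_ineq_sum)
    also have "... = (\<Sum>b<r. sq_norm d (?z w b)) * (sq_norm d x)"
      by (simp add: sum_distrib_right)
    finally show "B \<le> (\<Sum>b<r. sq_norm d (?z w b))"
      using mult_right_less_imp_less[of B "\<Sum>k<d. (x k)\<^sup>2" "\<Sum>b<r. sq_norm d (?z w b)"]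
      by (simp add: sum_nonneg less_imp_le)
  qed
  then have "prb ?P ?bad
    \<le> prb ?P {w. B \<le> (\<Sum>b<r. sq_norm d (?z w b))}"
    by (intro measure_pmf.finite_measure_mono) auto
  also have "... \<le> E / B"
    by (rule markov_pmf) (use J rL E B in \<open>auto simp: avg_bucket_sum_sq intro!: sum_nonneg\<close>)
  finally show ?thesis .
qed

lemma sketch_powr_upper_tail:
  fixes c :: "'j \<Rightarrow> 'l \<Rightarrow> nat \<Rightarrow> real"
  assumes J: "finite J" and rL: "r > 0" "finite (set_pmf L)" and p: "1 \<le> p" "p < 2"
    and E: "(\<Sum>j\<in>J. avg L (\<lambda>l. (sq_norm d (c j l)) powr (p/2))) \<le> E" and B: "0 < B"
  shows "prb (sketch_pmf J r L)
    {w. \<exists>x. B * (sq_norm d x) powr (p/2) < (\<Sum>b<r. \<bar>bucket_sum J (\<lambda>j l. \<Sum>k<d. c j l k * x k) w b\<bar> powr p)} \<le> E / B"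
    (is "prb ?P ?bad \<le> _")
proof -
  let ?z = "\<lambda>w b k. bucket_sum J (\<lambda>j l. c j l k) w b"
  have "?bad
    \<subseteq> {w. B \<le> (\<Sum>b<r. (sq_norm d (?z w b)) powr (p/2))}"
  proof clarify
    fix w and x :: "nat \<Rightarrow> real"
    assume "B * (sq_norm d x) powr (p/2) < (\<Sum>b<r. \<bar>bucket_sum J (\<lambda>j l. \<Sum>k<d. c j l k * x k) w b\<bar> powr p)"
    also have "... \<le> (\<Sum>b<r. ((sq_norm d (?z w b)) * (sq_norm d x)) powr (p/2))"
    proof (intro sum_mono)
      fix b
      let ?t = "bucket_sum J (\<lambda>j l. \<Sum>k<d. c j l k * x k) w b"
      have "\<bar>?t\<bar> powr p = (?t\<^sup>2) powr (p/2)" by (rule abs_powr_eq_sq_powr)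
      also have "... \<le> ((sq_norm d (?z w b)) * (sq_norm d x)) powr (p/2)"
        unfolding bucket_sum_combination using p by (intro powr_mono2 Cauchy_Schwarz_ineq_sum) auto
      finally show "\<bar>?t\<bar> powr p \<le> ((sq_norm d (?z w b)) * (sq_norm d x)) powr (p/2)" .
    qed
    also have "... = (\<Sum>b<r. (sq_norm d (?z w b)) powr (p/2)) * (sq_norm d x) powr (p/2)"
      by (simp add: powr_mult sum_nonneg) (simp add: sum_distrib_right)
    finally show "B \<le> (\<Sum>b<r. (sq_norm d (?z w b)) powr (p/2))"
      using mult_right_less_imp_less[of B "(sq_norm d x) powr (p/2)" "\<Sum>b<r. (sq_norm d (?z w b)) powr (p/2)"]
      by (simp add: less_imp_le)
  qed
  then have "prb ?P ?bad
    \<le> prb ?P {w. B \<le> (\<Sum>b<r. (sq_norm d (?z w b)) powr (p/2))}"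
    by (intro measure_pmf.finite_measure_mono) auto
  also have "... \<le> E / B"
    by (rule markov_pmf)
       (use J rL B p in \<open>auto intro!: sum_nonneg order_trans[OF avg_bucket_sum_powr_le E]\<close>)
  finally show ?thesis .
qed

section \<open>Uniform tail bounds on a subspace\<close>

text \<open>In an orthonormal basis of the column space the relative error is a quadratic form,
  bounded by the Frobenius norm of the Gram error. A loss of one half requires a squared Frobenius
  norm of at least 1/4, while its mean is at most \<open>2 * d\<^sup>2 / r\<close>.\<close>

lemma sketch_l2_lower_tail:
  fixes L :: "'l pmf"
  assumes rL: "r > 0" "finite (set_pmf L)"
  shows "prb (sketch_pmf {..<n} r L)
    {w. \<exists>x. (\<Sum>b<r. (sign_sketch n (mat_vec d A x) w b)\<^sup>2)
      < (\<Sum>j<n. (mat_vec d A x j)\<^sup>2) / 2} \<le> 8 * (real d)\<^sup>2 / r"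
    (is "prb ?P ?bad \<le> _")
proof -
  obtain V where V: "same_range n d A V" "orthonormal_cols (\<lambda>_. 1) n d V"
    using weighted_gram_schmidt[of n "\<lambda>_. 1" d A] by auto
  let ?z = "\<lambda>w b k. bucket_sum {..<n} (\<lambda>j l. V j k) w b"
  define X where "X = (\<lambda>(w :: nat \<Rightarrow> nat \<times> bool \<times> 'l) k m. (\<Sum>b<r. ?z w b k * ?z w b m) - (\<Sum>j<n. V j k * V j m))"
  define F where "F = (\<lambda>w. \<Sum>k<d. \<Sum>m<d. (X w k m)\<^sup>2)"
  have quad: "(\<Sum>i\<in>I. (\<Sum>k<d. g i k * y k)\<^sup>2) = (\<Sum>k<d. \<Sum>m<d. (\<Sum>i\<in>I. g i k * g i m) * (y k * y m))"
    for I :: "nat set" and g :: "nat \<Rightarrow> nat \<Rightarrow> real" and y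
  proof -
    have "(\<Sum>i\<in>I. (\<Sum>k<d. g i k * y k)\<^sup>2) = (\<Sum>i\<in>I. \<Sum>k<d. \<Sum>m<d. g i k * g i m * (y k * y m))"
      by (simp add: power2_eq_square sum_product mult_ac)
    also have "... = (\<Sum>k<d. \<Sum>i\<in>I. \<Sum>m<d. g i k * g i m * (y k * y m))" by (rule sum.swap)
    also have "... = (\<Sum>k<d. \<Sum>m<d. \<Sum>i\<in>I. g i k * g i m * (y k * y m))"
      by (rule sum.cong[OF refl], rule sum.swap)
    finally show ?thesis by (simp add: sum_distrib_right)
  qed
  have "?bad \<subseteq> {w. 1/4 \<le> F w}"
  proof clarify
    fix w :: "nat \<Rightarrow> nat \<times> bool \<times> 'l" and x
    assume less: "(\<Sum>b<r. (sign_sketch n (mat_vec d A x) w b)\<^sup>2)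
      < (\<Sum>j<n. (mat_vec d A x j)\<^sup>2) / 2"
    obtain y where y: "\<forall>j<n. mat_vec d A x j = mat_vec d V y j"
      "sq_norm d y = (\<Sum>j<n. 1 * (mat_vec d A x j)\<^sup>2)"
      using same_range_coords[OF V, of x] by blast
    define Y where "Y = (sq_norm d y)"
    have Y: "Y = (\<Sum>j<n. (\<Sum>k<d. V j k * y k)\<^sup>2)"
      using y by (simp add: Y_def mat_vec_def)
    have b: "sign_sketch n (mat_vec d A x) w b = (\<Sum>k<d. ?z w b k * y k)" for b
      unfolding bucket_sum_combination[symmetric] using y by (intro bucket_sum_cong) (auto simp: mat_vec_def)
    have "(\<Sum>b<r. (sign_sketch n (mat_vec d A x) w b)\<^sup>2) - Y
      = (\<Sum>k<d. \<Sum>m<d. X w k m * (y k * y m))"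
      unfolding b Y quad X_def by (simp add: sum_subtractf left_diff_distrib)
    then have D: "(\<Sum>k<d. \<Sum>m<d. X w k m * (y k * y m)) < - (Y / 2)"
      using less y(2) by (simp add: Y_def)
    have Y0: "0 < Y"
    proof -
      have "0 \<le> (\<Sum>b<r. (sign_sketch n (mat_vec d A x) w b)\<^sup>2)" by (simp add: sum_nonneg)
      then show ?thesis using less y(2) by (simp add: Y_def)
    qed
    have "(Y / 2)\<^sup>2 \<le> (\<Sum>k<d. \<Sum>m<d. X w k m * (y k * y m))\<^sup>2"
      using D Y0 by (intro abs_le_square_iff[THEN iffD1]) auto
    also have "(\<Sum>k<d. \<Sum>m<d. X w k m * (y k * y m)) = (\<Sum>a\<in>{..<d}\<times>{..<d}. X w (fst a) (snd a) * (y (fst a) * y (snd a)))"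
      by (simp add: sum.cartesian_product case_prod_beta)
    also have "...\<^sup>2 \<le> (\<Sum>a\<in>{..<d}\<times>{..<d}. (X w (fst a) (snd a))\<^sup>2) * (\<Sum>a\<in>{..<d}\<times>{..<d}. (y (fst a) * y (snd a))\<^sup>2)"
      by (rule Cauchy_Schwarz_ineq_sum)
    also have "(\<Sum>a\<in>{..<d}\<times>{..<d}. (X w (fst a) (snd a))\<^sup>2) = F w"
      by (simp add: F_def sum.cartesian_product case_prod_beta)
    also have "(\<Sum>a\<in>{..<d}\<times>{..<d}. (y (fst a) * y (snd a))\<^sup>2) = Y\<^sup>2"
      by (simp add: Y_def power2_eq_square[of "sum _ _"] sum_product sum.cartesian_product case_prod_beta power_mult_distrib)
    finally show "1/4 \<le> F w" using Y0 by (simp add: power_divide)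
  qed
  then have "prb ?P ?bad \<le> prb ?P {w. 1/4 \<le> F w}"
    by (intro measure_pmf.finite_measure_mono) auto
  also have "... \<le> (2 / r * (\<Sum>j<n. \<Sum>k<d. (V j k)\<^sup>2)\<^sup>2) / (1/4)"
  proof (rule markov_pmf)
    show "avg ?P F \<le> 2 / r * (\<Sum>j<n. \<Sum>k<d. (V j k)\<^sup>2)\<^sup>2"
      unfolding F_def X_def using rL by (intro avg_gram_error_le) auto
  qed (use rL in \<open>auto simp: F_def intro!: sum_nonneg\<close>)
  also have "... \<le> (2 / r * (real d)\<^sup>2) / (1/4)"
  proof (intro divide_right_mono mult_left_mono power_mono)
    have "(\<Sum>j<n. \<Sum>k<d. (V j k)\<^sup>2) = (\<Sum>k<d. \<Sum>j<n. 1 * V j k * V j k)"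
      by (subst sum.swap) (simp add: power2_eq_square)
    also have "... \<le> (\<Sum>k<d. 1)"
      using V(2) unfolding orthonormal_cols_def by (intro sum_mono) auto
    finally show "(\<Sum>j<n. \<Sum>k<d. (V j k)\<^sup>2) \<le> real d" by simp
  qed (auto intro!: sum_nonneg)
  finally show ?thesis by simp
qed

text \<open>In a bucket with at most \<open>B\<close> columns the power mean inequality costs
  \<open>B powr (p - 1)\<close>; buckets are disjoint, so their masses add up to at most the total
  mass.\<close>

lemma abs_bucket_sum_powr_le_load:
  fixes y :: "'j \<Rightarrow> real"
  assumes J: "finite J" and p: "1 \<le> p" "p < 2" and load: "\<And>b. b < r \<Longrightarrow> bucket_load J w b \<le> B"
  shows "(\<Sum>b<r. \<bar>bucket_sum J (\<lambda>j l. y j) w b\<bar> powr p) \<le> B powr (p - 1) * (\<Sum>j\<in>J. \<bar>y j\<bar> powr p)"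
proof -
  define Jb where "Jb = (\<lambda>b. {j \<in> J. fst (w j) = b})"
  have bl: "bucket_load J w b = card (Jb b)" for b
    unfolding bucket_load_def Jb_def using J by (subst sum.inter_filter[symmetric]) auto
  have "(\<Sum>b<r. \<bar>bucket_sum J (\<lambda>j l. y j) w b\<bar> powr p) \<le> (\<Sum>b<r. B powr (p - 1) * (\<Sum>j\<in>Jb b. \<bar>y j\<bar> powr p))"
  proof (intro sum_mono)
    fix b assume b: "b \<in> {..<r}"
    have "\<bar>bucket_sum J (\<lambda>j l. y j) w b\<bar> \<le> (\<Sum>j\<in>J. if fst (w j) = b then \<bar>y j\<bar> else 0)"
      unfolding bucket_sum_def
      by (rule order_trans[OF sum_abs], intro sum_mono) (auto simp: sgn_of_def abs_mult split: prod.splits)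
    also have "... = (\<Sum>j\<in>Jb b. \<bar>y j\<bar>)" unfolding Jb_def using J by (simp add: sum.inter_filter)
    finally have "\<bar>bucket_sum J (\<lambda>j l. y j) w b\<bar> powr p \<le> (\<Sum>j\<in>Jb b. \<bar>y j\<bar>) powr p"
      using p by (intro powr_mono2) auto
    also have "... \<le> real (card (Jb b)) powr (p - 1) * (\<Sum>j\<in>Jb b. \<bar>y j\<bar> powr p)"
      using p J by (intro powr_sum_le_card_powr_sum) (auto simp: Jb_def)
    also have "... \<le> B powr (p - 1) * (\<Sum>j\<in>Jb b. \<bar>y j\<bar> powr p)"
      using p load[of b] b bl by (intro mult_right_mono powr_mono2) (auto intro: sum_nonneg)
    finally show "\<bar>bucket_sum J (\<lambda>j l. y j) w b\<bar> powr p \<le> B powr (p - 1) * (\<Sum>j\<in>Jb b. \<bar>y j\<bar> powr p)" .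
  qed
  also have "... = B powr (p - 1) * (\<Sum>b<r. \<Sum>j\<in>Jb b. \<bar>y j\<bar> powr p)" by (simp add: sum_distrib_left)
  also have "... \<le> B powr (p - 1) * (\<Sum>j\<in>J. \<bar>y j\<bar> powr p)"
  proof (intro mult_left_mono)
    have "(\<Sum>b<r. \<Sum>j\<in>Jb b. \<bar>y j\<bar> powr p) = sum (\<lambda>j. \<bar>y j\<bar> powr p) (\<Union>b<r. Jb b)"
      using J by (subst sum.UNION_disjoint) (auto simp: Jb_def)
    also have "... \<le> (\<Sum>j\<in>J. \<bar>y j\<bar> powr p)"
      using J by (intro sum_mono2) (auto simp: Jb_def)
    finally show "(\<Sum>b<r. \<Sum>j\<in>Jb b. \<bar>y j\<bar> powr p) \<le> (\<Sum>j\<in>J. \<bar>y j\<bar> powr p)" .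
  qed auto
  finally show ?thesis .
qed

lemma prob_Un_le:
  assumes "prb P A \<le> a" "prb P B \<le> b"
  shows "prb P (A \<union> B) \<le> a + b"
proof -
  have "prb P (A \<union> B) \<le> prb P A + prb P B"
    by (rule measure_Un_le) auto
  then show ?thesis using assms by linarith
qed

context
  fixes p :: real and n d :: nat and U :: "nat \<Rightarrow> nat \<Rightarrow> real" and f :: "nat \<Rightarrow> real"
  assumes p: "1 \<le> p" "p < 2" and d: "1 \<le> d"
  defines "f \<equiv> \<lambda>j. (sq_norm d (U j)) powr (p/2)"
  assumes f_sum: "(\<Sum>j<n. f j) \<le> 2 * d"
begin

lemma lewis_weight_nonneg: "0 \<le> f j" by (simp add: f_def)

lemma row_norm_eq: "(sq_norm d (U j)) = f j powr (2/p)"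
  using p by (simp add: f_def powr_powr sum_nonneg)

text \<open>Light rows are controlled by their second moment, heavy rows by the maximal load of a bucket.\<close>
lemma countsketch_upper_tail:
  assumes rL: "r > 0" "finite (set_pmf L)"
  shows "prb (sketch_pmf {..<n} r L)
    {w. \<exists>x. 2 * (2000 * real d powr (p/2) * (sq_norm d x) powr (p/2)
        + (ln (1000 * real r) + 4 * real d) powr (p - 1) * (mass p n (mat_vec d U x)))
      < (\<Sum>b<r. \<bar>sign_sketch n (mat_vec d U x) w b\<bar> powr p)} \<le> 1/1000 + 1/1000"
    (is "prb ?P ?bad \<le> _")
proof -
  \<comment> \<open>Below this threshold the second moment is at most \<open>E\<close>, whose power
    of \<open>1 / r\<close> cancels the Hoelder factor and leaves \<open>d powr (p/2)\<close>. Above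
    it there are at most \<open>2 * d * r\<close> rows, so the exponential moment of their loads is
    at most \<open>r * exp (4 * d)\<close>.\<close>
  define H where "H = {j. 1 / r < f j}"
  define c where "c = (\<lambda>j (l :: 'a) k. if j \<in> H then 0 else U j k)"
  define E where "E = 2 * d * (1 / r) powr (2/p - 1)"
  have E: "0 < E" using d rL by (simp add: E_def)
  define E1 where "E1 = {w :: nat \<Rightarrow> nat \<times> bool \<times> 'a. \<exists>x. (1000 * E) * (sq_norm d x) < (\<Sum>b<r. (bucket_sum {..<n} (\<lambda>j l. \<Sum>k<d. c j l k * x k) w b)\<^sup>2)}"
  define E2 where "E2 = {w :: nat \<Rightarrow> nat \<times> bool \<times> 'a. 1000 * (r * exp (4 * real d)) \<le> (\<Sum>b<r. exp (bucket_load ({..<n} \<inter> H) w b))}"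
  have "prb ?P E1 \<le> E / (1000 * E)"
    unfolding E1_def
  proof (rule sketch_l2_upper_tail)
    have "(\<Sum>j<n. avg L (\<lambda>l. \<Sum>k<d. (c j l k)\<^sup>2)) = (\<Sum>j<n. if j \<in> H then 0 else f j powr (2/p))"
      unfolding row_norm_eq[symmetric] by (intro sum.cong) (auto simp: c_def)
    also have "... \<le> (\<Sum>j<n. f j * (1 / r) powr (2/p - 1))"
    proof (intro sum_mono)
      fix j
      have "f j powr (2/p) \<le> f j * (1 / r) powr (2/p - 1)" if "j \<notin> H"
      proof -
        have "f j powr (2/p) = f j * f j powr (2/p - 1)"
          using lewis_weight_nonneg[of j] by (simp add: powr_diff)
        also have "... \<le> f j * (1 / r) powr (2/p - 1)"
          using that p lewis_weight_nonneg[of j] by (intro mult_left_mono powr_mono2) (auto simp: H_def)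
        finally show ?thesis .
      qed
      then show "(if j \<in> H then 0 else f j powr (2/p)) \<le> f j * (1 / r) powr (2/p - 1)"
        using lewis_weight_nonneg[of j] by auto
    qed
    also have "... \<le> E"
      unfolding E_def sum_distrib_right[symmetric] using f_sum by (intro mult_right_mono) auto
    finally show "(\<Sum>j<n. avg L (\<lambda>l. \<Sum>k<d. (c j l k)\<^sup>2)) \<le> E" .
  qed (use rL E in auto)
  then have P1: "prb ?P E1 \<le> 1/1000" using E by simp
  have "prb ?P E2 \<le> (r * exp (4 * real d)) / (1000 * (r * exp (4 * real d)))"
    unfolding E2_def
  proof (rule markov_pmf)
    have "card ({..<n} \<inter> H) * (1 / r) = (\<Sum>j\<in>{..<n} \<inter> H. 1 / r)" by simp
    also have "... \<le> (\<Sum>j\<in>{..<n} \<inter> H. f j)" by (intro sum_mono) (auto simp: H_def)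
    also have "... \<le> (\<Sum>j<n. f j)" by (intro sum_mono2) (auto simp: lewis_weight_nonneg)
    finally have "card ({..<n} \<inter> H) / r \<le> 2 * d" using f_sum by simp
    then have "2 * card ({..<n} \<inter> H) / r \<le> 4 * d" by simp
    then have "r * exp (2 * card ({..<n} \<inter> H) / r) \<le> r * exp (4 * real d)"
      by (intro mult_left_mono) auto
    then show "avg ?P (\<lambda>w. \<Sum>b<r. exp (bucket_load ({..<n} \<inter> H) w b)) \<le> r * exp (4 * real d)"
      by (intro order_trans[OF avg_exp_bucket_load_le]) (use rL in auto)
  qed (use rL in \<open>auto intro!: sum_nonneg\<close>)
  then have P2: "prb ?P E2 \<le> 1/1000" using rL by simp
  have "?bad \<subseteq> E1 \<union> E2"
  proof (rule subsetI, rule ccontr)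
    fix w assume "w \<in> ?bad" and nE: "w \<notin> E1 \<union> E2"
    then obtain x where x: "2 * (2000 * real d powr (p/2) * (sq_norm d x) powr (p/2)
        + (ln (1000 * real r) + 4 * real d) powr (p - 1) * (mass p n (mat_vec d U x)))
      < (\<Sum>b<r. \<bar>sign_sketch n (mat_vec d U x) w b\<bar> powr p)" by auto
    define y where "y = mat_vec d U x"
    define Q where "Q = (sq_norm d x)"
    have Q: "0 \<le> Q" by (simp add: Q_def sum_nonneg)
    let ?zl = "\<lambda>b. bucket_sum {..<n} (\<lambda>j l. \<Sum>k<d. c j l k * x k) w b"
    let ?zh = "\<lambda>b. bucket_sum ({..<n} \<inter> H) (\<lambda>j l. y j) w b"
    have split: "sign_sketch n y w b = ?zl b + ?zh b" for b
    proof -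
      have "?zh b = bucket_sum {..<n} (\<lambda>j l. if j \<in> H then y j else 0) w b"
        unfolding bucket_sum_def by (subst sum.inter_restrict) (auto intro!: sum.cong split: prod.splits)
      moreover have "?zl b = bucket_sum {..<n} (\<lambda>j l. if j \<in> H then 0 else y j) w b"
        by (intro bucket_sum_cong) (auto simp: c_def y_def mat_vec_def)
      ultimately show ?thesis
        unfolding bucket_sum_add[symmetric] by (simp add: bucket_sum_add[symmetric]) (auto intro!: bucket_sum_cong)
    qed
    have "(\<Sum>b<r. \<bar>?zl b\<bar> powr p) \<le> real r powr (1 - p/2) * (\<Sum>b<r. (?zl b)\<^sup>2) powr (p/2)"
      by (rule sum_abs_powr_le_card_powr[OF p])
    also have "... \<le> real r powr (1 - p/2) * ((1000 * E) * Q) powr (p/2)"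
      using nE p by (intro mult_left_mono powr_mono2) (auto simp: E1_def Q_def not_less sum_nonneg)
    also have "... = (2000 * real d) powr (p/2) * Q powr (p/2)"
    proof -
      have "((1000 * E) * Q) powr (p/2) = (2000 * real d) powr (p/2) * ((1 / r) powr (2/p - 1)) powr (p/2) * Q powr (p/2)"
        using Q d by (simp add: E_def powr_mult mult_ac)
      also have "((1 / r) powr (2/p - 1)) powr (p/2) = (1 / r) powr (1 - p/2)"
        using p by (simp add: powr_powr algebra_simps)
      also have "... = 1 / real r powr (1 - p/2)" by (simp add: powr_divide)
      finally show ?thesis using rL by simp
    qed
    also have "... \<le> 2000 * real d powr (p/2) * Q powr (p/2)"
    proof (intro mult_right_mono)
      have "2000 powr (p/2) \<le> (2000 :: real) powr 1" using p by (intro powr_mono) auto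
      then show "(2000 * real d) powr (p/2) \<le> 2000 * real d powr (p/2)" by (simp add: powr_mult mult_right_mono)
    qed simp
    finally have l: "(\<Sum>b<r. \<bar>?zl b\<bar> powr p) \<le> 2000 * real d powr (p/2) * Q powr (p/2)" .
    have h: "(\<Sum>b<r. \<bar>?zh b\<bar> powr p) \<le> (ln (1000 * real r) + 4 * real d) powr (p - 1) * (mass p n y)"
    proof -
      have "bucket_load ({..<n} \<inter> H) w b \<le> ln (1000 * real r) + 4 * d" if b: "b < r" for b
      proof -
        have "exp (bucket_load ({..<n} \<inter> H) w b) \<le> (\<Sum>b<r. exp (bucket_load ({..<n} \<inter> H) w b))"
          using b by (intro member_le_sum) auto
        also have "... \<le> (1000 * r) * exp (4 * real d)" using nE by (simp add: E2_def)
        also have "... = exp (ln (1000 * real r) + 4 * real d)" using rL by (simp add: exp_add)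
        finally show ?thesis by simp
      qed
      then have "(\<Sum>b<r. \<bar>?zh b\<bar> powr p) \<le> (ln (1000 * real r) + 4 * real d) powr (p - 1) * (\<Sum>j\<in>{..<n} \<inter> H. \<bar>y j\<bar> powr p)"
        using p by (intro abs_bucket_sum_powr_le_load) auto
      also have "... \<le> (ln (1000 * real r) + 4 * real d) powr (p - 1) * (mass p n y)"
        by (intro mult_left_mono sum_mono2) auto
      finally show ?thesis .
    qed
    have "(\<Sum>b<r. \<bar>sign_sketch n y w b\<bar> powr p) \<le> (\<Sum>b<r. 2 * (\<bar>?zl b\<bar> powr p + \<bar>?zh b\<bar> powr p))"
      unfolding split using p by (intro sum_mono abs_add_powr_le) auto
    also have "... = 2 * ((\<Sum>b<r. \<bar>?zl b\<bar> powr p) + (\<Sum>b<r. \<bar>?zh b\<bar> powr p))"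
      by (simp add: sum.distrib sum_distrib_left)
    also have "... \<le> 2 * (2000 * real d powr (p/2) * Q powr (p/2) + (ln (1000 * real r) + 4 * real d) powr (p - 1) * (mass p n y))"
      using l h by simp
    finally show False using x by (simp add: y_def Q_def)
  qed
  then have "prb ?P ?bad \<le> prb ?P (E1 \<union> E2)"
    by (intro measure_pmf.finite_measure_mono) auto
  also have "... \<le> 1/1000 + 1/1000" by (rule prob_Un_le[OF P1 P2])
  finally show ?thesis .
qed

text \<open>The logarithmic factor counts the levels between the truncation points
  \<open>d / r\<close> (below which cancellation helps) and \<open>4000 d\<close> (rarely exceeded).\<close>
lemma stable_sketch_upper_tail:
  fixes \<epsilon> :: real
  assumes r: "r > 0" and \<epsilon>: "0 < \<epsilon>" "\<epsilon> < 1"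
  shows "prb (sketch_pmf {..<n} r (level_pmf \<epsilon> N))
    {w. \<exists>x. 4000 * real d * (1 / (1 - 2 powr (1 - 2/p)) + log 2 (4000 * real r) + 1) * (sq_norm d x) powr (p/2)
      < (\<Sum>b<r. \<bar>heavy_sketch p n (mat_vec d U x) w b\<bar> powr p)}
    \<le> 1/1000 + 1/1000 + 1/1000"
    (is "prb ?P ?bad \<le> _")
proof -
  define L where "L = level_pmf \<epsilon> N"
  have finL: "finite (set_pmf L)" unfolding L_def by (rule finite_set_level_pmf[OF \<epsilon>])
  \<comment> \<open>With this threshold the second moment part, after Hoelder, scales as
    \<open>d powr (p/2) * d powr (1 - p/2) = d\<close>.\<close>
  define \<tau> where "\<tau> = real d / r"
  \<comment> \<open>Makes the expected number of exceeding columns at most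
    \<open>2 * d * (2 / T) = 1/1000\<close>.\<close>
  define T where "T = 4000 * real d"
  have \<tau>: "0 < \<tau>" "\<tau> \<le> T" using d r by (auto simp: \<tau>_def T_def field_simps)
  have T: "0 < T" using d by (simp add: T_def)
  define Cp where "Cp = 1 / (1 - 2 powr (1 - 2/p))"
  have Cp: "1 \<le> Cp"
  proof -
    have "2 powr (1 - 2/p) < 2 powr (0::real)" using p by (intro powr_less_mono) (auto simp: field_simps)
    then show ?thesis by (simp add: Cp_def)
  qed
  define c1 where "c1 = (\<lambda>j l k. if 1 \<le> l \<and> 2 ^ l * f j \<le> \<tau> then level_entry p l * U j k else 0)"
  define c2 where "c2 = (\<lambda>j l k. if 1 \<le> l \<and> \<tau> < 2 ^ l * f j \<and> 2 ^ l * f j \<le> T then level_entry p l * U j k else 0)"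
  define e1 where "e1 = 2 * d * \<tau> powr (2/p - 1) * Cp"
  define e2 where "e2 = 2 * d * (log 2 (4000 * real r) + 1)"
  have log0: "0 \<le> log 2 (4000 * real r)" using r by (intro zero_le_log_cancel_iff[THEN iffD2]) auto
  have e: "0 < e1" "0 < e2" using d \<tau> Cp log0 by (auto simp: e1_def e2_def add_nonneg_pos)
  define E1 where "E1 = {w. \<exists>x. (1000 * e1) * (sq_norm d x) < (\<Sum>b<r. (bucket_sum {..<n} (\<lambda>j l. \<Sum>k<d. c1 j l k * x k) w b)\<^sup>2)}"
  define E2 where "E2 = {w. \<exists>x. (1000 * e2) * (sq_norm d x) powr (p/2) < (\<Sum>b<r. \<bar>bucket_sum {..<n} (\<lambda>j l. \<Sum>k<d. c2 j l k * x k) w b\<bar> powr p)}"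
  define g where "g = (\<lambda>j l. if 1 \<le> l \<and> T < 2 ^ l * f j then 1 else 0 :: real)"
  \<comment> \<open>Outside this event no column exceeds \<open>T\<close>, and
    \<open>c1 + c2\<close> is the whole coefficient.\<close>
  define E3 where "E3 = {w :: nat \<Rightarrow> nat \<times> bool \<times> nat. 1 \<le> (\<Sum>j<n. g j (snd (snd (w j))))}"
  have "prb ?P E1 \<le> e1 / (1000 * e1)"
    unfolding E1_def L_def[symmetric]
  proof (rule sketch_l2_upper_tail)
    have "(\<Sum>j<n. avg L (\<lambda>l. \<Sum>k<d. (c1 j l k)\<^sup>2)) \<le> (\<Sum>j<n. f j * (\<tau> powr (2/p - 1) * Cp))"
    proof (intro sum_mono)
      fix j
      have "(\<lambda>l. \<Sum>k<d. (c1 j l k)\<^sup>2) = (\<lambda>l. if 1 \<le> l \<and> 2 ^ l * f j \<le> \<tau> then (level_entry p l)\<^sup>2 * f j powr (2/p) else 0)"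
        unfolding row_norm_eq[symmetric] by (auto simp: fun_eq_iff c1_def power_mult_distrib sum_distrib_left)
      then have "avg L (\<lambda>l. \<Sum>k<d. (c1 j l k)\<^sup>2) \<le> f j * \<tau> powr (2/p - 1) / (1 - 2 powr (1 - 2/p))"
        unfolding L_def using level_pmf_truncated_second_moment_le[OF \<epsilon> p lewis_weight_nonneg \<tau>(1)] by simp
      then show "avg L (\<lambda>l. \<Sum>k<d. (c1 j l k)\<^sup>2) \<le> f j * (\<tau> powr (2/p - 1) * Cp)" by (simp add: Cp_def)
    qed
    also have "... \<le> 2 * d * (\<tau> powr (2/p - 1) * Cp)"
      unfolding sum_distrib_right[symmetric] using f_sum Cp by (intro mult_right_mono) auto
    finally show "(\<Sum>j<n. avg L (\<lambda>l. \<Sum>k<d. (c1 j l k)\<^sup>2)) \<le> e1" by (simp add: e1_def)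
  qed (use r finL e in auto)
  then have P1: "prb ?P E1 \<le> 1/1000" using e by simp
  have "prb ?P E2 \<le> e2 / (1000 * e2)"
    unfolding E2_def L_def[symmetric]
  proof (rule sketch_powr_upper_tail)
    have "(\<Sum>j<n. avg L (\<lambda>l. (\<Sum>k<d. (c2 j l k)\<^sup>2) powr (p/2))) \<le> (\<Sum>j<n. f j * (log 2 (T / \<tau>) + 1))"
    proof (intro sum_mono)
      fix j
      have "(\<lambda>l. (\<Sum>k<d. (c2 j l k)\<^sup>2) powr (p/2)) = (\<lambda>l. if 1 \<le> l \<and> \<tau> < 2 ^ l * f j \<and> 2 ^ l * f j \<le> T then 2 ^ l * f j else 0)"
      proof
        fix l
        have "(\<Sum>k<d. (level_entry p l * U j k)\<^sup>2) powr (p/2) = 2 ^ l * f j" if "1 \<le> l"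
        proof -
          have "(\<Sum>k<d. (level_entry p l * U j k)\<^sup>2) = (level_entry p l)\<^sup>2 * (sq_norm d (U j))"
            by (simp add: power_mult_distrib sum_distrib_left)
          then show ?thesis
            using that p by (simp add: powr_mult f_def sum_nonneg abs_powr_eq_sq_powr[symmetric] level_entry_powr)
        qed
        moreover have "c2 j l k = 0" if "\<not> (1 \<le> l \<and> \<tau> < 2 ^ l * f j \<and> 2 ^ l * f j \<le> T)" for k
          using that by (simp only: c2_def if_False)
        ultimately show "(\<Sum>k<d. (c2 j l k)\<^sup>2) powr (p/2) = (if 1 \<le> l \<and> \<tau> < 2 ^ l * f j \<and> 2 ^ l * f j \<le> T then 2 ^ l * f j else 0)"
          by (cases "1 \<le> l \<and> \<tau> < 2 ^ l * f j \<and> 2 ^ l * f j \<le> T") (simp_all only: c2_def if_True if_False, simp_all)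
      qed
      then show "avg L (\<lambda>l. (\<Sum>k<d. (c2 j l k)\<^sup>2) powr (p/2)) \<le> f j * (log 2 (T / \<tau>) + 1)"
        unfolding L_def using level_pmf_truncated_first_moment_le[OF \<epsilon> _ lewis_weight_nonneg \<tau>, of p] p by simp
    qed
    also have "... \<le> 2 * d * (log 2 (T / \<tau>) + 1)"
      unfolding sum_distrib_right[symmetric] using f_sum \<tau>
      by (intro mult_right_mono) (auto simp: zero_le_log_cancel_iff intro!: add_nonneg_nonneg)
    also have "T / \<tau> = 4000 * r" using d r by (simp add: T_def \<tau>_def)
    finally show "(\<Sum>j<n. avg L (\<lambda>l. (\<Sum>k<d. (c2 j l k)\<^sup>2) powr (p/2))) \<le> e2" by (simp add: e2_def)
  qed (use r finL e p in auto)
  then have P2: "prb ?P E2 \<le> 1/1000" using e by simp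
  have "prb ?P E3 \<le> (1/1000) / 1"
    unfolding E3_def L_def[symmetric]
  proof (rule markov_pmf)
    have "avg (sketch_pmf {..<n} r L) (\<lambda>w. \<Sum>j<n. g j (snd (snd (w j)))) = (\<Sum>j<n. avg L (g j))"
      using r finL by (simp add: avg_sum avg_sketch_pmf_component)
    also have "... \<le> (\<Sum>j<n. 2 * f j / T)"
      unfolding L_def g_def by (intro sum_mono level_pmf_tail_le[OF \<epsilon> lewis_weight_nonneg T])
    also have "... = (\<Sum>j<n. f j) * (2 / T)" by (simp add: sum_distrib_left mult.commute sum_divide_distrib)
    also have "... \<le> 2 * d * (2 / T)" using f_sum T by (intro mult_right_mono) auto
    also have "... = 1/1000" using d by (simp add: T_def)
    finally show "avg (sketch_pmf {..<n} r L) (\<lambda>w. \<Sum>j<n. g j (snd (snd (w j)))) \<le> 1/1000" .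
  qed (use r finL in \<open>auto simp: g_def intro!: sum_nonneg\<close>)
  then have P3: "prb ?P E3 \<le> 1/1000" by simp
  have "?bad \<subseteq> E1 \<union> E2 \<union> E3"
  proof (rule subsetI, rule ccontr)
    fix w assume "w \<in> ?bad" and nE: "w \<notin> E1 \<union> E2 \<union> E3"
    then obtain x where x: "4000 * real d * (Cp + log 2 (4000 * real r) + 1) * (sq_norm d x) powr (p/2)
      < (\<Sum>b<r. \<bar>heavy_sketch p n (mat_vec d U x) w b\<bar> powr p)"
      by (auto simp: Cp_def)
    define Q where "Q = (sq_norm d x)"
    have Q: "0 \<le> Q" by (simp add: Q_def sum_nonneg)
    let ?z1 = "\<lambda>b. bucket_sum {..<n} (\<lambda>j l. \<Sum>k<d. c1 j l k * x k) w b"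
    let ?z2 = "\<lambda>b. bucket_sum {..<n} (\<lambda>j l. \<Sum>k<d. c2 j l k * x k) w b"
    have no_large: "2 ^ snd (snd (w j)) * f j \<le> T" if "j < n" "1 \<le> snd (snd (w j))" for j
    proof (rule ccontr)
      assume "\<not> ?thesis"
      then have "1 = g j (snd (snd (w j)))" using that by (simp add: g_def)
      also have "... \<le> (\<Sum>j<n. g j (snd (snd (w j))))"
        using that by (intro member_le_sum) (auto simp: g_def)
      finally show False using nE by (simp add: E3_def)
    qed
    have split: "heavy_sketch p n (mat_vec d U x) w b = ?z1 b + ?z2 b" for b
      unfolding bucket_sum_add[symmetric]
    proof (rule bucket_sum_cong)
      fix j assume "j \<in> {..<n}"
      define l where "l = snd (snd (w j))"
      have "2 ^ l * f j \<le> T" if "1 \<le> l" using no_large[of j] that \<open>j \<in> {..<n}\<close> by (simp add: l_def)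
      then have "level_entry p l * U j k = c1 j l k + c2 j l k" for k
        by (cases "1 \<le> l") (auto simp: c1_def c2_def level_entry_def)
      then show "level_entry p (snd (snd (w j))) * mat_vec d U x j =
        (\<Sum>k<d. c1 j (snd (snd (w j))) k * x k) + (\<Sum>k<d. c2 j (snd (snd (w j))) k * x k)"
        unfolding l_def[symmetric] mat_vec_def sum.distrib[symmetric] sum_distrib_left
        by (intro sum.cong) (simp_all add: distrib_right[symmetric] mult.assoc[symmetric])
    qed
    have "(\<Sum>b<r. \<bar>?z1 b\<bar> powr p) \<le> real r powr (1 - p/2) * (\<Sum>b<r. (?z1 b)\<^sup>2) powr (p/2)"
      by (rule sum_abs_powr_le_card_powr[OF p])
    also have "... \<le> real r powr (1 - p/2) * ((1000 * e1) * Q) powr (p/2)"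
      using nE p by (intro mult_left_mono powr_mono2) (auto simp: E1_def Q_def not_less sum_nonneg)
    also have "... = d * (2000 * Cp) powr (p/2) * Q powr (p/2)"
    proof -
      have "((1000 * e1) * Q) powr (p/2) = (2000 * Cp) powr (p/2) * real d powr (p/2) * (\<tau> powr (2/p - 1)) powr (p/2) * Q powr (p/2)"
        using Q d Cp by (simp add: e1_def powr_mult mult_ac)
      also have "(\<tau> powr (2/p - 1)) powr (p/2) = \<tau> powr (1 - p/2)"
        using p by (simp add: powr_powr algebra_simps)
      also have "... = real d powr (1 - p/2) / real r powr (1 - p/2)" by (simp add: powr_divide \<tau>_def)
      finally have "real r powr (1 - p/2) * ((1000 * e1) * Q) powr (p/2)
        = (real d powr (p/2) * real d powr (1 - p/2)) * (2000 * Cp) powr (p/2) * Q powr (p/2)"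
        using r by simp
      also have "real d powr (p/2) * real d powr (1 - p/2) = d"
        using d by (simp add: powr_add[symmetric])
      finally show ?thesis .
    qed
    also have "... \<le> d * (2000 * Cp) * Q powr (p/2)"
    proof (intro mult_right_mono mult_left_mono)
      have "(2000 * Cp) powr (p/2) \<le> (2000 * Cp) powr 1" using p Cp by (intro powr_mono) auto
      then show "(2000 * Cp) powr (p/2) \<le> 2000 * Cp" using Cp by simp
    qed auto
    finally have z1: "(\<Sum>b<r. \<bar>?z1 b\<bar> powr p) \<le> d * (2000 * Cp) * Q powr (p/2)" .
    have z2: "(\<Sum>b<r. \<bar>?z2 b\<bar> powr p) \<le> (1000 * e2) * Q powr (p/2)"
      using nE by (auto simp: E2_def Q_def not_less)
    have "(\<Sum>b<r. \<bar>heavy_sketch p n (mat_vec d U x) w b\<bar> powr p) \<le> (\<Sum>b<r. 2 * (\<bar>?z1 b\<bar> powr p + \<bar>?z2 b\<bar> powr p))"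
      unfolding split using p by (intro sum_mono abs_add_powr_le) auto
    also have "... = 2 * ((\<Sum>b<r. \<bar>?z1 b\<bar> powr p) + (\<Sum>b<r. \<bar>?z2 b\<bar> powr p))"
      by (simp add: sum.distrib sum_distrib_left)
    also have "... \<le> 2 * (d * (2000 * Cp) * Q powr (p/2) + (1000 * e2) * Q powr (p/2))"
      using z1 z2 by simp
    also have "... = 4000 * real d * (Cp + log 2 (4000 * real r) + 1) * Q powr (p/2)"
      by (simp add: e2_def algebra_simps)
    finally show False using x by (simp add: Q_def)
  qed
  then have "prb ?P ?bad \<le> prb ?P (E1 \<union> E2 \<union> E3)"
    by (intro measure_pmf.finite_measure_mono) auto
  also have "... \<le> 1/1000 + 1/1000 + 1/1000" by (intro prob_Un_le P1 P2 P3)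
  finally show ?thesis .
qed

end

section \<open>A net in the coordinates of the Lewis basis\<close>

definition grid :: "nat \<Rightarrow> nat \<Rightarrow> (nat \<Rightarrow> real) set" where
  "grid d H = (\<lambda>k i. real_of_int (k i) / H) ` PiE {..<d} (\<lambda>_. {- (2 * int H + 1)..2 * int H + 1})"

lemma finite_grid: "finite (grid d H)"
  unfolding grid_def by (intro finite_imageI finite_PiE) auto

lemma card_grid_le: "card (grid d H) \<le> (4 * H + 3) ^ d"
proof -
  have "card (grid d H) \<le> card (PiE {..<d} (\<lambda>_. {- (2 * int H + 1)..2 * int H + 1}))"
    unfolding grid_def by (intro card_image_le finite_PiE) auto
  also have "... = (4 * H + 3) ^ d" by (simp add: card_PiE nat_add_distrib nat_mult_distrib add.commute)
  finally show ?thesis .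
qed

text \<open>Every coordinate is rounded down to a multiple of \<open>1 / H\<close>. The range 2
  suffices for vectors of mass 1, whose Lewis coordinates satisfy
  \<open>(sq_norm d y) powr (p/2) \<le> 2\<close>.\<close>

lemma grid_approx:
  assumes H: "0 < H" and x: "\<And>k. k < d \<Longrightarrow> \<bar>x k\<bar> \<le> 2"
  obtains g where "g \<in> grid d H" "(\<Sum>k<d. (x k - g k)\<^sup>2) \<le> d / (real H)\<^sup>2"
proof
  let ?k = "\<lambda>i. if i < d then \<lfloor>x i * H\<rfloor> else undefined"
  have "?k \<in> PiE {..<d} (\<lambda>_. {- (2 * int H + 1)..2 * int H + 1})"
  proof (rule PiE_I)
    fix i assume "i \<in> {..<d}"
    then have i: "i < d" by simp
    have "\<bar>x i * H\<bar> \<le> 2 * H" using x[OF i] H by (simp add: abs_mult mult_right_mono)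
    then have "- (2 * real H) \<le> x i * H" "x i * H \<le> 2 * real H" by linarith+
    then have "- (2 * int H + 1) \<le> \<lfloor>x i * H\<rfloor>" "\<lfloor>x i * H\<rfloor> \<le> 2 * int H + 1" by linarith+
    then show "?k i \<in> {- (2 * int H + 1)..2 * int H + 1}" using i by simp
  qed auto
  then show "(\<lambda>i. real_of_int (?k i) / H) \<in> grid d H" unfolding grid_def by (rule imageI)
  have "(\<Sum>i<d. (x i - real_of_int (?k i) / H)\<^sup>2) \<le> (\<Sum>i<d. 1 / (real H)\<^sup>2)"
  proof (intro sum_mono)
    fix i assume i: "i \<in> {..<d}"
    have "x i - real_of_int (?k i) / H = (x i * H - \<lfloor>x i * H\<rfloor>) / H"
      using i H by (simp add: field_simps)
    moreover have "(x i * H - \<lfloor>x i * H\<rfloor>)\<^sup>2 \<le> 1\<^sup>2"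
      by (intro power_mono) linarith+
    ultimately show "(x i - real_of_int (?k i) / H)\<^sup>2 \<le> 1 / (real H)\<^sup>2"
      by (simp add: power_divide divide_right_mono)
  qed
  then show "(\<Sum>i<d. (x i - real_of_int (?k i) / H)\<^sup>2) \<le> d / (real H)\<^sup>2" by simp
qed

text \<open>Flatness of a grid point is not random, so the union bound runs over the flat points
  only, and the small-ball estimate applies to each of them.\<close>

lemma flat_grid_lower_tail:
  assumes \<epsilon>: "0 < \<epsilon>" "\<epsilon> < 1" and p: "1 \<le> p" "p < 2" and m: "1 \<le> m" "m \<le> r" and n: "32 * real n \<le> 2 ^ N"
  shows "prb (sketch_pmf {..<n} r (level_pmf \<epsilon> N))
      {w. \<exists>g\<in>grid d H. 1/8 \<le> (\<Sum>j<n. if \<bar>mat_vec d U g j\<bar> powr p \<le> 1/m then \<bar>mat_vec d U g j\<bar> powr p else 0) \<and>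
        real (card {b. b < r \<and> 1/m \<le> \<bar>heavy_sketch p n (mat_vec d U g) w b\<bar> powr p}) \<le> \<epsilon> / 512 * m}
    \<le> (4 * H + 3) ^ d * (2 * exp (- (\<epsilon> / 512 * m)))"
    (is "prb ?P ?bad \<le> _")
proof -
  define G where "G = {g \<in> grid d H. 1/8 \<le> (\<Sum>j<n. if \<bar>mat_vec d U g j\<bar> powr p \<le> 1/m then \<bar>mat_vec d U g j\<bar> powr p else 0)}"
  define B where "B = (\<lambda>g. {w :: nat \<Rightarrow> nat \<times> bool \<times> nat. real (card {b. b < r \<and> 1/m \<le> \<bar>heavy_sketch p n (mat_vec d U g) w b\<bar> powr p}) \<le> \<epsilon> / 512 * m})"
  have G: "finite G" "G \<subseteq> grid d H" using finite_grid by (auto simp: G_def)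
  have "?bad = (\<Union>g\<in>G. B g)" by (auto simp: G_def B_def)
  then have "prb ?P ?bad \<le> (\<Sum>g\<in>G. prb ?P (B g))"
    using G by (simp add: measure_pmf.finite_measure_subadditive_finite)
  also have "... \<le> (\<Sum>g\<in>G. 2 * exp (- (\<epsilon> / 512 * m)))"
    unfolding B_def using \<epsilon> p m n by (intro sum_mono flat_vector_lower_tail) (auto simp: G_def)
  also have "... = card G * (2 * exp (- (\<epsilon> / 512 * m)))" by simp
  also have "... \<le> real ((4 * H + 3) ^ d) * (2 * exp (- (\<epsilon> / 512 * m)))"
  proof (intro mult_right_mono)
    have "card G \<le> card (grid d H)" using G finite_grid by (intro card_mono) auto
    then show "real (card G) \<le> real ((4 * H + 3) ^ d)" using card_grid_le[of d H] by linarith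
  qed auto
  finally show ?thesis by simp
qed

lemma mat_vec_scale: "mat_vec d A (\<lambda>k. t * x k) j = t * mat_vec d A x j"
  by (simp add: mat_vec_def sum_distrib_left mult_ac)

lemma mat_vec_add: "mat_vec d A (\<lambda>k. x k + y k) j = mat_vec d A x j + mat_vec d A y j"
  by (simp add: mat_vec_def sum.distrib algebra_simps)

lemma bucket_sum_scale: "bucket_sum J (\<lambda>j l. t * c j l) w b = t * bucket_sum J c w b"
  unfolding bucket_sum_def sum_distrib_left by (intro sum.cong) (auto split: prod.splits)

text \<open>The factor of the first block compensates the loss in the comparison of the \<open>p\<close>-norm
  with the Euclidean norm on entries of mass at least \<open>1/m\<close>.\<close>
definition embed_powr ::
  "real \<Rightarrow> nat \<Rightarrow> nat \<Rightarrow> (nat \<Rightarrow> nat \<times> bool \<times> nat) \<Rightarrow> real \<Rightarrow> (nat \<Rightarrow> real) \<Rightarrow> real" where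
  "embed_powr p n r w m y =
    (m powr (1/p - 1/2)) powr p * (\<Sum>b<r. \<bar>sign_sketch n y w b\<bar> powr p)
    + (\<Sum>b<r. \<bar>heavy_sketch p n y w b\<bar> powr p)"

lemma embed_powr_scale: "embed_powr p n r w m (\<lambda>j. t * y j) = \<bar>t\<bar> powr p * embed_powr p n r w m y"
proof -
  have "bucket_sum {..<n} (\<lambda>j l. level_entry p l * (t * y j)) w b = t * heavy_sketch p n y w b" for b
    by (simp add: bucket_sum_scale[symmetric] mult.left_commute)
  then show ?thesis
    by (simp add: embed_powr_def bucket_sum_scale abs_mult powr_mult sum_distrib_left algebra_simps)
qed

section \<open>Deterministic distortion bounds for a fixed good outcome\<close>

context
  fixes p :: real and n d r H :: nat and A U :: "nat \<Rightarrow> nat \<Rightarrow> real"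
    and w :: "nat \<Rightarrow> nat \<times> bool \<times> nat" and m \<eta> Ct Ld \<delta> :: real
  assumes p: "1 \<le> p" "p < 2"
    and lewis: "\<And>x. \<exists>y. (\<forall>j<n. mat_vec d A x j = mat_vec d U y j) \<and>
      (sq_norm d y) powr (p/2) \<le> 2 * (mass p n (mat_vec d A x))"
    and rows: "(\<Sum>j<n. (sq_norm d (U j)) powr (p/2)) \<le> 2 * d"
    and S_lower: "\<And>x. (\<Sum>j<n. (mat_vec d A x j)\<^sup>2) / 2 \<le>
      (\<Sum>b<r. (sign_sketch n (mat_vec d A x) w b)\<^sup>2)"
    and S_upper: "\<And>y. (\<Sum>b<r. \<bar>sign_sketch n (mat_vec d U y) w b\<bar> powr p) \<le>
      2 * (2000 * d powr (p/2) * (sq_norm d y) powr (p/2) + Ld powr (p - 1) * (mass p n (mat_vec d U y)))"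
    and T_upper: "\<And>y. (\<Sum>b<r. \<bar>heavy_sketch p n (mat_vec d U y) w b\<bar> powr p) \<le>
      Ct * (sq_norm d y) powr (p/2)"
    and net: "\<And>g. g \<in> grid d H \<Longrightarrow>
      1/8 \<le> (\<Sum>j<n. if \<bar>mat_vec d U g j\<bar> powr p \<le> 1/m then \<bar>mat_vec d U g j\<bar> powr p else 0) \<Longrightarrow>
      \<eta> * m < real (card {b. b < r \<and> 1/m \<le> \<bar>heavy_sketch p n (mat_vec d U g) w b\<bar> powr p})"
    and m: "1 \<le> m" and \<eta>: "0 < \<eta>" "\<eta> \<le> 1/16" and H: "0 < H" and Ct: "0 \<le> Ct"
    and \<delta>: "0 \<le> \<delta>" "\<delta> \<le> 1" "\<delta>\<^sup>2 = d / (real H)\<^sup>2"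
      "2 * d * \<delta> \<le> 1/4" "Ct * \<delta> \<le> \<eta> / 4" "(2 * real d)\<^sup>2 * m * \<delta>\<^sup>2 \<le> 1/64"
begin

lemma embed_powr_upper:
  "embed_powr p n r w m (mat_vec d A x) \<le>
    ((m powr (1/p - 1/2)) powr p * (2 * (4000 * d powr (p/2) + Ld powr (p - 1))) + 2 * Ct) *
    (mass p n (mat_vec d A x))"
proof -
  obtain y where y: "\<forall>j<n. mat_vec d A x j = mat_vec d U y j"
    "(sq_norm d y) powr (p/2) \<le> 2 * (mass p n (mat_vec d A x))"
    using lewis by blast
  let ?N = "\<Sum>j<n. \<bar>mat_vec d A x j\<bar> powr p"
  have b1: "sign_sketch n (mat_vec d A x) w b = sign_sketch n (mat_vec d U y) w b" for b
    using y by (intro bucket_sum_cong) auto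
  have b2: "heavy_sketch p n (mat_vec d A x) w b
    = heavy_sketch p n (mat_vec d U y) w b" for b
    using y by (intro bucket_sum_cong) auto
  have N: "(mass p n (mat_vec d U y)) = ?N" using y by simp
  have s: "(\<Sum>b<r. \<bar>sign_sketch n (mat_vec d A x) w b\<bar> powr p) \<le> 2 * (4000 * d powr (p/2) + Ld powr (p - 1)) * ?N"
  proof -
    have "(\<Sum>b<r. \<bar>sign_sketch n (mat_vec d A x) w b\<bar> powr p) \<le>
      2 * (2000 * d powr (p/2) * (sq_norm d y) powr (p/2) + Ld powr (p - 1) * ?N)"
      unfolding b1 using S_upper[of y] N by simp
    also have "... \<le> 2 * (2000 * d powr (p/2) * (2 * ?N) + Ld powr (p - 1) * ?N)"
      using y(2) by (intro mult_left_mono add_right_mono) auto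
    finally show ?thesis by (simp add: algebra_simps)
  qed
  have t: "(\<Sum>b<r. \<bar>heavy_sketch p n (mat_vec d A x) w b\<bar> powr p) \<le> 2 * Ct * ?N"
  proof -
    have "(\<Sum>b<r. \<bar>heavy_sketch p n (mat_vec d A x) w b\<bar> powr p) \<le> Ct * (sq_norm d y) powr (p/2)"
      unfolding b2 by (rule T_upper)
    also have "... \<le> Ct * (2 * ?N)" using y(2) Ct by (intro mult_left_mono)
    finally show ?thesis by simp
  qed
  have "embed_powr p n r w m (mat_vec d A x) \<le> (m powr (1/p - 1/2)) powr p * (2 * (4000 * d powr (p/2) + Ld powr (p - 1)) * ?N) + 2 * Ct * ?N"
    unfolding embed_powr_def using s t by (intro add_mono mult_left_mono) auto
  then show ?thesis by (simp add: algebra_simps)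
qed

text \<open>The Lewis coordinates are rounded to a grid point whose image \<open>G\<close> keeps
  mass at least 1/4. Either 1/8 of it is light, and the net bound for \<open>T\<close> transfers
  back because \<open>T\<close> maps the error \<open>E\<close> to mass at most
  \<open>\<eta> / 4\<close>; or 1/8 is heavy, the Euclidean norm of \<open>Y\<close> is then large,
  and the first block detects it.\<close>

lemma embed_powr_lower_normalized:
  assumes N: "(mass p n (mat_vec d A x)) = 1"
  shows "\<eta> / 4 \<le> embed_powr p n r w m (mat_vec d A x)"
proof -
  obtain y where y: "\<forall>j<n. mat_vec d A x j = mat_vec d U y j" "(sq_norm d y) powr (p/2) \<le> 2"
    using lewis[of x] N by auto
  have yk: "\<bar>y k\<bar> \<le> 2" if k: "k < d" for k
  proof (rule ccontr)
    assume "\<not> \<bar>y k\<bar> \<le> 2"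
    then have "2 powr p < \<bar>y k\<bar> powr p" using p by (intro powr_less_mono2) auto
    also have "... \<le> (sq_norm d y) powr (p/2)"
      unfolding abs_powr_eq_sq_powr using k p by (intro powr_mono2 member_le_sum) auto
    also have "... \<le> 2 powr 1" using y by simp
    also have "... \<le> 2 powr p" using p by (intro powr_mono) auto
    finally show False by simp
  qed
  obtain g where g: "g \<in> grid d H" "(\<Sum>k<d. (y k - g k)\<^sup>2) \<le> d / (real H)\<^sup>2"
    by (rule grid_approx[OF H, of d y]) (use yk in auto)
  define e where "e = (\<lambda>k. g k - y k)"
  define q where "q = (sq_norm d e)"
  have "q = (\<Sum>k<d. (y k - g k)\<^sup>2)"
    unfolding q_def e_def by (intro sum.cong refl) (rule power2_commute)
  then have q: "0 \<le> q" "q \<le> \<delta>\<^sup>2" using g \<delta> by (simp_all add: sum_nonneg)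
  \<comment> \<open>\<open>\<delta> powr p \<le> \<delta>\<close> as
    \<open>\<delta> \<le> 1\<close>; this makes the later conditions on the mesh linear in
    \<open>\<delta>\<close>.\<close>
  have qp: "q powr (p/2) \<le> \<delta>"
  proof -
    have "q powr (p/2) \<le> (\<delta>\<^sup>2) powr (p/2)" using q p by (intro powr_mono2) auto
    also have "... = \<delta> powr p" using abs_powr_eq_sq_powr[of \<delta> p] \<delta> by simp
    also have "... \<le> \<delta>"
    proof (cases "\<delta> = 0")
      case False
      then have "\<delta> powr p \<le> \<delta> powr 1" using \<delta> p by (intro powr_mono') auto
      then show ?thesis using \<delta> by simp
    qed simp
    finally show ?thesis .
  qed
  define Y where "Y = mat_vec d A x"
  define G where "G = mat_vec d U g"
  define E where "E = mat_vec d U e"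
  have GE: "G j = Y j + E j" if "j < n" for j
  proof -
    have "g = (\<lambda>k. y k + e k)" by (simp add: e_def)
    then have "G j = mat_vec d U y j + E j" unfolding G_def E_def using mat_vec_add by metis
    then show ?thesis using y(1) that by (simp add: Y_def)
  qed
  have Esq: "(E j)\<^sup>2 \<le> (sq_norm d (U j)) * q" for j
    unfolding E_def q_def by (rule mat_vec_sq_le)
  have EN: "mass p n E \<le> 1/4"
  proof -
    have "mass p n E \<le> (\<Sum>j<n. (sq_norm d (U j)) powr (p/2) * q powr (p/2))"
    proof (intro sum_mono)
      fix j
      have "\<bar>E j\<bar> powr p \<le> ((sq_norm d (U j)) * q) powr (p/2)"
        unfolding abs_powr_eq_sq_powr using Esq p by (intro powr_mono2) auto
      then show "\<bar>E j\<bar> powr p \<le> (sq_norm d (U j)) powr (p/2) * q powr (p/2)"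
        using q by (simp add: powr_mult sum_nonneg)
    qed
    also have "... = (\<Sum>j<n. (sq_norm d (U j)) powr (p/2)) * q powr (p/2)" by (simp add: sum_distrib_right)
    also have "... \<le> (2 * d) * \<delta>" using rows qp by (intro mult_mono) auto
    finally show ?thesis using \<delta> by simp
  qed
  have GN: "1/4 \<le> (mass p n G)"
  proof -
    have "mass p n Y \<le> (\<Sum>j<n. 2 * (\<bar>G j\<bar> powr p + \<bar>E j\<bar> powr p))"
    proof (intro sum_mono)
      fix j assume "j \<in> {..<n}"
      then have "Y j = G j + - E j" using GE by simp
      then show "\<bar>Y j\<bar> powr p \<le> 2 * (\<bar>G j\<bar> powr p + \<bar>E j\<bar> powr p)"
        using abs_add_powr_le[of p "G j" "- E j"] p by simp
    qed
    also have "... = 2 * ((mass p n G) + (mass p n E))"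
      by (simp add: sum.distrib sum_distrib_left)
    finally show ?thesis using EN N by (simp add: Y_def)
  qed
  define light where "light = (\<Sum>j<n. if \<bar>G j\<bar> powr p \<le> 1/m then \<bar>G j\<bar> powr p else 0)"
  show ?thesis
  proof (cases "1/8 \<le> light")
    case True
    let ?TG = "\<lambda>b. heavy_sketch p n G w b"
    let ?TY = "\<lambda>b. heavy_sketch p n Y w b"
    let ?TE = "\<lambda>b. heavy_sketch p n E w b"
    let ?B = "{b. b < r \<and> 1/m \<le> \<bar>?TG b\<bar> powr p}"
    have "\<eta> = (\<eta> * m) * (1/m)" using m by simp
    also have "... \<le> card ?B * (1/m)"
      using net[OF g(1)] True m unfolding light_def G_def by (intro mult_right_mono) auto
    also have "... = (\<Sum>b\<in>?B. 1/m)" by simp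
    also have "... \<le> (\<Sum>b\<in>?B. \<bar>?TG b\<bar> powr p)" by (intro sum_mono) auto
    also have "... \<le> (\<Sum>b<r. \<bar>?TG b\<bar> powr p)" by (intro sum_mono2) auto
    also have "... \<le> (\<Sum>b<r. 2 * (\<bar>?TY b\<bar> powr p + \<bar>?TE b\<bar> powr p))"
    proof (intro sum_mono)
      fix b
      have "?TG b = ?TY b + ?TE b"
        unfolding bucket_sum_add[symmetric] by (intro bucket_sum_cong) (auto simp: GE distrib_left)
      then show "\<bar>?TG b\<bar> powr p \<le> 2 * (\<bar>?TY b\<bar> powr p + \<bar>?TE b\<bar> powr p)"
        using abs_add_powr_le[of p "?TY b" "?TE b"] p by simp
    qed
    also have "... = 2 * ((\<Sum>b<r. \<bar>?TY b\<bar> powr p) + (\<Sum>b<r. \<bar>?TE b\<bar> powr p))"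
      by (simp add: sum.distrib sum_distrib_left)
    also have "... \<le> 2 * ((\<Sum>b<r. \<bar>?TY b\<bar> powr p) + \<eta> / 4)"
    proof -
      have "(\<Sum>b<r. \<bar>?TE b\<bar> powr p) \<le> Ct * q powr (p/2)" unfolding E_def q_def by (rule T_upper)
      also have "... \<le> Ct * \<delta>" using qp Ct by (intro mult_left_mono)
      finally show ?thesis using \<delta> by simp
    qed
    finally have "\<eta> / 4 \<le> (\<Sum>b<r. \<bar>?TY b\<bar> powr p)" by simp
    also have "... \<le> embed_powr p n r w m Y" unfolding embed_powr_def by (simp add: sum_nonneg)
    finally show ?thesis by (simp add: Y_def)
  next
    case False
    \<comment> \<open>On entries of mass above \<open>1/m\<close> the \<open>p\<close>-th power is
      at most \<open>a\<close> times the square. Moreover \<open>a powr (p/2)\<close> is the factor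
      of the first block in \<open>embed_powr\<close>, which is therefore exactly what is
      needed.\<close>
    define a where "a = m powr (2/p - 1)"
    have a0: "0 < a" using m by (simp add: a_def)
    have am: "a \<le> m"
    proof -
      have "2/p - 1 \<le> 1" using p by (simp add: field_simps)
      then have "m powr (2/p - 1) \<le> m powr 1" using m by (intro powr_mono) auto
      then show ?thesis using m by (simp add: a_def)
    qed
    have "1/8 \<le> (mass p n G) - light" using GN False by simp
    also have "... = (\<Sum>j<n. if \<bar>G j\<bar> powr p \<le> 1/m then 0 else \<bar>G j\<bar> powr p)"
      unfolding light_def sum_subtractf[symmetric] by (intro sum.cong) auto
    also have "... \<le> (\<Sum>j<n. a * (G j)\<^sup>2)"
    proof (intro sum_mono)
      fix j
      have "\<bar>G j\<bar> powr p \<le> a * (G j)\<^sup>2" if "1/m < \<bar>G j\<bar> powr p"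
      proof -
        let ?h = "\<bar>G j\<bar> powr p"
        have h: "0 < ?h" using that m by (intro less_trans[OF _ that]) auto
        have "(1/m) powr (2/p - 1) \<le> ?h powr (2/p - 1)"
          using that p m by (intro powr_mono2) auto
        then have "1 \<le> a * ?h powr (2/p - 1)"
          using m a0 by (simp add: a_def powr_divide field_simps)
        then have "?h * 1 \<le> ?h * (a * ?h powr (2/p - 1))" using h by (intro mult_left_mono) auto
        also have "... = a * ?h powr (2/p)" using h by (simp add: powr_diff)
        also have "?h powr (2/p) = (G j)\<^sup>2"
          using p by (simp add: powr_powr)
        finally show ?thesis by simp
      qed
      then show "(if \<bar>G j\<bar> powr p \<le> 1/m then 0 else \<bar>G j\<bar> powr p) \<le> a * (G j)\<^sup>2"
        using a0 by auto
    qed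
    also have "... \<le> (\<Sum>j<n. a * (2 * (Y j)\<^sup>2 + 2 * (E j)\<^sup>2))"
    proof (intro sum_mono mult_left_mono)
      fix j assume "j \<in> {..<n}"
      then show "(G j)\<^sup>2 \<le> 2 * (Y j)\<^sup>2 + 2 * (E j)\<^sup>2"
        using sum_squares_bound[of "Y j" "E j"] by (simp add: GE power2_sum)
    qed (use a0 in auto)
    also have "... = 2 * (a * (\<Sum>j<n. (Y j)\<^sup>2)) + 2 * (a * (\<Sum>j<n. (E j)\<^sup>2))"
      by (simp add: sum.distrib sum_distrib_left algebra_simps)
    also have "a * (\<Sum>j<n. (E j)\<^sup>2) \<le> 1/64"
    proof -
      \<comment> \<open>Subadditivity of \<open>powr (p/2)\<close> and the Lewis bound give
        \<open>R powr (p/2) \<le> 2 * d\<close>, hence \<open>R \<le> (2 * d)\<^sup>2\<close>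
        because \<open>2/p \<le> 2\<close>. The polynomially small mesh compensates for this crude
        bound.\<close>
      define R where "R = (\<Sum>j<n. \<Sum>k<d. (U j k)\<^sup>2)"
      have R0: "0 \<le> R" by (auto simp: R_def intro!: sum_nonneg)
      have "R powr (p/2) \<le> 2 * d"
        unfolding R_def using p by (intro order_trans[OF powr_sum_le_sum_powr rows]) (auto intro!: sum_nonneg)
      have R: "R \<le> (2 * real d)\<^sup>2"
      proof (cases "d = 0")
        case True
        then show ?thesis by (simp add: R_def)
      next
        case False
        have "R = (R powr (p/2)) powr (2/p)" using p R0 by (simp add: powr_powr)
        also have "... \<le> (2 * d) powr (2/p)" using p \<open>R powr (p/2) \<le> 2 * d\<close> by (intro powr_mono2) auto
        also have "... \<le> (2 * d) powr 2"
          using p False by (intro powr_mono) (auto simp: field_simps)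
        finally show ?thesis using False by simp
      qed
      have "a * (\<Sum>j<n. (E j)\<^sup>2) \<le> a * (\<Sum>j<n. (sq_norm d (U j)) * q)"
        using a0 Esq by (intro mult_left_mono sum_mono) auto
      also have "... = a * (R * q)" by (simp add: R_def sum_distrib_right)
      also have "... \<le> m * ((2 * real d)\<^sup>2 * \<delta>\<^sup>2)"
        using am R q R0 a0 m by (intro mult_mono) auto
      also have "... \<le> 1/64" using \<delta> by (simp add: mult_ac)
      finally show ?thesis .
    qed
    finally have Ysq: "1/32 \<le> a * (\<Sum>j<n. (Y j)\<^sup>2)" by simp
    have "1/64 \<le> a * ((\<Sum>j<n. (Y j)\<^sup>2) / 2)" using Ysq by simp
    also have "... \<le> a * (\<Sum>b<r. (sign_sketch n Y w b)\<^sup>2)"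
      using S_lower[of x] a0 unfolding Y_def by (intro mult_left_mono) auto
    finally have "(1/64) powr (p/2) \<le> (a * (\<Sum>b<r. (sign_sketch n Y w b)\<^sup>2)) powr (p/2)"
      using p by (intro powr_mono2) auto
    also have "... = a powr (p/2) * (\<Sum>b<r. (sign_sketch n Y w b)\<^sup>2) powr (p/2)"
      using a0 by (simp add: powr_mult sum_nonneg)
    also have "... \<le> a powr (p/2) * (\<Sum>b<r. \<bar>sign_sketch n Y w b\<bar> powr p)"
      unfolding abs_powr_eq_sq_powr using p by (intro mult_left_mono powr_sum_le_sum_powr) auto
    also have "a powr (p/2) = (m powr (1/p - 1/2)) powr p"
      using p by (simp add: a_def powr_powr algebra_simps)
    also have "... * (\<Sum>b<r. \<bar>sign_sketch n Y w b\<bar> powr p) \<le> embed_powr p n r w m Y"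
      unfolding embed_powr_def by (simp add: sum_nonneg)
    finally have "(1/64) powr (p/2) \<le> embed_powr p n r w m Y" .
    moreover have "(1/64) powr 1 \<le> (1/64 :: real) powr (p/2)" using p by (intro powr_mono') auto
    ultimately show ?thesis using \<eta> by (simp add: Y_def)
  qed
qed

lemma embed_powr_lower:
  "\<eta> / 4 * (mass p n (mat_vec d A x)) \<le> embed_powr p n r w m (mat_vec d A x)"
proof -
  define N where "N = (mass p n (mat_vec d A x))"
  have N0: "0 \<le> N" by (simp add: N_def sum_nonneg)
  show ?thesis
  proof (cases "N = 0")
    case True
    then show ?thesis by (simp add: N_def[symmetric] embed_powr_def sum_nonneg)
  next
    case False
    then have N: "0 < N" using N0 by simp
    define t where "t = N powr (- (1/p))"
    have t: "0 < t" using N by (simp add: t_def)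
    have tp: "\<bar>t\<bar> powr p = 1 / N"
    proof -
      have "\<bar>t\<bar> powr p = N powr (- (1/p) * p)" unfolding t_def powr_powr[symmetric] by simp
      also have "... = 1 / N" using N p by (simp add: powr_minus divide_inverse)
      finally show ?thesis .
    qed
    have sc: "mat_vec d A (\<lambda>k. t * x k) = (\<lambda>j. t * mat_vec d A x j)" by (simp add: fun_eq_iff mat_vec_scale)
    have "(\<Sum>j<n. \<bar>mat_vec d A (\<lambda>k. t * x k) j\<bar> powr p) = \<bar>t\<bar> powr p * N"
      by (simp add: sc abs_mult powr_mult N_def sum_distrib_left)
    then have "(\<Sum>j<n. \<bar>mat_vec d A (\<lambda>k. t * x k) j\<bar> powr p) = 1" using tp N by simp
    from embed_powr_lower_normalized[OF this]
    have "\<eta> / 4 \<le> (1 / N) * embed_powr p n r w m (mat_vec d A x)" by (simp add: sc embed_powr_scale tp)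
    then show ?thesis using N by (simp add: N_def[symmetric] field_simps)
  qed
qed

end

section \<open>Choice of the parameters\<close>

text \<open>The three conditions make, in this order, the Gram error event have probability at most
  1/1000, the image of the rounding error under \<open>T\<close> have mass at most
  \<open>\<eta> / 4\<close>, and the small-ball exponent beat the net. The dimension has been
  factored out, so \<open>K\<close> depends on \<open>p\<close> and \<open>\<epsilon>\<close>
  only.\<close>

lemma exists_size_parameter:
  fixes \<eta> Cp :: real
  assumes \<eta>: "0 < \<eta>"
  obtains K :: nat where "8000 \<le> K" "16000 / \<eta> * (Cp + 1 + 4000 * real K) \<le> (real K)\<^sup>2"
    "2 * ln (14000 * (real K)\<^sup>2) + 4 \<le> \<eta> * K"
proof -
  have "eventually (\<lambda>K::nat. 16000 / \<eta> * (Cp + 1 + 4000 * real K) \<le> (real K)\<^sup>2) sequentially"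
    by real_asymp
  moreover have "eventually (\<lambda>K::nat. 2 * ln (14000 * (real K)\<^sup>2) + 4 \<le> \<eta> * K) sequentially"
    using \<eta> by real_asymp
  moreover have "eventually (\<lambda>K::nat. 8000 \<le> K) sequentially" by (rule eventually_ge_at_top)
  ultimately have "eventually (\<lambda>K::nat. 8000 \<le> K \<and> 16000 / \<eta> * (Cp + 1 + 4000 * real K) \<le> (real K)\<^sup>2 \<and>
    2 * ln (14000 * (real K)\<^sup>2) + 4 \<le> \<eta> * K) sequentially"
    by eventually_elim auto
  then show thesis using that eventually_happens'[OF sequentially_bot] by blast
qed

lemma half_le_ln: "2 \<le> d \<Longrightarrow> 1/2 \<le> ln (real d)"
proof -
  assume "2 \<le> d"
  have "exp (1/2 :: real) \<le> 2"
  proof -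
    have "(exp (1/2 :: real))\<^sup>2 = exp 1" by (simp add: exp_double[symmetric] flip: exp_double)
    also have "... \<le> 3" by (rule exp_le)
    also have "... \<le> 2\<^sup>2" by simp
    finally show ?thesis by (rule power2_le_imp_le) simp
  qed
  also have "... \<le> real d" using \<open>2 \<le> d\<close> by simp
  finally show ?thesis using \<open>2 \<le> d\<close> by (subst ln_ge_iff) auto
qed

definition grid_size :: "nat \<Rightarrow> nat \<Rightarrow> nat" where
  "grid_size K d = K\<^sup>2 * d ^ 4"

definition grid_error :: "nat \<Rightarrow> nat \<Rightarrow> real" where
  "grid_error K d = sqrt d / grid_size K d"

definition upper_const :: "real \<Rightarrow> nat \<Rightarrow> real" where
  "upper_const p K = 4 * real K * (4000 + (1000 * real K + 6))
    + 8000 * (2 * (1 / (1 - 2 powr (1 - 2/p))) + 2 * log 2 (4000 * real K) + 6)"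

lemma log2_le_self: "0 < z \<Longrightarrow> log 2 z \<le> z"
proof -
  assume z: "0 < z"
  have "z \<le> 2 powr z"
  proof -
    have "ln 2 \<ge> (1/2::real)" using half_le_ln[of 2] by simp
    \<comment> \<open>The left side minus \<open>z\<close> equals
      \<open>(z - 2)\<^sup>2 / 8 + 1/2\<close>.\<close>
    then have "1 + z / 2 + (z/2)\<^sup>2 / 2 \<le> exp (z / 2) " using exp_lower_Taylor_quadratic[of "z/2"] z by simp
    also have "... \<le> 2 powr z" using \<open>ln 2 \<ge> 1/2\<close> z by (simp add: powr_def mult_left_mono)
    finally show ?thesis using zero_le_power2[of "z - 2"] by (simp add: power2_diff power_divide)
  qed
  then have "log 2 z \<le> log 2 (2 powr z)" using z by (subst log_le_cancel_iff) auto
  then show ?thesis by simp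
qed

context
  fixes p \<epsilon> :: real and K d :: nat and \<eta> Cp m :: real and r :: nat
  assumes p: "1 \<le> p" "p < 2" and \<epsilon>: "0 < \<epsilon>" "\<epsilon> < 1" and d: "2 \<le> d"
  defines "\<eta> \<equiv> \<epsilon> / 512" and "Cp \<equiv> 1 / (1 - 2 powr (1 - 2/p))"
    and "m \<equiv> real K * d * ln d" and "r \<equiv> K * d\<^sup>2"
  assumes K: "8000 \<le> K" "16000 / \<eta> * (Cp + 1 + 4000 * real K) \<le> (real K)\<^sup>2"
    "2 * ln (14000 * (real K)\<^sup>2) + 4 \<le> \<eta> * K"
begin

lemma ln_dim_bounds: "1/2 \<le> ln (real d)" "ln (real d) \<le> d"
  using half_le_ln[OF d] ln_le_minus_one[of "real d"] d by auto

lemma eta_bounds: "0 < \<eta>" "\<eta> \<le> 1/16" using \<epsilon> by (auto simp: \<eta>_def)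

lemma Cp_ge_one: "1 \<le> Cp"
proof -
  have "2 powr (1 - 2/p) < 2 powr (0::real)" using p by (intro powr_less_mono) (auto simp: field_simps)
  then show ?thesis by (simp add: Cp_def)
qed

lemma m_bounds: "1 \<le> m" "m \<le> r" "m \<le> K * (real d)\<^sup>2"
proof -
  have "1 * (2 * (1/2)) \<le> real K * (d * ln d)"
    using K d ln_dim_bounds by (intro mult_mono) auto
  then show "1 \<le> m" by (simp add: m_def mult.assoc)
  have "real d * ln d \<le> real d * real d" using ln_dim_bounds by (intro mult_left_mono) auto
  then have "real K * (d * ln d) \<le> real K * (real d * real d)" using ln_dim_bounds(2) by (intro mult_left_mono) auto
  then show "m \<le> K * (real d)\<^sup>2" unfolding m_def power2_eq_square by (simp only: mult.assoc)
  then show "m \<le> r" by (simp add: r_def)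
qed

lemma num_rows_pos: "0 < r" using K d by (simp add: r_def)

lemma grid_size_pos: "0 < grid_size K d" using K d by (simp add: grid_size_def)

lemma grid_error_le: "0 \<le> grid_error K d" "grid_error K d \<le> 1 / ((real K)\<^sup>2 * real d ^ 3)"
proof -
  show "0 \<le> grid_error K d" by (simp add: grid_error_def)
  have "sqrt d \<le> d" using d by (intro real_le_lsqrt) (auto simp: power2_eq_square)
  then have "grid_error K d \<le> d / ((real K)\<^sup>2 * real d ^ 4)"
    by (simp add: grid_error_def grid_size_def divide_right_mono)
  also have "... = 1 / ((real K)\<^sup>2 * real d ^ 3)"
    using d K by (simp add: field_simps power_numeral_reduce)
  finally show "grid_error K d \<le> 1 / ((real K)\<^sup>2 * real d ^ 3)" .
qed

text \<open>The expansion of the rounding error by \<open>T\<close>. Replacing the logarithm by its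
  argument costs \<open>d\<^sup>2\<close>, which with the leading \<open>d\<close> is cancelled by
  the \<open>d ^ 3\<close> in the mesh bound; this explains the exponent 4 in
  \<open>grid_size\<close>.\<close>

lemma stable_constant_le:
  "4000 * real d * (Cp + log 2 (4000 * real r) + 1) * grid_error K d \<le> \<eta> / 4"
proof -
  have "Cp + log 2 (4000 * real r) + 1 \<le> Cp * (real d)\<^sup>2 + 4000 * (K * (real d)\<^sup>2) + 1 * (real d)\<^sup>2"
  proof (intro add_mono)
    have d2: "1 \<le> (real d)\<^sup>2" using d by simp
    then show "Cp \<le> Cp * (real d)\<^sup>2" "1 \<le> 1 * (real d)\<^sup>2" using Cp_ge_one mult_left_mono[OF d2, of Cp] by auto
    show "log 2 (4000 * real r) \<le> 4000 * (K * (real d)\<^sup>2)"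
      using log2_le_self[of "4000 * real r"] num_rows_pos by (simp add: r_def)
  qed
  also have "... = (Cp + 1 + 4000 * real K) * (real d)\<^sup>2" by (simp add: algebra_simps)
  finally have "4000 * real d * (Cp + log 2 (4000 * real r) + 1) * grid_error K d
      \<le> 4000 * real d * ((Cp + 1 + 4000 * real K) * (real d)\<^sup>2) * (1 / ((real K)\<^sup>2 * real d ^ 3))"
    using grid_error_le Cp_ge_one by (intro mult_mono mult_left_mono) auto
  also have "... = 4000 * (Cp + 1 + 4000 * real K) / (real K)\<^sup>2"
    using d K by (simp add: field_simps power2_eq_square power3_eq_cube)
  also have "... \<le> \<eta> / 4"
  proof -
    have "16000 * (Cp + 1 + 4000 * real K) \<le> \<eta> * (real K)\<^sup>2"
      using K(2) eta_bounds by (simp add: field_simps)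
    then show ?thesis using K by (simp add: field_simps)
  qed
  finally show ?thesis .
qed

text \<open>The logarithm of the net size is of order \<open>d * ln (K\<^sup>2 * d ^ 4)\<close>,
  while the exponent is \<open>\<eta> * K * d * ln d\<close>. Since \<open>1 \<le> 2 * ln d\<close>,
  constants are charged to \<open>ln d\<close>, and the last condition on \<open>K\<close>
  remains.\<close>

lemma net_size_le: "(4 * real (grid_size K d) + 3) ^ d * (2 * exp (- (\<eta> * m))) \<le> 1/1000"
proof -
  define B where "B = 7 * (real K)\<^sup>2 * real d ^ 4"
  have B: "0 < B" using K d by (simp add: B_def)
  have "1 \<le> real (grid_size K d)" using grid_size_pos by linarith
  then have "4 * real (grid_size K d) + 3 \<le> B" by (simp add: B_def grid_size_def)
  then have "(4 * real (grid_size K d) + 3) ^ d \<le> B ^ d" by (intro power_mono) auto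
  also have "B ^ d = exp (d * ln B)" using B by (simp add: exp_of_nat_mult)
  finally have "(4 * real (grid_size K d) + 3) ^ d * (2 * exp (- (\<eta> * m))) \<le> exp (d * ln B) * (2 * exp (- (\<eta> * m)))"
    by (intro mult_right_mono) auto
  also have "... = (1/1000) * exp (d * ln B + ln 2000 - \<eta> * m)"
    by (simp add: exp_add exp_diff exp_minus field_simps)
  also have "... \<le> (1/1000) * 1"
  proof (intro mult_left_mono)
    have "d * ln B + ln 2000 \<le> d * ln B + d * ln (2000::real)"
      using d by (auto simp: mult_le_cancel_right1)
    also have "... = d * (ln (14000 * (real K)\<^sup>2) + 4 * ln d)"
    proof -
      have "ln B + ln 2000 = ln (B * 2000)" using B by (subst ln_mult) auto
      also have "B * 2000 = (14000 * (real K)\<^sup>2) * real d ^ 4" by (simp add: B_def)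
      also have "ln ... = ln (14000 * (real K)\<^sup>2) + ln (real d ^ 4)"
        using K d by (subst ln_mult) auto
      also have "ln (real d ^ 4) = 4 * ln d" using d by (simp add: ln_realpow)
      finally have "d * (ln B + ln 2000) = d * (ln (14000 * (real K)\<^sup>2) + 4 * ln d)" by simp
      then show ?thesis by (simp only: distrib_left)
    qed
    also have "... \<le> d * (ln (14000 * (real K)\<^sup>2) * (2 * ln d) + 4 * ln d)"
    proof (intro mult_left_mono add_right_mono)
      have "1 \<le> (real K)\<^sup>2" using K by (intro one_le_power) auto
      then have "0 \<le> ln (14000 * (real K)\<^sup>2)" by (intro ln_ge_zero) linarith
      then show "ln (14000 * (real K)\<^sup>2) \<le> ln (14000 * (real K)\<^sup>2) * (2 * ln d)"
        using ln_dim_bounds by (intro mult_le_cancel_left1[THEN iffD2]) auto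
    qed auto
    also have "... = d * ln d * (2 * ln (14000 * (real K)\<^sup>2) + 4)" by (simp add: algebra_simps)
    also have "... \<le> d * ln d * (\<eta> * K)" using K(3) ln_dim_bounds by (intro mult_left_mono) auto
    also have "... = \<eta> * m" by (simp add: m_def)
    finally show "exp (d * ln B + ln 2000 - \<eta> * m) \<le> 1" by simp
  qed auto
  finally show ?thesis by simp
qed

lemma upper_const_ge: "1 \<le> upper_const p K"
proof -
  have "0 \<le> log 2 (4000 * real K)" using K by (intro zero_le_log_cancel_iff[THEN iffD2]) auto
  moreover have "0 \<le> 4 * real K * (4000 + (1000 * real K + 6))" by simp
  moreover have "1 \<le> X + 8000 * (2 * Cp + 2 * Y + 6)" if "0 \<le> X" "0 \<le> Y" for X Y
    using that Cp_ge_one by (smt (verit))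
  ultimately show ?thesis unfolding upper_const_def Cp_def[symmetric] by blast
qed

text \<open>The scaling of the first block is affordable since its \<open>p\<close>-th power
  \<open>m powr (1 - p/2)\<close> times \<open>d powr (p/2)\<close> is of order
  \<open>d * ln d\<close>. The load term \<open>O(d) powr (p - 1)\<close> also stays within
  \<open>d powr (p/2)\<close>, because \<open>p - 1 \<le> p/2\<close>.\<close>

lemma upper_bound_le:
  "(m powr (1/p - 1/2)) powr p * (2 * (4000 * real d powr (p/2) + (ln (1000 * real r) + 4 * real d) powr (p - 1)))
    + 2 * (4000 * real d * (Cp + log 2 (4000 * real r) + 1)) \<le> upper_const p K * (d * ln d)"
proof -
  have d1: "1 \<le> real d" using d by simp
  have Ld: "(ln (1000 * real r) + 4 * real d) powr (p - 1) \<le> (1000 * real K + 6) * d powr (p/2)"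
  proof -
    have "ln (1000 * real r) = ln (1000 * real K) + 2 * ln d"
      using K d by (simp add: r_def ln_mult ln_realpow)
    also have "... \<le> 1000 * real K * d + 2 * real d"
    proof (intro add_mono)
      have "ln (1000 * real K) \<le> 1000 * real K * 1" using K ln_le_minus_one[of "1000 * real K"] by simp
      also have "... \<le> 1000 * real K * d" using d1 by (intro mult_left_mono) auto
      finally show "ln (1000 * real K) \<le> 1000 * real K * d" by simp
    qed (use ln_dim_bounds in auto)
    finally have "ln (1000 * real r) + 4 * d \<le> (1000 * real K + 6) * d" by (simp add: algebra_simps)
    moreover have "0 \<le> ln (1000 * real r)" using num_rows_pos by (intro ln_ge_zero) auto
    ultimately have "(ln (1000 * real r) + 4 * real d) powr (p - 1) \<le> ((1000 * real K + 6) * d) powr (p - 1)"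
      using p by (intro powr_mono2) auto
    also have "... \<le> ((1000 * real K + 6) * d) powr (p/2)"
    proof (intro powr_mono)
      have "1 * 1 \<le> (1000 * real K + 6) * d" using d1 by (intro mult_mono) auto
      then show "1 \<le> (1000 * real K + 6) * d" by simp
    qed (use p in auto)
    also have "... = (1000 * real K + 6) powr (p/2) * d powr (p/2)" by (simp add: powr_mult)
    also have "... \<le> (1000 * real K + 6) powr 1 * d powr (p/2)"
      using p by (intro mult_right_mono powr_mono) auto
    finally show ?thesis by simp
  qed
  have mp: "(m powr (1/p - 1/2)) powr p * d powr (p/2) \<le> 2 * K * (d * ln d)"
  proof -
    have "(m powr (1/p - 1/2)) powr p = m powr (1 - p/2)"
      using p by (simp add: powr_powr algebra_simps)
    also have "... = real K powr (1 - p/2) * real d powr (1 - p/2) * ln d powr (1 - p/2)"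
      using ln_dim_bounds by (simp add: m_def powr_mult)
    finally have "(m powr (1/p - 1/2)) powr p * d powr (p/2)
      = real K powr (1 - p/2) * (real d powr (1 - p/2) * real d powr (p/2)) * ln d powr (1 - p/2)"
      by (simp add: mult_ac)
    also have "real d powr (1 - p/2) * real d powr (p/2) = d" using d by (simp add: powr_add[symmetric])
    also have "real K powr (1 - p/2) * d * ln d powr (1 - p/2) \<le> real K * real d * (2 * ln d)"
    proof (intro mult_mono)
      have "real K powr (1 - p/2) \<le> real K powr 1" using p K by (intro powr_mono) auto
      then show "real K powr (1 - p/2) \<le> K" using K by simp
      \<comment> \<open>For \<open>d = 2\<close> the logarithm lies below 1, where smaller exponents
        give larger powers; the factor 2 with \<open>ln d \<ge> 1/2\<close> covers this
        case.\<close>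
      show "ln d powr (1 - p/2) \<le> 2 * ln d"
      proof (cases "1 \<le> ln (real d)")
        case True
        then have "ln d powr (1 - p/2) \<le> ln d powr 1" using p by (intro powr_mono) auto
        then show ?thesis using ln_dim_bounds by simp
      next
        case False
        then have "ln d powr (1 - p/2) \<le> 1" using ln_dim_bounds p by (intro powr_le1) auto
        then show ?thesis using ln_dim_bounds by simp
      qed
    qed (use ln_dim_bounds in auto)
    finally show ?thesis by simp
  qed
  have first: "(m powr (1/p - 1/2)) powr p * (2 * (4000 * real d powr (p/2) + (ln (1000 * real r) + 4 * real d) powr (p - 1)))
     \<le> 4 * real K * (4000 + (1000 * real K + 6)) * (d * ln d)"
  proof -
    have "(m powr (1/p - 1/2)) powr p * (2 * (4000 * real d powr (p/2) + (ln (1000 * real r) + 4 * real d) powr (p - 1)))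
      \<le> (m powr (1/p - 1/2)) powr p * (2 * (4000 * real d powr (p/2) + (1000 * real K + 6) * d powr (p/2)))"
      using Ld by (intro mult_left_mono add_left_mono) auto
    also have "... = 2 * (4000 + (1000 * real K + 6)) * ((m powr (1/p - 1/2)) powr p * d powr (p/2))"
      by (simp add: algebra_simps)
    also have "... \<le> 2 * (4000 + (1000 * real K + 6)) * (2 * K * (d * ln d))"
      using mp by (intro mult_left_mono) auto
    finally show ?thesis by (simp add: algebra_simps)
  qed
  have second: "2 * (4000 * real d * (Cp + log 2 (4000 * real r) + 1)) \<le> 8000 * (2 * Cp + 2 * log 2 (4000 * real K) + 6) * (d * ln d)"
  proof -
    have l2: "1/2 \<le> ln (2::real)" using half_le_ln[of 2] by simp
    have "log 2 (4000 * real r) = log 2 (4000 * real K) + 2 * log 2 d"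
      using K d by (simp add: r_def log_mult log_nat_power)
    moreover have "log 2 d \<le> 2 * ln d"
    proof -
      have "ln d * 1 \<le> ln d * (2 * ln 2)" using l2 ln_dim_bounds by (intro mult_left_mono) auto
      then show ?thesis using l2 by (simp add: log_def field_simps)
    qed
    moreover have "Cp + log 2 (4000 * real K) + 1 \<le> (Cp + log 2 (4000 * real K) + 1) * (2 * ln d)"
    proof -
      have "0 \<le> log 2 (4000 * real K)" using K by (intro zero_le_log_cancel_iff[THEN iffD2]) auto
      then show ?thesis using Cp_ge_one ln_dim_bounds by (intro mult_le_cancel_left1[THEN iffD2]) auto
    qed
    ultimately have "Cp + log 2 (4000 * real r) + 1 \<le> (2 * Cp + 2 * log 2 (4000 * real K) + 6) * ln d"
      by (simp add: algebra_simps)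
    then have "8000 * d * (Cp + log 2 (4000 * real r) + 1) \<le> 8000 * d * ((2 * Cp + 2 * log 2 (4000 * real K) + 6) * ln d)"
      by (intro mult_left_mono) auto
    then show ?thesis by (simp add: mult_ac)
  qed
  show ?thesis using add_mono[OF first second] by (simp add: upper_const_def Cp_def[symmetric] algebra_simps)
qed

lemma embedding_probability:
  assumes N: "32 * real n \<le> 2 ^ N"
  shows "0.99 \<le> prb (sketch_pmf {..<n} r (level_pmf \<epsilon> N))
    {w. \<forall>x. \<eta> / 4 * (mass p n (mat_vec d A x)) \<le> embed_powr p n r w m (mat_vec d A x) \<and>
      embed_powr p n r w m (mat_vec d A x) \<le> upper_const p K * (d * ln d) * (mass p n (mat_vec d A x))}"
    (is "_ \<le> prb ?P ?good")
proof -
  obtain U where U: "\<And>x. \<exists>y. (\<forall>j<n. mat_vec d A x j = mat_vec d U y j) \<and>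
      (sq_norm d y) powr (p/2) \<le> 2 * (mass p n (mat_vec d A x))"
    "(\<Sum>j<n. (sq_norm d (U j)) powr (p/2)) \<le> 2 * d"
    using lewis_basis[OF p, of n d A] by blast
  have d1: "1 \<le> d" using d by simp
  have fin: "finite (set_pmf (level_pmf \<epsilon> N))" by (rule finite_set_level_pmf[OF \<epsilon>])
  define B1 where "B1 = {w :: nat \<Rightarrow> nat \<times> bool \<times> nat. \<exists>x. (\<Sum>b<r. (sign_sketch n (mat_vec d A x) w b)\<^sup>2)
      < (\<Sum>j<n. (mat_vec d A x j)\<^sup>2) / 2}"
  define B2 where "B2 = {w :: nat \<Rightarrow> nat \<times> bool \<times> nat. \<exists>x. 2 * (2000 * real d powr (p/2) * (sq_norm d x) powr (p/2)
        + (ln (1000 * real r) + 4 * real d) powr (p - 1) * (mass p n (mat_vec d U x)))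
      < (\<Sum>b<r. \<bar>sign_sketch n (mat_vec d U x) w b\<bar> powr p)}"
  define B3 where "B3 = {w. \<exists>x. 4000 * real d * (Cp + log 2 (4000 * real r) + 1) * (sq_norm d x) powr (p/2)
      < (\<Sum>b<r. \<bar>heavy_sketch p n (mat_vec d U x) w b\<bar> powr p)}"
  define B4 where "B4 = {w. \<exists>g\<in>grid d (grid_size K d). 1/8 \<le> (\<Sum>j<n. if \<bar>mat_vec d U g j\<bar> powr p \<le> 1/m then \<bar>mat_vec d U g j\<bar> powr p else 0) \<and>
        real (card {b. b < r \<and> 1/m \<le> \<bar>heavy_sketch p n (mat_vec d U g) w b\<bar> powr p}) \<le> \<epsilon> / 512 * m}"
  have "prb ?P B1 \<le> 8 * (real d)\<^sup>2 / r"
    unfolding B1_def by (rule sketch_l2_lower_tail[OF num_rows_pos fin])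
  also have "... \<le> 1/1000"
  proof -
    have "8000 * (real d)\<^sup>2 \<le> real K * (real d)\<^sup>2" using K by (intro mult_right_mono) auto
    then have "8000 * (real d)\<^sup>2 \<le> real r" by (simp add: r_def)
    then show ?thesis using num_rows_pos by (simp add: field_simps)
  qed
  finally have P1: "prb ?P B1 \<le> 1/1000" .
  have P2: "prb ?P B2 \<le> 1/1000 + 1/1000"
    unfolding B2_def by (rule countsketch_upper_tail[OF p d1 U(2) num_rows_pos fin])
  have P3: "prb ?P B3 \<le> 1/1000 + 1/1000 + 1/1000"
    unfolding B3_def Cp_def by (rule stable_sketch_upper_tail[OF p d1 U(2) num_rows_pos \<epsilon>])
  have "prb ?P B4 \<le> (4 * real (grid_size K d) + 3) ^ d * (2 * exp (- (\<epsilon> / 512 * m)))"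
    unfolding B4_def by (rule flat_grid_lower_tail[OF \<epsilon> p m_bounds(1,2) N])
  also have "... \<le> 1/1000" using net_size_le by (simp add: \<eta>_def)
  finally have P4: "prb ?P B4 \<le> 1/1000" .
  define B where "B = B1 \<union> B2 \<union> B3 \<union> B4"
  \<comment> \<open>The four events cost 1, 2, 3 and 1 thousandths, 0.007 in total.\<close>
  have PB: "prb ?P B \<le> 0.01"
    unfolding B_def using prob_Un_le[OF prob_Un_le[OF prob_Un_le[OF P1 P2] P3] P4] by simp
  have "- B \<subseteq> ?good"
  proof (intro subsetI CollectI allI)
    fix w x assume "w \<in> - B"
    then have nB: "w \<notin> B1" "w \<notin> B2" "w \<notin> B3" "w \<notin> B4" by (auto simp: B_def)
    define Ct where "Ct = 4000 * real d * (Cp + log 2 (4000 * real r) + 1)"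
    define Ld where "Ld = ln (1000 * real r) + 4 * real d"
    have Ct0: "0 \<le> Ct"
    proof -
      have "0 \<le> log 2 (4000 * real r)" using num_rows_pos by (intro zero_le_log_cancel_iff[THEN iffD2]) auto
      then show ?thesis using Cp_ge_one by (simp add: Ct_def)
    qed
    have S_low: "(\<Sum>j<n. (mat_vec d A x j)\<^sup>2) / 2 \<le> (\<Sum>b<r. (sign_sketch n (mat_vec d A x) w b)\<^sup>2)" for x
      using nB(1) unfolding B1_def by (auto simp: not_less)
    have S_up: "(\<Sum>b<r. \<bar>sign_sketch n (mat_vec d U y) w b\<bar> powr p) \<le>
      2 * (2000 * real d powr (p/2) * (sq_norm d y) powr (p/2) + Ld powr (p - 1) * (mass p n (mat_vec d U y)))" for y
      using nB(2) unfolding B2_def Ld_def by (auto simp: not_less)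
    have T_up: "(\<Sum>b<r. \<bar>heavy_sketch p n (mat_vec d U y) w b\<bar> powr p) \<le>
      Ct * (sq_norm d y) powr (p/2)" for y
      using nB(3) unfolding B3_def Ct_def by (auto simp: not_less)
    have net: "\<eta> * m < real (card {b. b < r \<and> 1/m \<le> \<bar>heavy_sketch p n (mat_vec d U g) w b\<bar> powr p})"
      if "g \<in> grid d (grid_size K d)" "1/8 \<le> (\<Sum>j<n. if \<bar>mat_vec d U g j\<bar> powr p \<le> 1/m then \<bar>mat_vec d U g j\<bar> powr p else 0)" for g
    proof (rule ccontr)
      assume "\<not> ?thesis"
      then have "w \<in> B4" unfolding B4_def using that by (auto simp: \<eta>_def not_less intro!: bexI[of _ g])
      then show False using nB(4) by contradiction
    qed
    have K1: "1 \<le> real K" using K by simp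
    have d3: "1 \<le> real d ^ 3" "1 \<le> real d" using d by auto
    have K2: "16 \<le> (real K)\<^sup>2" using power_mono[of 4 "real K" 2] K by simp
    have e1: "grid_error K d \<le> 1"
    proof -
      have "1 * 1 \<le> (real K)\<^sup>2 * real d ^ 3" using K2 d3 by (intro mult_mono) auto
      then have "1 / ((real K)\<^sup>2 * real d ^ 3) \<le> 1" by simp
      then show ?thesis using grid_error_le by linarith
    qed
    have e2: "(grid_error K d)\<^sup>2 = d / (real (grid_size K d))\<^sup>2" by (simp add: grid_error_def power_divide)
    have e3: "2 * d * grid_error K d \<le> 1/4"
    proof -
      have "2 * d * grid_error K d \<le> 2 * d * (1 / ((real K)\<^sup>2 * real d ^ 3))"
        using grid_error_le by (intro mult_left_mono) auto
      also have "... = 2 / ((real K)\<^sup>2 * (real d)\<^sup>2)" using d K by (simp add: field_simps power2_eq_square power3_eq_cube)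
      also have "... \<le> 2 / (16 * 1)" using K K2 d by (intro divide_left_mono mult_mono) auto
      finally show ?thesis by simp
    qed
    have e4: "Ct * grid_error K d \<le> \<eta> / 4" using stable_constant_le by (simp add: Ct_def)
    have e5: "(2 * real d)\<^sup>2 * m * (grid_error K d)\<^sup>2 \<le> 1/64"
    proof -
      have "(2 * real d)\<^sup>2 * m * (grid_error K d)\<^sup>2 \<le> (2 * real d)\<^sup>2 * (K * (real d)\<^sup>2) * (1 / ((real K)\<^sup>2 * real d ^ 3))\<^sup>2"
        using m_bounds grid_error_le by (intro mult_mono mult_left_mono power_mono) auto
      also have "... = 4 / (real K ^ 3 * (real d)\<^sup>2)"
        using d K by (simp add: field_simps power2_eq_square power3_eq_cube)
      also have "... \<le> 4 / (256 * 1)"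
      proof (intro divide_left_mono mult_mono)
        have "16 * 16 \<le> real K * (real K)\<^sup>2" using K K2 by (intro mult_mono) auto
        then show "256 \<le> real K ^ 3" by (simp add: power2_eq_square power3_eq_cube)
      qed (use d K in auto)
      finally show ?thesis by simp
    qed
    have low: "\<eta> / 4 * (mass p n (mat_vec d A x)) \<le> embed_powr p n r w m (mat_vec d A x)"
      by (rule embed_powr_lower[OF p U S_low S_up T_up net m_bounds(1) eta_bounds grid_size_pos Ct0 grid_error_le(1) e1 e2 e3 e4 e5])
    have up: "embed_powr p n r w m (mat_vec d A x) \<le>
      ((m powr (1/p - 1/2)) powr p * (2 * (4000 * real d powr (p/2) + Ld powr (p - 1))) + 2 * Ct) * (mass p n (mat_vec d A x))"
      by (rule embed_powr_upper[OF p U S_low S_up T_up net m_bounds(1) eta_bounds grid_size_pos Ct0 grid_error_le(1) e1 e2 e3 e4 e5])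
    also have "... \<le> upper_const p K * (d * ln d) * (mass p n (mat_vec d A x))"
      using upper_bound_le unfolding Ct_def Ld_def by (intro mult_right_mono) (auto intro: sum_nonneg)
    finally show "\<eta> / 4 * (mass p n (mat_vec d A x)) \<le> embed_powr p n r w m (mat_vec d A x) \<and>
      embed_powr p n r w m (mat_vec d A x) \<le> upper_const p K * (d * ln d) * (mass p n (mat_vec d A x))"
      using low by blast
  qed
  then have "prb ?P (- B) \<le> prb ?P ?good"
    by (intro measure_pmf.finite_measure_mono) auto
  moreover have "prb ?P (- B) = 1 - prb ?P B"
    using measure_pmf.prob_compl[of B ?P] by (simp add: Compl_eq_Diff_UNIV)
  ultimately show ?thesis using PB by simp
qed

end

section \<open>The random matrix\<close>

text \<open>The two blocks of \<open>r\<close> rows are stacked. Column \<open>j\<close> meets row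
  \<open>h\<close> and, unless its level is 0, row \<open>h + r\<close>; this gives the sparsity for
  every outcome and the expected count through the probability of a nonzero level.\<close>

definition sketch_matrix :: "real \<Rightarrow> real \<Rightarrow> nat \<Rightarrow> nat \<Rightarrow> (nat \<Rightarrow> nat \<times> bool \<times> nat) \<Rightarrow> nat \<Rightarrow> nat \<Rightarrow> real" where
  "sketch_matrix \<alpha> p r n w i j = (if n \<le> j then 0 else case w j of (h, s, l) \<Rightarrow>
    if i < r then (if h = i then \<alpha> * sgn_of s else 0)
    else if i < 2 * r then (if h = i - r then sgn_of s * level_entry p l else 0) else 0)"

lemma mat_vec_sketch_matrix:
  "mat_vec n (sketch_matrix \<alpha> p r n w) y i =
    (if i < r then \<alpha> * sign_sketch n y w i
     else if i < 2 * r then heavy_sketch p n y w (i - r) else 0)"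
proof -
  have "sketch_matrix \<alpha> p r n w i j * y j =
    (if i < r then \<alpha> * (case w j of (h, s, l) \<Rightarrow> if h = i then sgn_of s * y j else 0)
     else if i < 2 * r then (case w j of (h, s, l) \<Rightarrow> if h = i - r then sgn_of s * (level_entry p l * y j) else 0) else 0)"
    if "j < n" for j using that by (auto simp: sketch_matrix_def split: prod.splits)
  then show ?thesis by (simp add: mat_vec_def bucket_sum_def sum_distrib_left)
qed

lemma lp_norm_sketch_matrix:
  assumes "0 \<le> \<alpha>" "0 < p" "\<alpha> = m powr (1/p - 1/2)"
  shows "lp_norm p (2 * r) (mat_vec n (sketch_matrix \<alpha> p r n w) y) = embed_powr p n r w m y powr (1/p)"
proof -
  let ?v = "mat_vec n (sketch_matrix \<alpha> p r n w) y"
  have "(\<Sum>i<2 * r. \<bar>?v i\<bar> powr p) = (\<Sum>i<r. \<bar>?v i\<bar> powr p) + (\<Sum>i<r. \<bar>?v (i + r)\<bar> powr p)"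
  proof -
    have "(\<Sum>i<2 * r. \<bar>?v i\<bar> powr p) = (\<Sum>i = 0..<r. \<bar>?v i\<bar> powr p) + (\<Sum>i = r..<2 * r. \<bar>?v i\<bar> powr p)"
      unfolding lessThan_atLeast0 by (rule sum.atLeastLessThan_concat[symmetric]) auto
    also have "(\<Sum>i = r..<2 * r. \<bar>?v i\<bar> powr p) = (\<Sum>i = 0..<r. \<bar>?v (i + r)\<bar> powr p)"
      using sum.shift_bounds_nat_ivl[of "\<lambda>i. \<bar>?v i\<bar> powr p" 0 r r] by (simp add: mult_2)
    finally show ?thesis by (simp add: lessThan_atLeast0)
  qed
  also have "(\<Sum>i<r. \<bar>?v i\<bar> powr p) = \<alpha> powr p * (\<Sum>b<r. \<bar>sign_sketch n y w b\<bar> powr p)"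
    using assms(1) by (simp add: mat_vec_sketch_matrix abs_mult powr_mult sum_distrib_left)
  also have "(\<Sum>i<r. \<bar>?v (i + r)\<bar> powr p) = (\<Sum>b<r. \<bar>heavy_sketch p n y w b\<bar> powr p)"
    by (simp add: mat_vec_sketch_matrix)
  finally show ?thesis unfolding lp_norm_def embed_powr_def assms(3) by simp
qed

lemma card_nonzero_sketch_matrix_le:
  "card {i. i < 2 * r \<and> sketch_matrix \<alpha> p r n w i j \<noteq> 0} \<le> (if snd (snd (w j)) = 0 then 1 else 2)"
proof -
  obtain h s l where w: "w j = (h, s, l)" by (cases "w j")
  have "{i. i < 2 * r \<and> sketch_matrix \<alpha> p r n w i j \<noteq> 0} \<subseteq> (if l = 0 then {h} else {h, h + r})"
    by (auto simp: sketch_matrix_def w level_entry_def split: if_splits)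
  then have "card {i. i < 2 * r \<and> sketch_matrix \<alpha> p r n w i j \<noteq> 0} \<le> card (if l = 0 then {h} else {h, h + r})"
    by (intro card_mono) auto
  also have "... \<le> (if l = 0 then 1 else 2)" by (auto simp: card_insert_if)
  finally show ?thesis by (simp add: w)
qed

section \<open>Measurability of the embedding event\<close>

lemma space_matrix_space [simp]: "space matrix_space = UNIV"
  by (simp add: matrix_space_def space_PiM)

lemma measurable_matrix_entry [measurable]: "(\<lambda>P. P i j) \<in> borel_measurable matrix_space"
proof -
  have "(\<lambda>P. P i) \<in> matrix_space \<rightarrow>\<^sub>M PiM UNIV (\<lambda>_. borel)"
    unfolding matrix_space_def by (rule measurable_component_singleton) simp
  moreover have "(\<lambda>v. v j) \<in> borel_measurable (PiM UNIV (\<lambda>_. borel :: real measure))"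
    by (rule measurable_component_singleton) simp
  ultimately show ?thesis by (rule measurable_compose)
qed

lemma measurable_lp_norm_mat_vec [measurable]:
  "(\<lambda>P. lp_norm p r (mat_vec n P y)) \<in> borel_measurable matrix_space"
  unfolding lp_norm_def mat_vec_def by measurable

lemma tendsto_mat_vec:
  assumes "\<And>k. k < d \<Longrightarrow> (\<lambda>i. X i k) \<longlonglongrightarrow> x k"
  shows "(\<lambda>i. mat_vec d A (X i) j) \<longlonglongrightarrow> mat_vec d A x j"
  unfolding mat_vec_def using assms by (intro tendsto_intros) auto

lemma tendsto_lp_norm:
  assumes "0 < p" "\<And>j. j < n \<Longrightarrow> (\<lambda>i. Y i j) \<longlonglongrightarrow> y j"
  shows "(\<lambda>i. lp_norm p n (Y i)) \<longlonglongrightarrow> lp_norm p n y"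
proof -
  have "(\<lambda>i. \<bar>Y i j\<bar> powr p) \<longlonglongrightarrow> \<bar>y j\<bar> powr p" if "j < n" for j
    using assms that by (intro tendsto_powr') (auto intro!: tendsto_intros)
  then have "(\<lambda>i. \<Sum>j<n. \<bar>Y i j\<bar> powr p) \<longlonglongrightarrow> (mass p n y)"
    by (intro tendsto_sum) auto
  then show ?thesis
    unfolding lp_norm_def using assms
    by (intro tendsto_powr') (auto intro!: tendsto_intros always_eventually sum_nonneg)
qed

text \<open>Lists form a countable index type; padding with 0 makes them dense in the first
  \<open>d\<close> coordinates, the only ones that matter.\<close>

definition rat_vector :: "rat list \<Rightarrow> nat \<Rightarrow> real" where
  "rat_vector q k = (if k < length q then of_rat (q ! k) else 0)"

lemma rat_vector_dense:
  fixes x :: "nat \<Rightarrow> real"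
  obtains q where "\<And>k. k < d \<Longrightarrow> (\<lambda>i. rat_vector (q i) k) \<longlonglongrightarrow> x k"
proof -
  have "\<exists>a. \<bar>of_rat a - x k\<bar> < 1 / Suc i" for k i
  proof -
    obtain a where "x k < of_rat a" "of_rat a < x k + 1 / Suc i"
      using of_rat_dense[of "x k" "x k + 1 / Suc i"] by auto
    then have "\<bar>of_rat a - x k\<bar> < 1 / Suc i" by linarith
    then show ?thesis by blast
  qed
  then obtain a where a: "\<bar>of_rat (a k i) - x k\<bar> < 1 / Suc i" for k i by metis
  show thesis
  proof (rule that[of "\<lambda>i. map (\<lambda>k. a k i) [0..<d]"])
    fix k assume k: "k < d"
    have "(\<lambda>i. of_rat (a k i) - x k) \<longlonglongrightarrow> 0"
    proof (rule Lim_null_comparison)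
      show "\<forall>\<^sub>F i in sequentially. norm (of_rat (a k i) - x k) \<le> 1 / Suc i"
        using a by (intro always_eventually) (auto simp: less_imp_le)
      show "(\<lambda>i. 1 / Suc i) \<longlonglongrightarrow> (0 :: real)" using LIMSEQ_inverse_real_of_nat by (simp add: inverse_eq_divide)
    qed
    then have "(\<lambda>i. of_rat (a k i)) \<longlonglongrightarrow> x k" by (simp add: LIM_zero_iff)
    then show "(\<lambda>i. rat_vector (map (\<lambda>k. a k i) [0..<d]) k) \<longlonglongrightarrow> x k"
      using k by (simp add: rat_vector_def)
  qed
qed

text \<open>The quantifier over all real \<open>x\<close> is uncountable. Both norms are continuous
  in \<open>x\<close> and the inequalities are closed, so it may be restricted to rational
  vectors.\<close>

lemma measurable_embedding_event:
  assumes p: "0 < p"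
  shows "{P \<in> space matrix_space. \<forall>x. c * lp_norm p n (mat_vec d A x) \<le> lp_norm p r (mat_vec n P (mat_vec d A x)) \<and>
      lp_norm p r (mat_vec n P (mat_vec d A x)) \<le> D * lp_norm p n (mat_vec d A x)} \<in> sets matrix_space"
    (is "{P \<in> _. \<forall>x. ?Q P x} \<in> _")
proof -
  have "(\<forall>x. ?Q P x) \<longleftrightarrow> (\<forall>q. ?Q P (rat_vector q))" for P
  proof (intro iffI allI)
    fix x assume Q: "\<forall>q. ?Q P (rat_vector q)"
    obtain q where q: "\<And>k. k < d \<Longrightarrow> (\<lambda>i. rat_vector (q i) k) \<longlonglongrightarrow> x k"
      using rat_vector_dense[of d x] by blast
    have l1: "(\<lambda>i. lp_norm p n (mat_vec d A (rat_vector (q i)))) \<longlonglongrightarrow> lp_norm p n (mat_vec d A x)"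
      by (intro tendsto_lp_norm p tendsto_mat_vec q)
    have l2: "(\<lambda>i. lp_norm p r (mat_vec n P (mat_vec d A (rat_vector (q i))))) \<longlonglongrightarrow> lp_norm p r (mat_vec n P (mat_vec d A x))"
      by (intro tendsto_lp_norm p tendsto_mat_vec q)
    show "?Q P x"
    proof
      show "c * lp_norm p n (mat_vec d A x) \<le> lp_norm p r (mat_vec n P (mat_vec d A x))"
        using Q by (intro LIMSEQ_le[OF tendsto_mult[OF tendsto_const l1] l2]) auto
      show "lp_norm p r (mat_vec n P (mat_vec d A x)) \<le> D * lp_norm p n (mat_vec d A x)"
        using Q by (intro LIMSEQ_le[OF l2 tendsto_mult[OF tendsto_const l1]]) auto
    qed
  qed auto
  moreover have "{P \<in> space matrix_space. \<forall>q. ?Q P (rat_vector q)} \<in> sets matrix_space"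
    by (intro sets.sets_Collect_countable_All) measurable
  ultimately show ?thesis by simp
qed

theorem theorem8:
  fixes p \<epsilon> :: real
  assumes "1 \<le> p" "p < 2" "0 < \<epsilon>" "\<epsilon> < 1"
  shows "\<exists>c C :: real. c > 0 \<and> C > 0 \<and>
    (\<forall>d n :: nat. d \<ge> 2 \<longrightarrow> n \<ge> 1 \<longrightarrow>
      (\<exists>(r :: nat) (M :: (nat \<Rightarrow> nat \<Rightarrow> real) measure).
         real r \<le> C * (real d)\<^sup>2 \<and>
         prob_space M \<and> sets M = sets matrix_space \<and>
         (AE P in M. (\<forall>i j. (i \<ge> r \<or> j \<ge> n) \<longrightarrow> P i j = 0) \<and>
                      (\<forall>j<n. card {i. i < r \<and> P i j \<noteq> 0} \<le> 2)) \<and>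
         (\<forall>j<n. (\<integral>\<^sup>+ P. ennreal (real (card {i. i < r \<and> P i j \<noteq> 0})) \<partial>M)
                   \<le> ennreal (1 + \<epsilon>)) \<and>
         (\<forall>A :: nat \<Rightarrow> nat \<Rightarrow> real.
            measure M {P \<in> space M. \<forall>x :: nat \<Rightarrow> real.
               c * lp_norm p n (mat_vec d A x) \<le> lp_norm p r (mat_vec n P (mat_vec d A x)) \<and>
               lp_norm p r (mat_vec n P (mat_vec d A x))
                 \<le> C * (real d * ln (real d)) powr (1 / p) * lp_norm p n (mat_vec d A x)}
            \<ge> 0.99)))"
proof -
  define \<eta> where "\<eta> = \<epsilon> / 512"
  define Cp where "Cp = 1 / (1 - 2 powr (1 - 2/p))"
  have \<eta>: "0 < \<eta>" "\<eta> \<le> 1" using assms by (auto simp: \<eta>_def)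
  obtain K :: nat where K: "8000 \<le> K" "16000 / \<eta> * (Cp + 1 + 4000 * real K) \<le> (real K)\<^sup>2"
    "2 * ln (14000 * (real K)\<^sup>2) + 4 \<le> \<eta> * K"
    by (rule exists_size_parameter[OF \<eta>(1), of Cp])
  define C0 where "C0 = upper_const p K"
  \<comment> \<open>\<open>C0\<close> does not involve the dimension; \<open>order_refl\<close>
    instantiates the dimension of the lemma's context with 2.\<close>
  have C0: "1 \<le> C0"
    unfolding C0_def by (rule upper_const_ge[OF assms(1,2,3,4) order_refl K[unfolded \<eta>_def Cp_def]])
  \<comment> \<open>One constant serves two purposes: \<open>C0\<close> bounds the distortion,
    \<open>2 * K\<close> the number \<open>2 * r\<close> of rows.\<close>
  define c C where "c = \<eta> / 4" and "C = C0 + 2 * K"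
  have c: "0 < c" "c \<le> 1" using \<eta> by (auto simp: c_def)
  have C: "0 < C" "C0 \<le> C" using C0 by (auto simp: C_def)
  have p0: "0 < p" using assms by simp
  have main: "\<exists>(r :: nat) (M :: (nat \<Rightarrow> nat \<Rightarrow> real) measure).
         real r \<le> C * (real d)\<^sup>2 \<and>
         prob_space M \<and> sets M = sets matrix_space \<and>
         (AE P in M. (\<forall>i j. (i \<ge> r \<or> j \<ge> n) \<longrightarrow> P i j = 0) \<and>
                      (\<forall>j<n. card {i. i < r \<and> P i j \<noteq> 0} \<le> 2)) \<and>
         (\<forall>j<n. (\<integral>\<^sup>+ P. ennreal (real (card {i. i < r \<and> P i j \<noteq> 0})) \<partial>M)
                   \<le> ennreal (1 + \<epsilon>)) \<and>
         (\<forall>A :: nat \<Rightarrow> nat \<Rightarrow> real.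
            measure M {P \<in> space M. \<forall>x :: nat \<Rightarrow> real.
               c * lp_norm p n (mat_vec d A x) \<le> lp_norm p r (mat_vec n P (mat_vec d A x)) \<and>
               lp_norm p r (mat_vec n P (mat_vec d A x))
                 \<le> C * (real d * ln (real d)) powr (1 / p) * lp_norm p n (mat_vec d A x)}
            \<ge> 0.99)" if d: "2 \<le> d" for d n :: nat
  proof -
    define r where "r = K * d\<^sup>2"
    define m where "m = real K * d * ln d"
    \<comment> \<open>\<open>2 ^ 5 = 32\<close> gives \<open>32 * n \<le> 2 ^ N\<close>; the cutoff
      may depend on \<open>n\<close> since no bound involves \<open>N\<close>.\<close>
    define N where "N = n + 5"
    define \<alpha> where "\<alpha> = m powr (1/p - 1/2)"
    define L where "L = level_pmf \<epsilon> N"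
    define Q where "Q = sketch_pmf {..<n} r L"
    define F where "F = sketch_matrix \<alpha> p r n"
    define M where "M = distr (measure_pmf Q) matrix_space F"
    have r: "0 < r" using K d by (simp add: r_def)
    have finL: "finite (set_pmf L)" unfolding L_def by (rule finite_set_level_pmf[OF assms(3,4)])
    have F[measurable]: "F \<in> measurable (measure_pmf Q) matrix_space" by simp
    have ps: "prob_space M" unfolding M_def by (rule measure_pmf.prob_space_distr[OF F])
    have setsM: "sets M = sets matrix_space" by (simp add: M_def)
    have card_eq: "real (card {i. i < 2 * r \<and> P i j \<noteq> 0}) = (\<Sum>i<2 * r. if P i j = 0 then 0 else 1)" for P :: "nat \<Rightarrow> nat \<Rightarrow> real" and j
    proof -
      have "(\<Sum>i<2 * r. if P i j = 0 then 0 else 1 :: real) = (\<Sum>i\<in>{i \<in> {..<2 * r}. P i j \<noteq> 0}. 1)"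
        by (subst sum.inter_filter) (auto intro!: sum.cong)
      then show ?thesis by simp
    qed
    have card_meas[measurable]: "(\<lambda>P. real (card {i. i < 2 * r \<and> P i j \<noteq> 0})) \<in> borel_measurable matrix_space" for j
      unfolding card_eq by measurable
    have ae: "AE P in M. (\<forall>i j. (i \<ge> 2 * r \<or> j \<ge> n) \<longrightarrow> P i j = 0) \<and>
        (\<forall>j<n. card {i. i < 2 * r \<and> P i j \<noteq> 0} \<le> 2)"
    proof -
      have "AE P in M. (\<forall>i j. (i \<ge> 2 * r \<or> j \<ge> n) \<longrightarrow> P i j = 0) \<and>
        (\<forall>j<n. real (card {i. i < 2 * r \<and> P i j \<noteq> 0}) \<le> 2)"
        unfolding M_def
      proof (subst AE_distr_iff)
        show "{P \<in> space matrix_space. (\<forall>i j. (i \<ge> 2 * r \<or> j \<ge> n) \<longrightarrow> P i j = 0) \<and>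
          (\<forall>j<n. real (card {i. i < 2 * r \<and> P i j \<noteq> 0}) \<le> 2)} \<in> sets matrix_space"
          by measurable
        have "card {i. i < 2 * r \<and> F w i j \<noteq> 0} \<le> 2" for w j
          unfolding F_def by (rule order_trans[OF card_nonzero_sketch_matrix_le]) simp
        then have "real (card {i. i < 2 * r \<and> F w i j \<noteq> 0}) \<le> 2" for w j
          by (metis of_nat_le_iff of_nat_numeral)
        moreover have "F w i j = 0" if "i \<ge> 2 * r \<or> j \<ge> n" for w i j
          using that by (auto simp: F_def sketch_matrix_def split: prod.splits)
        ultimately show "AE w in measure_pmf Q. (\<forall>i j. (i \<ge> 2 * r \<or> j \<ge> n) \<longrightarrow> F w i j = 0) \<and>
          (\<forall>j<n. real (card {i. i < 2 * r \<and> F w i j \<noteq> 0}) \<le> 2)" by (intro always_eventually allI) blast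
      qed (rule F)
      then show ?thesis by eventually_elim auto
    qed
    have nnz: "(\<integral>\<^sup>+ P. ennreal (real (card {i. i < 2 * r \<and> P i j \<noteq> 0})) \<partial>M) \<le> ennreal (1 + \<epsilon>)" if j: "j < n" for j
    proof -
      have "(\<integral>\<^sup>+ P. ennreal (real (card {i. i < 2 * r \<and> P i j \<noteq> 0})) \<partial>M)
        = (\<integral>\<^sup>+ w. ennreal (real (card {i. i < 2 * r \<and> F w i j \<noteq> 0})) \<partial>measure_pmf Q)"
        unfolding M_def by (rule nn_integral_distr[OF F]) measurable
      also have "... \<le> (\<integral>\<^sup>+ w. ennreal (1 + (if snd (snd (w j)) = 0 then 0 else 1)) \<partial>measure_pmf Q)"
      proof (intro nn_integral_mono ennreal_leI)
        fix w
        show "real (card {i. i < 2 * r \<and> F w i j \<noteq> 0}) \<le> 1 + (if snd (snd (w j)) = 0 then 0 else 1)"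
          using card_nonzero_sketch_matrix_le[of r \<alpha> p n w j] unfolding F_def by (auto split: if_splits)
      qed
      also have "... = ennreal (avg Q (\<lambda>w. 1 + (if snd (snd (w j)) = 0 then 0 else 1)))"
        using r finL by (intro nn_integral_eq_integral integrable_measure_pmf_finite) (auto simp: Q_def)
      also have "avg Q (\<lambda>w. 1 + (if snd (snd (w j)) = 0 then 0 else 1)) = avg L (\<lambda>l. 1 + (if l = 0 then 0 else 1))"
        unfolding Q_def using j r finL by (intro avg_sketch_pmf_component) auto
      also have "... = 1 + avg L (\<lambda>l. if l = 0 then 0 else 1)"
        using finL by (simp add: avg_add)
      also have "... \<le> 1 + \<epsilon>" unfolding L_def using avg_level_nonzero_le[OF assms(3,4)] by simp
      finally show ?thesis by (simp add: ennreal_leI)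
    qed
    have emb: "0.99 \<le> measure M {P \<in> space M. \<forall>x :: nat \<Rightarrow> real.
               c * lp_norm p n (mat_vec d A x) \<le> lp_norm p (2 * r) (mat_vec n P (mat_vec d A x)) \<and>
               lp_norm p (2 * r) (mat_vec n P (mat_vec d A x))
                 \<le> C * (real d * ln (real d)) powr (1 / p) * lp_norm p n (mat_vec d A x)}"
      (is "_ \<le> measure M {P \<in> space M. ?E P}") for A :: "nat \<Rightarrow> nat \<Rightarrow> real"
    proof -
      have "32 * real n \<le> 2 ^ N"
      proof -
        have "real n \<le> 2 ^ n" using of_nat_less_two_power[of n, where 'a = real] by simp
        then show ?thesis by (simp add: N_def power_add)
      qed
      then have "0.99 \<le> prb Q
        {w. \<forall>x. c * (mass p n (mat_vec d A x)) \<le> embed_powr p n r w m (mat_vec d A x) \<and>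
          embed_powr p n r w m (mat_vec d A x) \<le> C0 * (d * ln d) * (mass p n (mat_vec d A x))}"
        (is "_ \<le> prb Q ?good")
        unfolding Q_def L_def c_def C0_def \<eta>_def m_def r_def
        by (intro embedding_probability[OF assms d K[unfolded \<eta>_def Cp_def]])
      also have "... \<le> prb Q {w. ?E (F w)}"
      proof (intro measure_pmf.finite_measure_mono subsetI CollectI allI)
        fix w x assume "w \<in> ?good"
        define S where "S = (mass p n (mat_vec d A x))"
        have S: "0 \<le> S" by (simp add: S_def sum_nonneg)
        have ln: "0 \<le> real d * ln d" using d by simp
        have good: "c * S \<le> embed_powr p n r w m (mat_vec d A x)"
          "embed_powr p n r w m (mat_vec d A x) \<le> C0 * (d * ln d) * S"
          using \<open>w \<in> ?good\<close> by (auto simp: S_def)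
        have nF: "lp_norm p (2 * r) (mat_vec n (F w) (mat_vec d A x)) = embed_powr p n r w m (mat_vec d A x) powr (1/p)"
          unfolding F_def using p0 by (intro lp_norm_sketch_matrix) (auto simp: \<alpha>_def)
        have nA: "lp_norm p n (mat_vec d A x) = S powr (1/p)" by (simp add: lp_norm_def S_def)
        have p1: "1/p \<le> 1" using assms by simp
        \<comment> \<open>Roots of the bounds on \<open>p\<close>-th powers produce
          \<open>c powr (1/p)\<close> and \<open>C0 powr (1/p)\<close>;
          \<open>c \<le> 1 \<le> C0\<close> and \<open>1/p \<le> 1\<close> allow the constants
          themselves.\<close>
        have "c * S powr (1/p) \<le> c powr (1/p) * S powr (1/p)"
        proof (intro mult_right_mono)
          have "c powr 1 \<le> c powr (1/p)" using c p1 by (intro powr_mono') auto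
          then show "c \<le> c powr (1/p)" using c by simp
        qed simp
        also have "... = (c * S) powr (1/p)" using c S by (simp add: powr_mult)
        also have "... \<le> embed_powr p n r w m (mat_vec d A x) powr (1/p)"
          using good c S p0 by (intro powr_mono2) auto
        finally have lower: "c * lp_norm p n (mat_vec d A x) \<le> lp_norm p (2 * r) (mat_vec n (F w) (mat_vec d A x))"
          by (simp add: nF nA)
        have "embed_powr p n r w m (mat_vec d A x) powr (1/p) \<le> (C0 * (d * ln d) * S) powr (1/p)"
          using good(2) p0 order_trans[OF mult_nonneg_nonneg good(1)] c S by (intro powr_mono2) simp_all
        also have "... = C0 powr (1/p) * ((d * ln d) powr (1/p) * S powr (1/p))"
          using C0 ln S by (simp add: powr_mult mult.assoc)
        also have "... \<le> C * ((d * ln d) powr (1/p) * S powr (1/p))"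
        proof (intro mult_right_mono)
          have "C0 powr (1/p) \<le> C0 powr 1" using C0 p1 by (intro powr_mono) auto
          then show "C0 powr (1/p) \<le> C" using C C0 by simp
        qed simp
        finally show "c * lp_norm p n (mat_vec d A x) \<le> lp_norm p (2 * r) (mat_vec n (F w) (mat_vec d A x)) \<and>
          lp_norm p (2 * r) (mat_vec n (F w) (mat_vec d A x)) \<le> C * (real d * ln (real d)) powr (1 / p) * lp_norm p n (mat_vec d A x)"
          using lower by (simp add: nF nA mult.assoc)
      qed simp
      also have "... = measure M {P \<in> space M. ?E P}"
      proof -
        have "{P \<in> space matrix_space. ?E P} \<in> sets matrix_space"
          by (rule measurable_embedding_event[OF p0])
        then have "measure M {P \<in> space matrix_space. ?E P} = prb Q (F -` {P \<in> space matrix_space. ?E P} \<inter> space (measure_pmf Q))"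
          unfolding M_def by (intro measure_distr F)
        then show ?thesis by (simp add: M_def vimage_def)
      qed
      finally show ?thesis .
    qed
    have "real (2 * r) \<le> C * (real d)\<^sup>2"
    proof -
      have "2 * real K * (real d)\<^sup>2 \<le> C * (real d)\<^sup>2" using C0 by (intro mult_right_mono) (auto simp: C_def)
      then show ?thesis by (simp add: r_def)
    qed
    then show ?thesis using ps setsM ae nnz emb by blast
  qed
  show ?thesis
    by (intro exI[of _ c] exI[of _ C] conjI c C allI impI main)
qed

end
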